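(* Let $\mathfrak{T}=\{r_{\boldsymbol y}:\boldsymbol y\in\mathbb{U}\}$ be the affine-parametric set of domain transformations described in the context. Suppose that $\mathfrak{T}$ fulfills Assumptions (T), (P) and (K) of the context, and that the incident field $u^{\mathrm{inc}}$ is entire. In addition, assume that $\boldsymbol b\in\ell^p(\mathbb{N})$ for some $0<p<1$. Let $\Omega$ be a bounded Lipschitz domain with boundary $\partial\Omega$, and let $0<h<h_0$ with $h_0$ as in the context. Then for each $x\in\partial\Omega$ the map $$\mathcal{F}:\mathbb{U}\to\mathbb{C}:\ \boldsymbol y\mapsto\big(\mathsf{N}^{(\kappa_0)}_{\boldsymbol y}(\beta u_{h,\boldsymbol y})\big)(x)$$ is $(\boldsymbol b,p,\varepsilon)$-holomorphic for some $\varepsilon>0$.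
   Context: Affine-parametric transformations. $\mathbb{U}=[-1,1]^{\mathbb{N}}$ with the product topology. The transformations are constructed in the two-dimensional case as follows. Let $\widehat\varrho,\varrho_j\in W^{1,\infty}_{\mathrm{per}}(0,2\pi)$ ($j\in\mathbb{N}$), $\varrho_{\boldsymbol y}(\varphi)=\widehat\varrho(\varphi)+\sum_{j\in\mathbb{N}}y_j\varrho_j(\varphi)$ for $\boldsymbol y\in\mathbb{U}$, and $\boldsymbol b=(b_j)_{j\in\mathbb{N}}$ with $b_j=\|\varrho_j\|_{W^{1,\infty}_{\mathrm{per}}(0,2\pi)}$. It is assumed that $\varrho_{\min}\le\widehat\varrho(\varphi)-\sum_j|\varrho_j(\varphi)|\le\widehat\varrho(\varphi)+\sum_j|\varrho_j(\varphi)|\le\varrho_{\max}$ for some $0<\varrho_{\min}<\varrho_{\max}<\infty$. The reference domain is $\widehat D=\{\vartheta(\cos\varphi,\sin\varphi)^\top:0\le\vartheta\le\widehat\varrho(\varphi),\ \varphi\in[0,2\pi)\}$ and $D_{\boldsymbol y}=\{\vartheta(\cos\varphi,\sin\varphi)^\top:0\le\vartheta\le\varrho_{\boldsymbol y}(\varphi),\ \varphi\in[0,2\pi)\}$ (domains understood up to their boundary). For $\widehat x=\sigma(\cos\varphi,\sin\varphi)^\top\in\widehat D$, $r_{\boldsymbol y}(\widehat x)=\frac{\varrho_{\boldsymbol y}(\varphi)}{\widehat\varrho(\varphi)}\widehat x=\widehat x+\sum_{j\ge1}y_j\frac{\varrho_j(\varphi)}{\widehat\varrho(\varphi)}\widehat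 x$, so $r_{\boldsymbol y}:\widehat D\to D_{\boldsymbol y}$. The paper writes $\mathfrak{T}\subset W^{1,\infty}(\widehat D;\mathbb{R}^d)$ with $d\in\{2,3\}$, and the formulas below are displayed for both values of $d$. Write $D_r=r(\widehat D)$ for $r\in\mathfrak{T}$. Assumption (T): $\mathfrak{T}$ is a compact subset of $W^{1,\infty}(\widehat D,\mathbb{R}^d)$ of bijective, bi-Lipschitz maps onto their images; for each $r\in\mathfrak{T}$, $r^{-1}\in W^{1,\infty}(D_r,\mathbb{R}^d)$ and $D_r$ is a simply connected, bounded Lipschitz domain. Assumption (P): there are $M\in\mathbb{N}$ and pairwise disjoint, simply connected, bounded Lipschitz domains $\widehat D^{(1)},\dots,\widehat D^{(M)}$ with $\widehat D=\mathrm{int}\bigcup_i\overline{\widehat D^{(i)}}$, such that for each $r\in\mathfrak{T}$ the sets $D_r^{(i)}:=r(\widehat D^{(i)})$ are pairwise disjoint, simply connected, bounded Lipschitz domains with $D_r=\mathrm{int}\bigcup_i\overline{D_r^{(i)}}$. Assumption (K): in the setting of (P), there are bounded Lipschitz domains $D_H^{(1)},\dots,D_H^{(M)}\subset\mathbb{R}^d$ with $\bigcup_{r\in\mathfrak{T}}D_r^{(i)}\subset\overline{D_H^{(i)}}$ for each $i$, such that the wavenumber $\kappa\in L^\infty(\bigcup_iD_H^{(i)})$ admits for each $i$ an analytic extension into an open neighborhood of $D_H^{(i)}$. Lippmann–Schwinger equation. Let $\kappa_0>0$, $\beta=\kappa^2-\kappa_0^2$, and, for $z\in\mathbb{R}^d\setminus\{0\}$,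 $G^{(\kappa_0)}(z)=\frac{\imath}{4}H_0^{(1)}(\kappa_0\|z\|)$ if $d=2$ ($H_0^{(1)}$ the Hankel function of the first kind, order zero) and $G^{(\kappa_0)}(z)=\frac{\exp(\imath\kappa_0\|z\|)}{4\pi\|z\|}$ if $d=3$. Let $(\mathsf{A}_ru)(x)=\int_{D_r}G^{(\kappa_0)}(x-\xi)\beta(\xi)u(\xi)\,d\xi$ for $x\in D_r$, $\tau_ru=u\circ r$, $\widehat{\mathsf{A}}_r=\tau_r\mathsf{A}_r\tau_r^{-1}$. The incident field satisfies $-\Delta u^{\mathrm{inc}}-\kappa_0^2u^{\mathrm{inc}}=0$ in $\mathbb{R}^d$; "entire" means it extends to a holomorphic function on $\mathbb{C}^d$. The equation $u-\mathsf{A}_ru=u^{\mathrm{inc}}$ in $D_r$ is well-posed for each $r\in\mathfrak{T}$ (recalled in the paper as a known fact). Discretization: $V_h\subset H^1(\widehat D)$ is the space of piecewise linear functions on a mesh $\mathcal{T}_h$ from a globally quasi-uniform, shape-regular family of triangular meshes of $\widehat D$ with mesh size $h$; $\widehat u_{h,r}\in V_h$ is the solution of $\langle\widehat u_{h,r},\widehat v_h\rangle_{\widehat D}-\langle\widehat{\mathsf{A}}_r\widehat u_{h,r},\widehat v_h\rangle_{\widehat D}=\langle\tau_ru^{\mathrm{inc}},\widehat v_h\rangle_{\widehat D}$ for all $\widehat v_h\in V_h$, with $\langle\cdot,\cdot\rangle_{\widehat D}$ the $L^2(\widehat D)$-based duality pairing; $\widehat u_{h,\boldsymbol y}:=\widehat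 u_{h,r_{\boldsymbol y}}$ and $u_{h,\boldsymbol y}:=\tau_{r_{\boldsymbol y}}^{-1}\widehat u_{h,\boldsymbol y}$ on $D_{\boldsymbol y}$. Here $h_0>0$ is a threshold depending only on $\mathfrak{T}$ and on some $\delta>0$, such that for $0<h<h_0$ the discrete problem is uniquely solvable for every $r\in\mathfrak{T}$ and $\mathfrak{T}\ni r\mapsto\widehat u_{h,r}\in V_h$ admits a bounded holomorphic (complex Fréchet differentiable) extension into the open $\delta$-neighborhood of $\mathfrak{T}$ in $W^{1,\infty}(\widehat D;\mathbb{C}^d)$. Newton potential. For $x\in\partial\Omega$, $$\big(\mathsf{N}^{(\kappa_0)}_{\boldsymbol y}(\beta u_{h,\boldsymbol y})\big)(x)=\int_{D_{\boldsymbol y}}G^{(\kappa_0)}(x-\xi)\,\beta(\xi)\,u_{h,\boldsymbol y}(\xi)\,d\xi=\int_{\widehat D}\mathsf{g}^{(\kappa_0)}_{\boldsymbol y}(x,\widehat\xi)\,\beta(r_{\boldsymbol y}(\widehat\xi))\,\widehat u_{h,\boldsymbol y}(\widehat\xi)\,d\widehat\xi,$$ where $\mathsf{g}^{(\kappa_0)}_{\boldsymbol y}(x,\widehat\xi)=G^{(\kappa_0)}(x-r_{\boldsymbol y}(\widehat\xi))\,J_{\boldsymbol y}(\widehat\xi)$ and $J_{\boldsymbol y}=\det Dr_{\boldsymbol y}$ is the Jacobian determinant. $(\boldsymbol b,p,\varepsilon)$-holomorphy. For $s>1$ let $\mathcal{E}_s=\{\frac{z+z^{-1}}{2}:1\le|z|\le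 s\}\subset\mathbb{C}$, and for $\boldsymbol\rho=(\rho_j)_{j\ge1}$ with $\rho_j>1$ let $\mathcal{E}_{\boldsymbol\rho}=\bigotimes_{j\ge1}\mathcal{E}_{\rho_j}\subset\mathbb{C}^{\mathbb{N}}$. Let $X$ be a complex Banach space, $\varepsilon>0$, $p\in(0,1)$. A map $\mathbb{U}\ni\boldsymbol y\mapsto u(\boldsymbol y)\in X$ is $(\boldsymbol b,p,\varepsilon)$-holomorphic if and only if: (1) it is uniformly bounded; (2) there exist a positive sequence $\boldsymbol b=(b_j)_{j\ge1}\in\ell^p(\mathbb{N})$ and a constant $C_\varepsilon>0$ such that for any sequence $\boldsymbol\rho$ of numbers strictly larger than one that is $(\boldsymbol b,\varepsilon)$-admissible, i.e. $\sum_{j\ge1}(\rho_j-1)b_j\le\varepsilon$, the map admits a complex extension $\boldsymbol z\mapsto u(\boldsymbol z)$ that is holomorphic with respect to each variable $z_j$ on a set of the form $\mathcal{O}_{\boldsymbol\rho}=\bigotimes_{j\ge1}\mathcal{O}_{\rho_j}$, $\mathcal{O}_{\rho_j}=\{z\in\mathbb{C}:\mathrm{dist}(z,[-1,1])<\rho_j-1\}$; (3) this extension satisfies $\sup_{\boldsymbol z\in\mathcal{E}_{\boldsymbol\rho}}\|u(\boldsymbol z)\|_X\le C_\varepsilon$.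
   Formalization: It is additionally assumed that the boundary of Ω meets none of the closed domains D_y; without this the claim fails, e.g. for a scaled polygon when x lies on its moving boundary, where the potential is not twice differentiable in y_1. *)

theory Defs
  imports "HOL-Complex_Analysis.Complex_Analysis"
begin

section \<open>Function spaces\<close>

primrec Ck :: "nat \<Rightarrow> ('a::euclidean_space \<Rightarrow> 'b::real_normed_vector) \<Rightarrow> bool" where
  "Ck 0 f \<longleftrightarrow> continuous_on UNIV f"
| "Ck (Suc k) f \<longleftrightarrow> (\<forall>x. f differentiable (at x)) \<and>
     (\<forall>i\<in>Basis. Ck k (\<lambda>x. frechet_derivative f (at x) i))"

definition smooth :: "('a::euclidean_space \<Rightarrow> 'b::real_normed_vector) \<Rightarrow> bool" where
  "smooth f \<longleftrightarrow> (\<forall>k. Ck k f)"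

definition test_function :: "'a::euclidean_space set \<Rightarrow> ('a \<Rightarrow> real) \<Rightarrow> bool" where
  "test_function D \<phi> \<longleftrightarrow> smooth \<phi> \<and> compact (closure {x. \<phi> x \<noteq> 0}) \<and> closure {x. \<phi> x \<noteq> 0} \<subseteq> D"

text \<open>Elements of the spaces \<open>L\<^sup>\<infinity>(D)\<close> and \<open>W\<^sup>1\<^sup>,\<^sup>\<infinity>(D)\<close> are represented by functions on the whole
  space of which only the values almost everywhere in \<open>D\<close> matter; accordingly the norms are
  seminorms that vanish exactly on the functions that are zero almost everywhere in \<open>D\<close>.\<close>

definition Linf :: "'a::euclidean_space set \<Rightarrow> ('a \<Rightarrow> 'b::real_normed_vector) set" where
  "Linf D = {f. set_borel_measurable lebesgue D f \<and> (\<exists>C. AE x\<in>D in lebesgue. norm (f x) \<le> C)}"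

definition Linf_norm :: "'a::euclidean_space set \<Rightarrow> ('a \<Rightarrow> 'b::real_normed_vector) \<Rightarrow> real" where
  "Linf_norm D f = Inf {C. 0 \<le> C \<and> (AE x\<in>D in lebesgue. norm (f x) \<le> C)}"

definition weak_partial ::
  "'a::euclidean_space set \<Rightarrow> 'a \<Rightarrow> ('a \<Rightarrow> 'b::{banach,second_countable_topology}) \<Rightarrow> ('a \<Rightarrow> 'b) \<Rightarrow> bool" where
  "weak_partial D i f g \<longleftrightarrow> (\<forall>\<phi>. test_function D \<phi> \<longrightarrow>
     (LINT x:D|lebesgue. frechet_derivative \<phi> (at x) i *\<^sub>R f x) = - (LINT x:D|lebesgue. \<phi> x *\<^sub>R g x))"

definition W1inf :: "'a::euclidean_space set \<Rightarrow> ('a \<Rightarrow> 'b::{banach,second_countable_topology}) set" where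
  "W1inf D = {f \<in> Linf D. \<forall>i\<in>Basis. \<exists>g\<in>Linf D. weak_partial D i f g}"

definition W1inf_norm ::
  "'a::euclidean_space set \<Rightarrow> ('a \<Rightarrow> 'b::{banach,second_countable_topology}) \<Rightarrow> real" where
  "W1inf_norm D f = Linf_norm D f +
     (\<Sum>i\<in>Basis. Linf_norm D (SOME g. g \<in> Linf D \<and> weak_partial D i f g))"

definition weak_deriv_per :: "(real \<Rightarrow> real) \<Rightarrow> (real \<Rightarrow> real) \<Rightarrow> bool" where
  "weak_deriv_per f g \<longleftrightarrow> (\<forall>\<psi>. smooth \<psi> \<and> (\<forall>t. \<psi> (t + 2 * pi) = \<psi> t) \<longrightarrow>
     (LINT t:{0..2 * pi}|lebesgue. f t * deriv \<psi> t) = - (LINT t:{0..2 * pi}|lebesgue. g t * \<psi> t))"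

text \<open>The periodic functions are evaluated pointwise below, so the continuous
  representative is taken.\<close>

definition W1inf_per :: "(real \<Rightarrow> real) set" where
  "W1inf_per = {f. continuous_on UNIV f \<and> (\<forall>t. f (t + 2 * pi) = f t) \<and>
     (\<exists>g\<in>Linf {0..2 * pi}. weak_deriv_per f g)}"

definition W1inf_per_norm :: "(real \<Rightarrow> real) \<Rightarrow> real" where
  "W1inf_per_norm f = Linf_norm {0..2 * pi} f +
     Linf_norm {0..2 * pi} (SOME g. g \<in> Linf {0..2 * pi} \<and> weak_deriv_per f g)"

definition summable_p :: "real \<Rightarrow> (nat \<Rightarrow> real) \<Rightarrow> bool" where
  "summable_p p b \<longleftrightarrow> summable (\<lambda>j. \<bar>b j\<bar> powr p)"


section \<open>Holomorphic functions of several variables\<close>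

definition cvec :: "real^'n \<Rightarrow> complex^'n" where
  "cvec x = (\<chi> i. complex_of_real (x $ i))"

definition holomorphic_Cn :: "(complex^'n \<Rightarrow> complex) \<Rightarrow> (complex^'n) set \<Rightarrow> bool" where
  "holomorphic_Cn f W \<longleftrightarrow> (\<forall>z\<in>W. \<exists>f'. (f has_derivative f') (at z) \<and>
     (\<forall>c v. f' (c *s v) = c * f' v))"

definition entire_field :: "(real^'n \<Rightarrow> complex) \<Rightarrow> bool" where
  "entire_field u \<longleftrightarrow> (\<exists>E. holomorphic_Cn E UNIV \<and> (\<forall>x. E (cvec x) = u x))"


section \<open>Domains and assumptions on the transformations\<close>

text \<open>Near each boundary point the domain is the strict epigraph, in some direction \<open>e\<close>,
  of a Lipschitz function \<open>\<gamma>\<close> of the coordinates orthogonal to \<open>e\<close>.\<close>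

definition lipschitz_domain :: "'a::euclidean_space set \<Rightarrow> bool" where
  "lipschitz_domain D \<longleftrightarrow> open D \<and> connected D \<and> D \<noteq> {} \<and>
     (\<forall>x\<in>frontier D. \<exists>e \<gamma> L \<epsilon>. norm e = 1 \<and> 0 < \<epsilon> \<and> L-lipschitz_on {w. w \<bullet> e = 0} \<gamma> \<and>
        D \<inter> ball x \<epsilon> = {z \<in> ball x \<epsilon>. \<gamma> (z - (z \<bullet> e) *\<^sub>R e) < z \<bullet> e})"

text \<open>Compactness in \<open>W\<^sup>1\<^sup>,\<^sup>\<infinity>(D)\<close> is stated sequentially.\<close>

definition compact_W1inf ::
  "'a::euclidean_space set \<Rightarrow> ('a \<Rightarrow> 'b::{banach,second_countable_topology}) set \<Rightarrow> bool" where
  "compact_W1inf D T \<longleftrightarrow> T \<subseteq> W1inf D \<and>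
     (\<forall>s::nat \<Rightarrow> 'a \<Rightarrow> 'b. range s \<subseteq> T \<longrightarrow> (\<exists>r\<in>T. \<exists>k. strict_mono k \<and>
        (\<lambda>n. W1inf_norm D (\<lambda>x. s (k n) x - r x)) \<longlonglongrightarrow> 0))"

definition assumption_T :: "(real^'n) set \<Rightarrow> (real^'n \<Rightarrow> real^'n) set \<Rightarrow> bool" where
  "assumption_T D T \<longleftrightarrow> compact_W1inf D T \<and>
     (\<forall>r\<in>T. inj_on r D \<and> (\<exists>L. L-lipschitz_on D r) \<and> (\<exists>L. L-lipschitz_on (r ` D) (inv_into D r)) \<and>
        inv_into D r \<in> W1inf (r ` D) \<and>
        simply_connected (r ` D) \<and> bounded (r ` D) \<and> lipschitz_domain (r ` D))"

definition domain_partition :: "(real^'n) set \<Rightarrow> nat \<Rightarrow> (nat \<Rightarrow> (real^'n) set) \<Rightarrow> bool" where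
  "domain_partition D M Dp \<longleftrightarrow>
     (\<forall>i\<in>{1..M}. simply_connected (Dp i) \<and> bounded (Dp i) \<and> lipschitz_domain (Dp i)) \<and>
     disjoint_family_on Dp {1..M} \<and> D = interior (\<Union>i\<in>{1..M}. closure (Dp i))"

definition assumption_P ::
  "(real^'n) set \<Rightarrow> (real^'n \<Rightarrow> real^'n) set \<Rightarrow> nat \<Rightarrow> (nat \<Rightarrow> (real^'n) set) \<Rightarrow> bool" where
  "assumption_P D T M Dp \<longleftrightarrow> domain_partition D M Dp \<and>
     (\<forall>r\<in>T. domain_partition (r ` D) M (\<lambda>i. r ` Dp i))"

text \<open>The analytic extension of \<open>\<kappa>\<close> lives on an open set of complex vectors that contains the
  closed set \<open>closure (DH i)\<close>: the transformed subdomains may touch the boundary of \<open>DH i\<close>.\<close>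

definition assumption_K ::
  "(real^'n \<Rightarrow> real^'n) set \<Rightarrow> nat \<Rightarrow> (nat \<Rightarrow> (real^'n) set) \<Rightarrow> (nat \<Rightarrow> (real^'n) set) \<Rightarrow>
    (real^'n \<Rightarrow> complex) \<Rightarrow> bool" where
  "assumption_K T M Dp DH \<kappa> \<longleftrightarrow>
     (\<forall>i\<in>{1..M}. bounded (DH i) \<and> lipschitz_domain (DH i) \<and>
        (\<Union>r\<in>T. r ` Dp i) \<subseteq> closure (DH i)) \<and>
     \<kappa> \<in> Linf (\<Union>i\<in>{1..M}. DH i) \<and>
     (\<forall>i\<in>{1..M}. \<exists>W g. open W \<and> cvec ` closure (DH i) \<subseteq> W \<and> holomorphic_Cn g W \<and>
        (AE x\<in>DH i in lebesgue. g (cvec x) = \<kappa> x))"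


section \<open>Lippmann--Schwinger equation\<close>

definition bessel_J0 :: "real \<Rightarrow> real" where
  "bessel_J0 t = (\<Sum>k. (-1) ^ k / (fact k)\<^sup>2 * (t / 2) ^ (2 * k))"

definition bessel_Y0 :: "real \<Rightarrow> real" where
  "bessel_Y0 t = 2 / pi * ((ln (t / 2) + euler_mascheroni) * bessel_J0 t
     - (\<Sum>k. (-1) ^ k * harm k / (fact k)\<^sup>2 * (t / 2) ^ (2 * k)))"

definition hankel_H0 :: "real \<Rightarrow> complex" where
  "hankel_H0 t = Complex (bessel_J0 t) (bessel_Y0 t)"

text \<open>Only the dimensions 2 and 3 are meant; the value at \<open>z = 0\<close> is irrelevant.\<close>

definition green :: "real \<Rightarrow> real^'n \<Rightarrow> complex" where
  "green \<kappa>\<^sub>0 z = (if CARD('n) = 2 then \<i> / 4 * hankel_H0 (\<kappa>\<^sub>0 * norm z)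
     else exp (\<i> * complex_of_real (\<kappa>\<^sub>0 * norm z)) / complex_of_real (4 * pi * norm z))"

text \<open>The volume integral operator over \<open>E\<close>: for \<open>E = r ` D\<close> its values on \<open>E\<close> are those of the
  Lippmann--Schwinger operator, and its values outside are those of the Newton potential of
  \<open>\<beta> u\<close>.\<close>

definition volume_potential ::
  "real \<Rightarrow> (real^'n \<Rightarrow> complex) \<Rightarrow> (real^'n) set \<Rightarrow> (real^'n \<Rightarrow> complex) \<Rightarrow> real^'n \<Rightarrow> complex" where
  "volume_potential \<kappa>\<^sub>0 \<beta> E u x = (LINT \<xi>:E|lebesgue. green \<kappa>\<^sub>0 (x - \<xi>) * \<beta> \<xi> * u \<xi>)"

definition contrast :: "real \<Rightarrow> (real^'n \<Rightarrow> complex) \<Rightarrow> real^'n \<Rightarrow> complex" where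
  "contrast \<kappa>\<^sub>0 \<kappa> \<xi> = (\<kappa> \<xi>)\<^sup>2 - complex_of_real (\<kappa>\<^sub>0\<^sup>2)"

definition pull :: "('a \<Rightarrow> 'a) \<Rightarrow> ('a \<Rightarrow> complex) \<Rightarrow> 'a \<Rightarrow> complex" where
  "pull r u = u \<circ> r"

definition push :: "'a set \<Rightarrow> ('a \<Rightarrow> 'a) \<Rightarrow> ('a \<Rightarrow> complex) \<Rightarrow> 'a \<Rightarrow> complex" where
  "push D r u = u \<circ> inv_into D r"

definition laplacian :: "(real^'n \<Rightarrow> complex) \<Rightarrow> real^'n \<Rightarrow> complex" where
  "laplacian u x =
     (\<Sum>i\<in>Basis. frechet_derivative (\<lambda>z. frechet_derivative u (at z) i) (at x) i)"

definition helmholtz_solution :: "real \<Rightarrow> (real^'n \<Rightarrow> complex) \<Rightarrow> bool" where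
  "helmholtz_solution \<kappa>\<^sub>0 u \<longleftrightarrow> Ck 2 u \<and>
     (\<forall>x. - laplacian u x - complex_of_real (\<kappa>\<^sub>0\<^sup>2) * u x = 0)"


section \<open>Finite element discretization\<close>

definition simplicial_mesh :: "(real^'n) set \<Rightarrow> (real^'n) set set \<Rightarrow> bool" where
  "simplicial_mesh D \<T> \<longleftrightarrow> triangulation \<T> \<and> (\<forall>K\<in>\<T>. int CARD('n) simplex K) \<and> \<Union>\<T> = closure D"

definition mesh_size :: "(real^'n) set set \<Rightarrow> real" where
  "mesh_size \<T> = Max (diameter ` \<T>)"

definition inradius :: "(real^'n) set \<Rightarrow> real" where
  "inradius K = Sup {t. 0 \<le> t \<and> (\<exists>x. cball x t \<subseteq> K)}"

definition regular_mesh_family :: "(real^'n) set \<Rightarrow> (real^'n) set set set \<Rightarrow> bool" where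
  "regular_mesh_family D \<F> \<longleftrightarrow> (\<forall>\<T>\<in>\<F>. simplicial_mesh D \<T>) \<and>
     (\<exists>c. \<forall>\<T>\<in>\<F>. \<forall>K\<in>\<T>. diameter K \<le> c * inradius K) \<and>
     (\<exists>c>0. \<forall>\<T>\<in>\<F>. \<forall>K\<in>\<T>. c * mesh_size \<T> \<le> diameter K)"

text \<open>For piecewise linear functions, being in \<open>H\<^sup>1\<close> means being continuous. The functions are
  extended by zero so that they are determined by their values on the closure of \<open>D\<close>.\<close>

definition Vh :: "(real^'n) set \<Rightarrow> (real^'n) set set \<Rightarrow> (real^'n \<Rightarrow> complex) set" where
  "Vh D \<T> = {v. continuous_on (closure D) v \<and> (\<forall>x. x \<notin> closure D \<longrightarrow> v x = 0) \<and>
     (\<forall>K\<in>\<T>. \<exists>a c. \<forall>x\<in>K. v x = c + (\<Sum>i\<in>UNIV. a $ i * complex_of_real (x $ i)))}"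

text \<open>All norms on the finite-dimensional space \<open>Vh D \<T>\<close> are equivalent.\<close>

definition Vh_norm :: "(real^'n) set \<Rightarrow> (real^'n \<Rightarrow> complex) \<Rightarrow> real" where
  "Vh_norm D v = (SUP x\<in>closure D. norm (v x))"

text \<open>Conjugating the test function or not makes no difference in the Galerkin equations
  since \<open>Vh D \<T>\<close> is closed under complex conjugation.\<close>

definition pairing :: "(real^'n) set \<Rightarrow> (real^'n \<Rightarrow> complex) \<Rightarrow> (real^'n \<Rightarrow> complex) \<Rightarrow> complex" where
  "pairing D f g = (LINT x:D|lebesgue. f x * cnj (g x))"

definition galerkin_solution ::
  "(real^'n) set \<Rightarrow> real \<Rightarrow> (real^'n \<Rightarrow> complex) \<Rightarrow> (real^'n \<Rightarrow> complex) \<Rightarrow> (real^'n) set set \<Rightarrow>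
    (real^'n \<Rightarrow> real^'n) \<Rightarrow> (real^'n \<Rightarrow> complex) \<Rightarrow> bool" where
  "galerkin_solution D \<kappa>\<^sub>0 \<beta> uinc \<T> r u \<longleftrightarrow> u \<in> Vh D \<T> \<and>
     (\<forall>v\<in>Vh D \<T>.
        pairing D u v - pairing D (pull r (volume_potential \<kappa>\<^sub>0 \<beta> (r ` D) (push D r u))) v
          = pairing D (pull r uinc) v)"

definition discrete_solution ::
  "(real^'n) set \<Rightarrow> real \<Rightarrow> (real^'n \<Rightarrow> complex) \<Rightarrow> (real^'n \<Rightarrow> complex) \<Rightarrow> (real^'n) set set \<Rightarrow>
    (real^'n \<Rightarrow> real^'n) \<Rightarrow> real^'n \<Rightarrow> complex" where
  "discrete_solution D \<kappa>\<^sub>0 \<beta> uinc \<T> r = (THE u. galerkin_solution D \<kappa>\<^sub>0 \<beta> uinc \<T> r u)"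

definition complex_neighborhood ::
  "(real^'n) set \<Rightarrow> (real^'n \<Rightarrow> real^'n) set \<Rightarrow> real \<Rightarrow> (real^'n \<Rightarrow> complex^'n) set" where
  "complex_neighborhood D T \<delta> =
     {v \<in> W1inf D. \<exists>r\<in>T. W1inf_norm D (\<lambda>x. v x - cvec (r x)) < \<delta>}"

text \<open>Complex Frechet differentiability of a map from \<open>W\<^sup>1\<^sup>,\<^sup>\<infinity>(D; \<complex>\<^sup>n)\<close> into \<open>Vh D \<T>\<close>,
  with bounded complex linear derivative \<open>L\<close>.\<close>

definition frechet_differentiable_W1inf ::
  "(real^'n) set \<Rightarrow> (real^'n) set set \<Rightarrow> ((real^'n \<Rightarrow> complex^'n) \<Rightarrow> real^'n \<Rightarrow> complex) \<Rightarrow>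
    (real^'n \<Rightarrow> complex^'n) \<Rightarrow> bool" where
  "frechet_differentiable_W1inf D \<T> U v \<longleftrightarrow> (\<exists>L.
     (\<forall>w\<in>W1inf D. L w \<in> Vh D \<T>) \<and>
     (\<forall>w\<in>W1inf D. \<forall>w'\<in>W1inf D. L (\<lambda>x. w x + w' x) = (\<lambda>x. L w x + L w' x)) \<and>
     (\<forall>c. \<forall>w\<in>W1inf D. L (\<lambda>x. c *s w x) = (\<lambda>x. c * L w x)) \<and>
     (\<exists>C. \<forall>w\<in>W1inf D. Vh_norm D (L w) \<le> C * W1inf_norm D w) \<and>
     (\<forall>\<epsilon>>0. \<exists>\<eta>>0. \<forall>w\<in>W1inf D. W1inf_norm D w < \<eta> \<longrightarrow>
        Vh_norm D (\<lambda>x. U (\<lambda>t. v t + w t) x - U v x - L w x) \<le> \<epsilon> * W1inf_norm D w))"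

definition bounded_holomorphic_extension ::
  "(real^'n) set \<Rightarrow> (real^'n \<Rightarrow> real^'n) set \<Rightarrow> real \<Rightarrow> (real^'n) set set \<Rightarrow>
    ((real^'n \<Rightarrow> real^'n) \<Rightarrow> real^'n \<Rightarrow> complex) \<Rightarrow> bool" where
  "bounded_holomorphic_extension D T \<delta> \<T> u \<longleftrightarrow> (\<exists>U.
     (\<forall>r\<in>T. U (\<lambda>x. cvec (r x)) = u r) \<and>
     (\<forall>v\<in>complex_neighborhood D T \<delta>. U v \<in> Vh D \<T> \<and> frechet_differentiable_W1inf D \<T> U v) \<and>
     (\<exists>B. \<forall>v\<in>complex_neighborhood D T \<delta>. Vh_norm D (U v) \<le> B))"

text \<open>The threshold \<open>h\<^sub>0\<close> and the radius \<open>\<delta>\<close> are uniform over the mesh family.\<close>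

definition mesh_threshold ::
  "(real^'n) set \<Rightarrow> (real^'n \<Rightarrow> real^'n) set \<Rightarrow> real \<Rightarrow> (real^'n \<Rightarrow> complex) \<Rightarrow> (real^'n \<Rightarrow> complex) \<Rightarrow>
    (real^'n) set set set \<Rightarrow> real \<Rightarrow> real \<Rightarrow> bool" where
  "mesh_threshold D T \<kappa>\<^sub>0 \<beta> uinc \<F> \<delta> h\<^sub>0 \<longleftrightarrow> 0 < \<delta> \<and> 0 < h\<^sub>0 \<and>
     (\<forall>\<T>\<in>\<F>. 0 < mesh_size \<T> \<and> mesh_size \<T> < h\<^sub>0 \<longrightarrow>
        (\<forall>r\<in>T. \<exists>!u. galerkin_solution D \<kappa>\<^sub>0 \<beta> uinc \<T> r u) \<and>
        bounded_holomorphic_extension D T \<delta> \<T> (discrete_solution D \<kappa>\<^sub>0 \<beta> uinc \<T>))"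


section \<open>Affine-parametric transformations of the plane\<close>

definition param_cube :: "(nat \<Rightarrow> real) set" where
  "param_cube = {y. \<forall>j. -1 \<le> y j \<and> y j \<le> 1}"

definition param_radius ::
  "(real \<Rightarrow> real) \<Rightarrow> (nat \<Rightarrow> real \<Rightarrow> real) \<Rightarrow> (nat \<Rightarrow> real) \<Rightarrow> real \<Rightarrow> real" where
  "param_radius \<rho>h \<rho> y \<phi> = \<rho>h \<phi> + (\<Sum>j. y j * \<rho> j \<phi>)"

definition admissible_radii :: "(real \<Rightarrow> real) \<Rightarrow> (nat \<Rightarrow> real \<Rightarrow> real) \<Rightarrow> bool" where
  "admissible_radii \<rho>h \<rho> \<longleftrightarrow> \<rho>h \<in> W1inf_per \<and> (\<forall>j. \<rho> j \<in> W1inf_per) \<and>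
     (\<exists>\<rho>min \<rho>max. 0 < \<rho>min \<and> \<rho>min < \<rho>max \<and>
        (\<forall>\<phi>. summable (\<lambda>j. \<bar>\<rho> j \<phi>\<bar>) \<and>
           \<rho>min \<le> \<rho>h \<phi> - (\<Sum>j. \<bar>\<rho> j \<phi>\<bar>) \<and> \<rho>h \<phi> + (\<Sum>j. \<bar>\<rho> j \<phi>\<bar>) \<le> \<rho>max))"

definition polar_body :: "(real \<Rightarrow> real) \<Rightarrow> (real^2) set" where
  "polar_body \<rho> = {\<theta> *\<^sub>R vector [cos \<phi>, sin \<phi>] | \<theta> \<phi>. 0 \<le> \<theta> \<and> \<theta> \<le> \<rho> \<phi> \<and> 0 \<le> \<phi> \<and> \<phi> < 2 * pi}"

definition polar_angle :: "real^2 \<Rightarrow> real" where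
  "polar_angle x = Arg2pi (Complex (x $ 1) (x $ 2))"

definition affine_transformation ::
  "(real \<Rightarrow> real) \<Rightarrow> (nat \<Rightarrow> real \<Rightarrow> real) \<Rightarrow> (nat \<Rightarrow> real) \<Rightarrow> real^2 \<Rightarrow> real^2" where
  "affine_transformation \<rho>h \<rho> y x =
     (param_radius \<rho>h \<rho> y (polar_angle x) / \<rho>h (polar_angle x)) *\<^sub>R x"


section \<open>Parametric holomorphy\<close>

definition bernstein_ellipse :: "real \<Rightarrow> complex set" where
  "bernstein_ellipse s = {(z + inverse z) / 2 | z. 1 \<le> norm z \<and> norm z \<le> s}"

definition stadium :: "real \<Rightarrow> complex set" where
  "stadium s = {z. infdist z (complex_of_real ` {-1..1}) < s - 1}"

definition admissible_sequence :: "(nat \<Rightarrow> real) \<Rightarrow> real \<Rightarrow> (nat \<Rightarrow> real) \<Rightarrow> bool" where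
  "admissible_sequence b \<epsilon> \<rho> \<longleftrightarrow> (\<forall>j. 1 < \<rho> j) \<and>
     summable (\<lambda>j. (\<rho> j - 1) * b j) \<and> (\<Sum>j. (\<rho> j - 1) * b j) \<le> \<epsilon>"

text \<open>The sequence \<open>b\<close> may have zero entries (a vanishing radius function has norm zero); this
  implies the same property for the strictly positive sequence \<open>\<lambda>j. max (b j) (1 / 2 ^ j)\<close>,
  which has fewer admissible sequences.\<close>

definition parametric_holomorphic ::
  "(nat \<Rightarrow> real) \<Rightarrow> real \<Rightarrow> real \<Rightarrow> ((nat \<Rightarrow> real) \<Rightarrow> complex) \<Rightarrow> bool" where
  "parametric_holomorphic b p \<epsilon> u \<longleftrightarrow>
     (\<exists>B. \<forall>y\<in>param_cube. norm (u y) \<le> B) \<and>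
     (\<forall>j. 0 \<le> b j) \<and> summable_p p b \<and>
     (\<exists>C>0. \<forall>\<rho>. admissible_sequence b \<epsilon> \<rho> \<longrightarrow>
        (\<exists>v :: (nat \<Rightarrow> complex) \<Rightarrow> complex.
           (\<forall>y\<in>param_cube. v (\<lambda>j. complex_of_real (y j)) = u y) \<and>
           (\<forall>z. (\<forall>j. z j \<in> stadium (\<rho> j)) \<longrightarrow>
              (\<forall>j. (\<lambda>w. v (z(j := w))) holomorphic_on stadium (\<rho> j))) \<and>
           (\<forall>z. (\<forall>j. z j \<in> bernstein_ellipse (\<rho> j)) \<longrightarrow> norm (v z) \<le> C)))"

end

theory Submission
  imports Defs
begin

text \<open>The transformation \<open>r\<^sub>y(x) = q\<^sub>y(\<phi>) x\<close> is radial with a factor that depends on the angle only, so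
  its Jacobian is \<open>q\<^sub>y\<^sup>2\<close> and the Newton potential at \<open>x\<close> is an integral over the reference domain
  of \<open>G(x - r\<^sub>y) \<beta>(r\<^sub>y) u\<^sub>h\<^sub>,\<^sub>y q\<^sub>y\<^sup>2\<close>. On each subdomain all factors extend to complex parameters \<open>z\<close>:
  \<open>r\<^sub>z\<close> is affine in \<open>z\<close>, the Green function is holomorphic near the transformed domains because
  these stay in a compact set that does not contain \<open>x\<close>, the contrast is analytic by assumption,
  and the discrete solution is holomorphic in a \<open>W\<^sup>1\<^sup>,\<^sup>\<infinity>\<close>-neighborhood of the set of
  transformations. The map \<open>r\<^sub>z\<close> lies in that neighborhood as soon as \<open>\<Sum>\<^sub>j |z\<^sub>j - y\<^sub>j| b\<^sub>j\<close> is small for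
  some real \<open>y\<close> in the cube, because \<open>x \<mapsto> (\<rho>\<^sub>j / \<rho>h)(\<phi>) x\<close> is Lipschitz with a constant
  proportional to \<open>b\<^sub>j\<close>. The integral of a bounded holomorphic integrand is holomorphic.\<close>

section \<open>Smooth functions\<close>

text \<open>The norms of \<open>W1inf\<close> are built from weak derivatives, while the estimates
  on the transformations are Lipschitz estimates, so the proof crosses between the two twice. From
  weak to Lipschitz: \<open>b j\<close> controls a weak derivative of \<open>\<rho> j\<close>, and
  mollification turns this into a Lipschitz constant. From Lipschitz to weak: testing against
  nonnegative bumps bounds every weak derivative of a Lipschitz function almost everywhere.
  Existence of weak derivatives of a single radial field is not proved by hand: the field is a
  difference of two members of T, and Assumption (T) places T in \<open>W1inf\<close>. The second
  obstacle is uniformity: one \<epsilon> must serve all parameters of an infinite-dimensional cube.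
  Compactness is used in the plane, not in the cube: all transformed domains lie in one compact
  body, described by the largest radius at each angle, and its intersection with each closed
  \<open>DH i\<close> has a neighborhood that serves every parameter. The subdomains may touch the
  boundary of \<open>DH i\<close>, where \<kappa> and its extension need not agree, so the
  exceptional sets must be shown negligible.\<close>

lemma Ck_SucI:
  assumes "\<And>x. (f has_derivative f' x) (at x)" "\<And>i. i \<in> Basis \<Longrightarrow> Ck k (\<lambda>x. f' x i)"
  shows "Ck (Suc k) f"
proof -
  have "frechet_derivative f (at x) = f' x" for x
    using frechet_derivative_at[OF assms(1)[of x]] by simp
  then show ?thesis
    using assms unfolding Ck.simps differentiable_def by auto
qed

lemma Ck_Suc_has_derivative:
  assumes "Ck (Suc k) f"
  shows "(f has_derivative frechet_derivative f (at x)) (at x)"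
  using assms by (auto simp: frechet_derivative_works)

lemma Ck_Suc_imp: "Ck (Suc k) f \<Longrightarrow> Ck k f"
proof (induction k arbitrary: f)
  case 0
  then have "isCont f x" for x
    using Ck_Suc_has_derivative[OF 0] has_derivative_continuous by blast
  then show ?case
    by (simp add: continuous_at_imp_continuous_on)
next
  case (Suc k)
  have "Ck k (\<lambda>x. frechet_derivative f (at x) i)" if "i \<in> Basis" for i
    by (rule Suc.IH) (use Suc.prems that in simp)
  with Suc.prems show ?case
    by simp
qed

lemma Ck_const: "Ck k (\<lambda>x. c)"
proof (induction k arbitrary: c)
  case (Suc k)
  show ?case
    by (rule Ck_SucI[where f' = "\<lambda>x h. 0"]) (auto simp: Suc)
qed simp

lemma Ck_linear:
  assumes "bounded_linear f"
  shows "Ck k f"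
proof (cases k)
  case 0
  then show ?thesis
    by (simp add: assms linear_continuous_on)
next
  case (Suc k)
  show ?thesis
    unfolding Suc by (rule Ck_SucI[where f' = "\<lambda>x. f"])
      (auto intro: Ck_const bounded_linear_imp_has_derivative assms)
qed

lemma Ck_add: "Ck k f \<Longrightarrow> Ck k g \<Longrightarrow> Ck k (\<lambda>x. f x + g x)"
proof (induction k arbitrary: f g)
  case 0
  then show ?case
    by (auto intro: continuous_intros)
next
  case (Suc k)
  show ?case
    using Suc by (intro Ck_SucI[OF has_derivative_add[OF Ck_Suc_has_derivative Ck_Suc_has_derivative]]) auto
qed

lemma Ck_mult:
  fixes f g :: "'a::euclidean_space \<Rightarrow> real"
  shows "Ck k f \<Longrightarrow> Ck k g \<Longrightarrow> Ck k (\<lambda>x. f x * g x)"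
proof (induction k arbitrary: f g)
  case 0
  then show ?case
    by (auto intro: continuous_intros)
next
  case (Suc k)
  have "Ck k f" "Ck k g"
    using Suc.prems Ck_Suc_imp by blast+
  then show ?case
    using Suc
    by (intro Ck_SucI[OF has_derivative_mult[OF Ck_Suc_has_derivative Ck_Suc_has_derivative]] Ck_add) auto
qed

lemma Ck_prod:
  fixes f :: "'i \<Rightarrow> 'a::euclidean_space \<Rightarrow> real"
  shows "(\<And>i. i \<in> I \<Longrightarrow> Ck k (f i)) \<Longrightarrow> Ck k (\<lambda>x. \<Prod>i\<in>I. f i x)"
  by (induction I rule: infinite_finite_induct) (auto intro: Ck_const Ck_mult)

section \<open>Flat functions: a family closed under differentiation\<close>

definition flat :: "real poly \<Rightarrow> real \<Rightarrow> real" where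
  "flat p t = (if 0 < t then poly p (inverse t) * exp (- inverse t) else 0)"

lemma tendsto_poly_mult_exp_neg:
  "((\<lambda>x::real. poly p x * exp (- x)) \<longlongrightarrow> 0) at_top"
proof -
  have "((\<lambda>x::real. \<Sum>i\<le>degree p. coeff p i * (x ^ i / exp x)) \<longlongrightarrow> (\<Sum>i\<le>degree p. coeff p i * 0)) at_top"
    by (intro tendsto_intros tendsto_power_div_exp_0)
  then show ?thesis
    by (simp add: poly_altdef exp_minus sum_distrib_right field_simps sum_divide_distrib)
qed

text \<open>With s = 1/t, the derivative of p(s) e^(-s) in t is s^2 (p(s) - p'(s)) e^(-s), and
  \<open>[:0, 0, 1:]\<close> is the factor s^2. At 0 the right difference quotient is s p(s) e^(-s)
  as s tends to infinity, hence \<open>pCons 0 p\<close> in that case.\<close>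

lemma flat_has_derivative:
  "(flat p has_real_derivative flat ([:0, 0, 1:] * (p - pderiv p)) t) (at t)"
proof -
  consider "t > 0" | "t < 0" | "t = 0"
    by linarith
  then show ?thesis
  proof cases
    case 1
    have "((\<lambda>t. poly p (inverse t) * exp (- inverse t)) has_real_derivative
        flat ([:0, 0, 1:] * (p - pderiv p)) t) (at t)"
      using 1 by (auto intro!: derivative_eq_intros poly_DERIV
          DERIV_chain2[where f = "poly p" and g = inverse]
          simp: flat_def power2_eq_square field_simps)
    then show ?thesis
      by (rule has_field_derivative_transform_within_open[where S = "{0<..}"])
        (use 1 in \<open>auto simp: flat_def\<close>)
  next
    case 2
    have "((\<lambda>t. 0) has_real_derivative flat ([:0, 0, 1:] * (p - pderiv p)) t) (at t)"
      using 2 by (auto simp: flat_def)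
    then show ?thesis
      by (rule has_field_derivative_transform_within_open[where S = "{..<0}"])
        (use 2 in \<open>auto simp: flat_def\<close>)
  next
    case 3
    have "((\<lambda>h. poly (pCons 0 p) (inverse h) * exp (- inverse h)) \<longlongrightarrow> 0) (at_right 0)"
      by (rule filterlim_compose[OF tendsto_poly_mult_exp_neg filterlim_inverse_at_top_right])
    then have "((\<lambda>h. flat p h / h) \<longlongrightarrow> 0) (at_right 0)"
      by (rule Lim_transform_eventually)
        (auto simp: flat_def eventually_at_filter field_simps)
    moreover have "((\<lambda>h. flat p h / h) \<longlongrightarrow> 0) (at_left 0)"
      by (rule Lim_transform_eventually[OF tendsto_const]) (auto simp: flat_def eventually_at_filter)
    ultimately have "((\<lambda>h. flat p h / h) \<longlongrightarrow> 0) (at 0)"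
      by (simp add: filterlim_split_at)
    then show ?thesis
      unfolding 3 DERIV_def by (simp add: flat_def)
  qed
qed

lemma flat_continuous: "continuous_on UNIV (flat p)"
  using flat_has_derivative DERIV_isCont continuous_at_imp_continuous_on by blast

text \<open>The induction runs over all polynomials at once, because differentiation replaces
  \<open>p\<close> by another one.\<close>

lemma Ck_flat: "Ck k u \<Longrightarrow> Ck k (\<lambda>x. flat p (u x))"
proof (induction k arbitrary: p u)
  case 0
  then show ?case
    by (auto intro: continuous_on_compose2[OF flat_continuous])
next
  case (Suc k)
  have "Ck k u"
    using Suc.prems Ck_Suc_imp by blast
  then show ?case
    using Suc
    by (intro Ck_SucI[OF has_derivative_compose[OF Ck_Suc_has_derivative
          flat_has_derivative[unfolded has_field_derivative_def]]] Ck_mult) auto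
qed

abbreviation flat1 :: "real \<Rightarrow> real" where "flat1 \<equiv> flat 1"

lemma flat1_nonneg: "0 \<le> flat1 t" and flat1_le: "flat1 t \<le> 1"
  and flat1_eq_0: "flat1 t = 0 \<longleftrightarrow> t \<le> 0"
  by (auto simp: flat_def)

lemma flat1_mono: "s \<le> t \<Longrightarrow> flat1 s \<le> flat1 t"
  by (auto simp: flat_def)

lemma flat1_tendsto: "0 < t \<Longrightarrow> (\<lambda>n. flat1 (real n * t)) \<longlonglongrightarrow> 1"
proof -
  assume t: "0 < t"
  have "filterlim (\<lambda>n. real n * t) at_top sequentially"
    using t by (intro filterlim_at_top_mult_tendsto_pos[OF tendsto_const _ filterlim_real_sequentially])
      auto
  then have "(\<lambda>n. inverse (real n * t)) \<longlonglongrightarrow> 0"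
    using tendsto_inverse_0_at_top by blast
  then have "(\<lambda>n. exp (- inverse (real n * t))) \<longlonglongrightarrow> exp (- 0)"
    by (intro tendsto_intros)
  then have "(\<lambda>n. exp (- inverse (real n * t))) \<longlonglongrightarrow> 1"
    by simp
  then show ?thesis
    using t by (elim Lim_transform_eventually)
      (auto simp: flat_def eventually_sequentially intro!: exI[of _ 1])
qed

section \<open>Smooth approximations of indicators of boxes and of finite unions of boxes\<close>

definition box_bump :: "'a::euclidean_space \<Rightarrow> 'a \<Rightarrow> nat \<Rightarrow> 'a \<Rightarrow> real" where
  "box_bump a b n x = (\<Prod>i\<in>Basis. flat1 (real n * ((x - a) \<bullet> i)) * flat1 (real n * ((b - x) \<bullet> i)))"

lemma Ck_box_bump: "Ck k (box_bump a b n)"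
proof -
  have *: "Ck k (\<lambda>x::'a. c + d * (x \<bullet> i))" for c d i
    by (intro Ck_add Ck_const Ck_mult Ck_linear bounded_linear_inner_left)
  have 1: "real n * ((x - a) \<bullet> i) = - real n * (a \<bullet> i) + real n * (x \<bullet> i)" for x i
    by (simp add: inner_diff_left algebra_simps)
  have 2: "real n * ((b - x) \<bullet> i) = real n * (b \<bullet> i) + (- real n) * (x \<bullet> i)" for x i
    by (simp add: inner_diff_left algebra_simps)
  show ?thesis
    unfolding box_bump_def[abs_def] 1 2 by (intro Ck_prod Ck_mult Ck_flat *)
qed

lemma continuous_box_bump: "continuous_on UNIV (box_bump a b n)"
  using Ck_box_bump[of 0 a b n] by simp

lemma box_bump_nonneg: "0 \<le> box_bump a b n x" and box_bump_le: "box_bump a b n x \<le> 1"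
  by (auto simp: box_bump_def intro!: prod_nonneg prod_le_1 mult_le_one mult_nonneg_nonneg flat1_nonneg flat1_le)

lemma box_bump_outside: "x \<notin> box a b \<Longrightarrow> box_bump a b n x = 0"
proof -
  assume "x \<notin> box a b"
  then obtain i where i: "i \<in> Basis" "x \<bullet> i \<le> a \<bullet> i \<or> b \<bullet> i \<le> x \<bullet> i"
    by (auto simp: mem_box not_less)
  then have "flat1 (real n * ((x - a) \<bullet> i)) * flat1 (real n * ((b - x) \<bullet> i)) = 0"
    by (auto simp: flat1_eq_0 inner_diff_left mult_nonneg_nonpos)
  with i show ?thesis
    unfolding box_bump_def by (intro prod_zero) auto
qed

lemma box_bump_tendsto: "(\<lambda>n. box_bump a b n x) \<longlonglongrightarrow> indicator (box a b) x"
proof (cases "x \<in> box a b")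
  case True
  have "(\<lambda>n. box_bump a b n x) \<longlonglongrightarrow> (\<Prod>i\<in>(Basis::'a set). 1 * 1)"
    unfolding box_bump_def using True
    by (intro tendsto_prod tendsto_mult flat1_tendsto) (auto simp: mem_box inner_diff_left)
  with True show ?thesis
    by simp
qed (simp add: box_bump_outside)

text \<open>Lets the change of variables for boxes pass to the limit by monotone
  convergence.\<close>

lemma box_bump_mono: "m \<le> n \<Longrightarrow> box_bump a b m x \<le> box_bump a b n x"
proof (cases "x \<in> box a b")
  case True
  assume "m \<le> n"
  with True show ?thesis
    unfolding box_bump_def
    by (intro prod_mono conjI mult_mono mult_nonneg_nonneg flat1_nonneg flat1_mono mult_right_mono)
      (auto simp: mem_box inner_diff_left intro: less_imp_le)
qed (simp add: box_bump_outside)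

text \<open>One minus the product of the complements is the smooth counterpart of a union: it stays
  between 0 and 1 even where boxes overlap, which a sum of bumps would not.\<close>

definition boxes_bump :: "('a::euclidean_space \<times> 'a) set \<Rightarrow> nat \<Rightarrow> 'a \<Rightarrow> real" where
  "boxes_bump S n x = 1 - (\<Prod>c\<in>S. 1 - box_bump (fst c) (snd c) n x)"

lemma boxes_bump_nonneg: "0 \<le> boxes_bump S n x" and boxes_bump_le: "boxes_bump S n x \<le> 1"
proof -
  have "0 \<le> 1 - box_bump (fst c) (snd c) n x" "1 - box_bump (fst c) (snd c) n x \<le> 1" for c
    using box_bump_nonneg[of "fst c" "snd c" n x] box_bump_le[of "fst c" "snd c" n x] by auto
  then show "0 \<le> boxes_bump S n x" "boxes_bump S n x \<le> 1"
    unfolding boxes_bump_def using prod_le_1[of S "\<lambda>c. 1 - box_bump (fst c) (snd c) n x"]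
      prod_nonneg[of S "\<lambda>c. 1 - box_bump (fst c) (snd c) n x"] by auto
qed

lemma boxes_bump_outside:
  "x \<notin> (\<Union>c\<in>S. box (fst c) (snd c)) \<Longrightarrow> boxes_bump S n x = 0"
  by (auto simp: boxes_bump_def box_bump_outside)

lemma boxes_bump_tendsto:
  assumes "finite S"
  shows "(\<lambda>n. boxes_bump S n x) \<longlonglongrightarrow> indicator (\<Union>c\<in>S. box (fst c) (snd c)) x"
proof -
  have "(\<lambda>n. boxes_bump S n x) \<longlonglongrightarrow> 1 - (\<Prod>c\<in>S. 1 - indicator (box (fst c) (snd c)) x)"
    unfolding boxes_bump_def by (intro tendsto_intros box_bump_tendsto)
  moreover have "1 - (\<Prod>c\<in>S. 1 - indicator (box (fst c) (snd c)) x) =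
      (indicator (\<Union>c\<in>S. box (fst c) (snd c)) x :: real)"
    using assms by (auto simp: indicator_def intro!: prod_zero)
  ultimately show ?thesis
    by simp
qed

lemma smooth_boxes_bump: "smooth (boxes_bump S n)"
proof -
  have "Ck k (\<lambda>x. 1 + (-1) * (\<Prod>c\<in>S. 1 + (-1) * box_bump (fst c) (snd c) n x))" for k
    by (intro Ck_add Ck_mult Ck_const Ck_prod Ck_box_bump)
  then show ?thesis
    unfolding smooth_def boxes_bump_def[abs_def] by simp
qed

text \<open>The closed boxes have to lie in \<open>D\<close>: their finite union is a compact set
  that contains the support.\<close>

lemma test_function_boxes_bump:
  assumes "finite S" "(\<Union>c\<in>S. cbox (fst c) (snd c)) \<subseteq> D"
  shows "test_function D (boxes_bump S n)"
proof -
  have c: "compact (\<Union>c\<in>S. cbox (fst c) (snd c))"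
    using assms(1) by (intro compact_UN compact_cbox)
  have sub: "{x. boxes_bump S n x \<noteq> 0} \<subseteq> (\<Union>c\<in>S. cbox (fst c) (snd c))"
    using boxes_bump_outside box_subset_cbox by blast
  then have *: "closure {x. boxes_bump S n x \<noteq> 0} \<subseteq> (\<Union>c\<in>S. cbox (fst c) (snd c))"
    using c by (intro closure_minimal compact_imp_closed)
  then have "compact (closure {x. boxes_bump S n x \<noteq> 0})"
    using bounded_subset[OF compact_imp_bounded[OF c] sub] by (simp only: compact_closure)
  with * assms(2) show ?thesis
    by (auto simp: test_function_def smooth_boxes_bump)
qed

section \<open>Weak derivatives of Lipschitz functions\<close>

text \<open>The infimum is attained: each bound with slack \<open>inverse (Suc n)\<close> fails on a
  null set only, and countably many null sets have a null union.\<close>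

lemma Linf_norm_AE:
  assumes "f \<in> Linf D"
  shows "AE x\<in>D in lebesgue. norm (f x) \<le> Linf_norm D f"
proof -
  let ?S = "{C. 0 \<le> C \<and> (AE x\<in>D in lebesgue. norm (f x) \<le> C)}"
  obtain C where "AE x\<in>D in lebesgue. norm (f x) \<le> C"
    using assms by (auto simp: Linf_def)
  then have "AE x\<in>D in lebesgue. norm (f x) \<le> max 0 C"
    by eventually_elim auto
  then have ne: "?S \<noteq> {}"
    by (auto intro!: exI[of _ "max 0 C"])
  have bdd: "bdd_below ?S"
    by (auto intro!: bdd_belowI[of _ 0])
  have "AE x\<in>D in lebesgue. norm (f x) \<le> Linf_norm D f + inverse (Suc n)" for n :: nat
  proof -
    obtain C' where "C' \<in> ?S" "C' < Linf_norm D f + inverse (Suc n)"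
      using cInf_less_iff[OF ne bdd, of "Linf_norm D f + inverse (Suc n)"] unfolding Linf_norm_def
      by auto
    then show ?thesis
      by (auto elim!: eventually_mono)
  qed
  then have "AE x in lebesgue. \<forall>n::nat. x \<in> D \<longrightarrow> norm (f x) \<le> Linf_norm D f + inverse (Suc n)"
    by (subst AE_all_countable) blast
  then show ?thesis
  proof eventually_elim
    case (elim x)
    have "norm (f x) \<le> Linf_norm D f" if "x \<in> D"
      by (rule LIMSEQ_le_const[OF LIMSEQ_inverse_real_of_nat_add]) (use elim that in auto)
    then show ?case
      by blast
  qed
qed

lemma Linf_norm_le: "0 \<le> C \<Longrightarrow> AE x\<in>D in lebesgue. norm (f x) \<le> C \<Longrightarrow> Linf_norm D f \<le> C"
  unfolding Linf_norm_def by (intro cInf_lower) (auto intro!: bdd_belowI[of _ 0])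

lemma Linf_norm_nonneg:
  assumes "f \<in> Linf D"
  shows "0 \<le> Linf_norm D f"
proof -
  obtain C where "AE x\<in>D in lebesgue. norm (f x) \<le> C"
    using assms by (auto simp: Linf_def)
  then have "AE x\<in>D in lebesgue. norm (f x) \<le> max 0 C"
    by eventually_elim auto
  then show ?thesis
    unfolding Linf_norm_def by (intro cInf_greatest) (auto intro!: exI[of _ "max 0 C"])
qed

lemma Linf_bounded_linear:
  assumes "f \<in> Linf D" "bounded_linear T"
  shows "(\<lambda>x. T (f x)) \<in> Linf D"
proof -
  interpret bounded_linear T by fact
  obtain C where C: "AE x\<in>D in lebesgue. norm (f x) \<le> C"
    using assms by (auto simp: Linf_def)
  obtain K where K: "\<And>x. norm (T x) \<le> norm x * K" "0 < K"
    using pos_bounded by blast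
  have "AE x\<in>D in lebesgue. norm (T (f x)) \<le> C * K"
    using C
  proof eventually_elim
    case (elim x)
    then show ?case
      using K(2) by (auto intro!: order_trans[OF K(1)] mult_right_mono)
  qed
  moreover have "(\<lambda>x. T (indicator D x *\<^sub>R f x)) \<in> borel_measurable lebesgue"
    using assms(1) measurable_compose[OF _ borel_measurable_continuous_onI[OF linear_continuous_on[OF assms(2)]]]
    unfolding Linf_def set_borel_measurable_def by blast
  ultimately show ?thesis
    by (auto simp: Linf_def set_borel_measurable_def scaleR)
qed

lemma Linf_add:
  assumes "f \<in> Linf D" "g \<in> Linf D"
  shows "(\<lambda>x. f x + (g x :: 'b :: {real_normed_vector, second_countable_topology})) \<in> Linf D"
proof -
  obtain C C' where C: "AE x\<in>D in lebesgue. norm (f x) \<le> C" "AE x\<in>D in lebesgue. norm (g x) \<le> C'"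
    using assms by (auto simp: Linf_def)
  then have "AE x\<in>D in lebesgue. norm (f x + g x) \<le> C + C'"
    by eventually_elim (meson add_mono norm_triangle_le)
  moreover have "(\<lambda>x. indicator D x *\<^sub>R f x + indicator D x *\<^sub>R g x) \<in> borel_measurable lebesgue"
    using assms by (intro borel_measurable_add) (auto simp: Linf_def set_borel_measurable_def)
  ultimately show ?thesis
    by (auto simp: Linf_def set_borel_measurable_def scaleR_add_right)
qed

lemma Linf_set_integrable:
  fixes f :: "'a::euclidean_space \<Rightarrow> 'b::{banach, second_countable_topology}"
  assumes "f \<in> Linf D" "open D" "bounded D" "continuous_on UNIV u" "\<And>x. \<bar>u x\<bar> \<le> M"
  shows "set_integrable lebesgue D (\<lambda>x. u x *\<^sub>R f x)"
proof -
  obtain C where C: "AE x\<in>D in lebesgue. norm (f x) \<le> C"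
    using assms by (auto simp: Linf_def)
  have D: "D \<in> lmeasurable"
    using assms by (simp add: lmeasurable_open)
  have u: "u \<in> borel_measurable lebesgue"
    by (simp add: assms(4) borel_measurable_continuous_onI measurable_completion)
  have m: "(\<lambda>x. u x *\<^sub>R (indicator D x *\<^sub>R f x)) \<in> borel_measurable lebesgue"
    using assms(1) by (intro borel_measurable_scaleR[OF u]) (auto simp: Linf_def set_borel_measurable_def)
  have eq: "(\<lambda>x. u x *\<^sub>R (indicator D x *\<^sub>R f x)) = (\<lambda>x. indicator D x *\<^sub>R (u x *\<^sub>R f x))"
    by (auto simp: fun_eq_iff)
  have "M \<ge> 0"
    using assms(5) abs_ge_zero order_trans by blast
  have "integrable lebesgue (\<lambda>x. indicator D x * (M * \<bar>C\<bar>))"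
    using D by (intro integrable_mult_left) (auto simp: fmeasurable_def integrable_real_indicator)
  then show ?thesis
    unfolding set_integrable_def
  proof (rule Bochner_Integration.integrable_bound)
    show "AE x in lebesgue. norm (indicator D x *\<^sub>R u x *\<^sub>R f x) \<le> norm (indicator D x * (M * \<bar>C\<bar>))"
      using C
    proof eventually_elim
      case (elim x)
      then show ?case
        using assms(5)[of x] \<open>M \<ge> 0\<close>
        by (auto simp: indicator_def abs_mult intro!: mult_mono)
    qed
  qed (use eq m in simp)
qed

lemma continuous_compact_support_bounded:
  fixes u :: "'a::euclidean_space \<Rightarrow> real"
  assumes "continuous_on UNIV u" "compact K" "\<And>x. x \<notin> K \<Longrightarrow> u x = 0"
  obtains M where "\<And>x. \<bar>u x\<bar> \<le> M"
proof -
  have "compact (u ` K)"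
    using assms compact_continuous_image continuous_on_subset by blast
  then obtain M where "\<forall>y\<in>u ` K. \<bar>y\<bar> \<le> M"
    using compact_imp_bounded bounded_real by metis
  then have "\<bar>u x\<bar> \<le> max M 0" for x
    using assms(3)[of x] by (cases "x \<in> K") (auto simp: le_max_iff_disj)
  then show ?thesis
    using that by blast
qed

lemma test_functionD:
  assumes "test_function D \<phi>"
  shows "continuous_on UNIV \<phi>" "\<exists>M. \<forall>x. \<bar>\<phi> x\<bar> \<le> M" "\<And>x. x \<notin> D \<Longrightarrow> \<phi> x = 0"
    and "(\<phi> has_derivative frechet_derivative \<phi> (at x)) (at x)"
    and "i \<in> Basis \<Longrightarrow> continuous_on UNIV (\<lambda>x. frechet_derivative \<phi> (at x) i)"
    and "i \<in> Basis \<Longrightarrow> \<exists>M. \<forall>x. \<bar>frechet_derivative \<phi> (at x) i\<bar> \<le> M"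
proof -
  let ?K = "closure {x. \<phi> x \<noteq> 0}"
  have K: "compact ?K" "?K \<subseteq> D" and sm: "smooth \<phi>"
    using assms by (auto simp: test_function_def)
  have C1: "Ck (Suc 0) \<phi>" and C0: "Ck 0 \<phi>"
    using sm by (metis smooth_def)+
  show c: "continuous_on UNIV \<phi>"
    using C0 by simp
  have out: "\<phi> x = 0" if "x \<notin> ?K" for x
    using that closure_subset[of "{x. \<phi> x \<noteq> 0}"] by auto
  then show "\<And>x. x \<notin> D \<Longrightarrow> \<phi> x = 0"
    using K by blast
  show "\<exists>M. \<forall>x. \<bar>\<phi> x\<bar> \<le> M"
    using continuous_compact_support_bounded[OF c K(1) out] by metis
  show "(\<phi> has_derivative frechet_derivative \<phi> (at x)) (at x)" for x
    using C1 Ck_Suc_has_derivative by blast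
  show c': "continuous_on UNIV (\<lambda>x. frechet_derivative \<phi> (at x) i)" if "i \<in> Basis"
    using C1 that by simp
  \<comment> \<open>\<open>\<phi>\<close> vanishes on the open complement of its support, hence so
    does its derivative.\<close>
  have out': "frechet_derivative \<phi> (at x) i = 0" if "x \<notin> ?K" for x
  proof -
    have "(\<phi> has_derivative (\<lambda>h. 0)) (at x)"
    proof (rule has_derivative_transform_within_open[OF has_derivative_const[of 0], of "- ?K"])
      show "0 = \<phi> y" if "y \<in> - ?K" for y
        by (rule out[symmetric]) (use that in blast)
    qed (use that in blast)+
    then have "(\<lambda>h. 0) = frechet_derivative \<phi> (at x)"
      by (rule frechet_derivative_at)
    then show ?thesis
      by (metis (mono_tags))
  qed
  show "\<exists>M. \<forall>x. \<bar>frechet_derivative \<phi> (at x) i\<bar> \<le> M" if "i \<in> Basis"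
    using continuous_compact_support_bounded[OF c'[OF that] K(1) out'] by metis
qed

lemma test_set_integrable:
  fixes f :: "'a::euclidean_space \<Rightarrow> 'b::{banach, second_countable_topology}"
  assumes "f \<in> Linf D" "open D" "bounded D" "test_function D \<phi>"
  shows "set_integrable lebesgue D (\<lambda>x. \<phi> x *\<^sub>R f x)"
    and "i \<in> Basis \<Longrightarrow> set_integrable lebesgue D (\<lambda>x. frechet_derivative \<phi> (at x) i *\<^sub>R f x)"
proof -
  obtain M where M: "\<And>x. \<bar>\<phi> x\<bar> \<le> M"
    using test_functionD(2)[OF assms(4)] by blast
  then show "set_integrable lebesgue D (\<lambda>x. \<phi> x *\<^sub>R f x)"
    by (rule Linf_set_integrable[OF assms(1-3) test_functionD(1)[OF assms(4)]])
  assume i: "i \<in> Basis"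
  obtain M where "\<And>x. \<bar>frechet_derivative \<phi> (at x) i\<bar> \<le> M"
    using test_functionD(6)[OF assms(4) i] by blast
  then show "set_integrable lebesgue D (\<lambda>x. frechet_derivative \<phi> (at x) i *\<^sub>R f x)"
    by (rule Linf_set_integrable[OF assms(1-3) test_functionD(5)[OF assms(4) i]])
qed

section \<open>Linear operations on weak derivatives\<close>

lemma weak_partial_bounded_linear:
  fixes f g :: "'a::euclidean_space \<Rightarrow> 'b::{banach, second_countable_topology}"
    and T :: "'b \<Rightarrow> 'c::{banach, second_countable_topology}"
  assumes "weak_partial D i f g" "f \<in> Linf D" "g \<in> Linf D" "open D" "bounded D" "i \<in> Basis"
    and "bounded_linear T"
  shows "weak_partial D i (\<lambda>x. T (f x)) (\<lambda>x. T (g x))"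
  unfolding weak_partial_def
proof (intro allI impI)
  fix \<phi> assume \<phi>: "test_function D \<phi>"
  interpret bounded_linear T by fact
  have "(LINT x:D|lebesgue. frechet_derivative \<phi> (at x) i *\<^sub>R T (f x)) =
      T (LINT x:D|lebesgue. frechet_derivative \<phi> (at x) i *\<^sub>R f x)"
    using integral_bounded_linear[OF assms(7) test_set_integrable(2)[OF assms(2,4,5) \<phi> assms(6),
        unfolded set_integrable_def]]
    by (simp add: set_lebesgue_integral_def scaleR)
  also have "\<dots> = - T (LINT x:D|lebesgue. \<phi> x *\<^sub>R g x)"
    using assms(1) \<phi> linear_neg[OF bounded_linear.linear[OF assms(7)]]
    by (simp add: weak_partial_def)
  also have "T (LINT x:D|lebesgue. \<phi> x *\<^sub>R g x) = (LINT x:D|lebesgue. \<phi> x *\<^sub>R T (g x))"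
    using integral_bounded_linear[OF assms(7) test_set_integrable(1)[OF assms(3,4,5) \<phi>,
        unfolded set_integrable_def]]
    by (simp add: set_lebesgue_integral_def scaleR)
  finally show "(LINT x:D|lebesgue. frechet_derivative \<phi> (at x) i *\<^sub>R T (f x)) =
      - (LINT x:D|lebesgue. \<phi> x *\<^sub>R T (g x))" .
qed

lemma weak_partial_add:
  fixes f g :: "'a::euclidean_space \<Rightarrow> 'b::{banach, second_countable_topology}"
  assumes "weak_partial D i f g" "f \<in> Linf D" "g \<in> Linf D"
    and "weak_partial D i f' g'" "f' \<in> Linf D" "g' \<in> Linf D" "open D" "bounded D" "i \<in> Basis"
  shows "weak_partial D i (\<lambda>x. f x + f' x) (\<lambda>x. g x + g' x)"
  unfolding weak_partial_def
proof (intro allI impI)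
  fix \<phi> assume \<phi>: "test_function D \<phi>"
  note int = test_set_integrable[OF _ assms(7,8) \<phi>]
  show "(LINT x:D|lebesgue. frechet_derivative \<phi> (at x) i *\<^sub>R (f x + f' x)) =
      - (LINT x:D|lebesgue. \<phi> x *\<^sub>R (g x + g' x))"
    using assms \<phi> by (simp add: scaleR_add_right set_integral_add int weak_partial_def)
qed

text \<open>Serves to pass from a real field to its complex multiples \<open>c *s cvec\<close> and
  to its negative.\<close>

lemma W1inf_bounded_linear:
  fixes f :: "'a::euclidean_space \<Rightarrow> 'b::{banach, second_countable_topology}"
    and T :: "'b \<Rightarrow> 'c::{banach, second_countable_topology}"
  assumes "f \<in> W1inf D" "open D" "bounded D" "bounded_linear T"
  shows "(\<lambda>x. T (f x)) \<in> W1inf D"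
proof -
  have f: "f \<in> Linf D"
    using assms(1) by (simp add: W1inf_def)
  have "\<exists>g\<in>Linf D. weak_partial D i (\<lambda>x. T (f x)) g" if i: "i \<in> Basis" for i
  proof -
    obtain g where "g \<in> Linf D" "weak_partial D i f g"
      using assms(1) i by (auto simp: W1inf_def)
    then show ?thesis
      using weak_partial_bounded_linear[OF _ f _ assms(2,3) i assms(4)]
        Linf_bounded_linear[OF _ assms(4)] by blast
  qed
  then show ?thesis
    using Linf_bounded_linear[OF f assms(4)] by (simp add: W1inf_def)
qed

lemma W1inf_add:
  fixes f :: "'a::euclidean_space \<Rightarrow> 'b::{banach, second_countable_topology}"
  assumes "f \<in> W1inf D" "g \<in> W1inf D" "open D" "bounded D"
  shows "(\<lambda>x. f x + g x) \<in> W1inf D"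
proof -
  have fg: "f \<in> Linf D" "g \<in> Linf D"
    using assms(1,2) by (simp_all add: W1inf_def)
  have "\<exists>h\<in>Linf D. weak_partial D i (\<lambda>x. f x + g x) h" if i: "i \<in> Basis" for i
  proof -
    obtain f' where "f' \<in> Linf D" "weak_partial D i f f'"
      using assms(1) i by (auto simp: W1inf_def)
    moreover obtain g' where "g' \<in> Linf D" "weak_partial D i g g'"
      using assms(2) i by (auto simp: W1inf_def)
    ultimately show ?thesis
      using weak_partial_add[OF _ fg(1) _ _ fg(2) _ assms(3,4) i] Linf_add by blast
  qed
  then show ?thesis
    using Linf_add[OF fg] by (simp add: W1inf_def)
qed

lemma translation_test_integral:
  fixes \<phi> F :: "'a::euclidean_space \<Rightarrow> real"
  assumes "\<phi> \<in> borel_measurable borel" "F \<in> borel_measurable borel"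
  shows "(LINT x|lborel. \<phi> (x + v) * F x) = (LINT x|lborel. \<phi> x * F (x - v))"
proof -
  have "(LINT x|distr lborel borel ((+) v). \<phi> x * F (x - v)) = (LINT x|lborel. \<phi> (v + x) * F (v + x - v))"
    using assms by (intro integral_distr) auto
  then show ?thesis
    by (simp add: lborel_distr_plus add.commute)
qed

text \<open>The difference quotient is moved from the test function to \<open>f\<close> by a translation.
  This replaces Rademacher's theorem.\<close>

lemma lipschitz_test_derivative_bound:
  fixes f :: "'a::euclidean_space \<Rightarrow> real"
  assumes D: "open D" "bounded D" and f: "L-lipschitz_on D f"
    and \<phi>: "test_function D \<phi>" "\<And>x. 0 \<le> \<phi> x" and i: "i \<in> Basis"
  shows "\<bar>LINT x:D|lebesgue. frechet_derivative \<phi> (at x) i * f x\<bar> \<le> L * (LINT x:D|lebesgue. \<phi> x)"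
proof -
  define F where "F x = indicator D x * f x" for x
  define \<phi>' where "\<phi>' x = frechet_derivative \<phi> (at x) i" for x
  let ?K = "closure {x. \<phi> x \<noteq> 0}"
  have K: "compact ?K" "?K \<subseteq> D"
    using \<phi> by (auto simp: test_function_def)
  \<comment> \<open>\<open>d\<close> is a margin: a point of the support of \<open>\<phi>\<close>
    moved by less than \<open>d\<close> stays in \<open>D\<close>.\<close>
  obtain d where d: "d > 0" "(\<Union>x\<in>?K. ball x d) \<subseteq> D"
    using compact_subset_open_imp_ball_epsilon_subset[OF K(1) D(1) K(2)] .
  have L: "0 \<le> L"
    using f lipschitz_on_nonneg by blast
  have "bounded (f ` D)"
    using D(2) f lipschitz_on_uniformly_continuous bounded_uniformly_continuous_image by blast
  then obtain C where C: "\<And>x. x \<in> D \<Longrightarrow> \<bar>f x\<bar> \<le> C"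
    unfolding bounded_real by auto
  have D': "D \<in> sets borel" "emeasure lborel D < \<infinity>"
    using D emeasure_bounded_finite by auto
  have Fm [measurable]: "F \<in> borel_measurable borel"
    unfolding F_def[abs_def] using D' lipschitz_on_continuous_on[OF f]
      borel_measurable_continuous_on_indicator[of D f] by simp
  have \<phi>m [measurable]: "\<phi> \<in> borel_measurable borel"
    using test_functionD(1)[OF \<phi>(1)] by (rule borel_measurable_continuous_onI)
  have \<phi>'m [measurable]: "\<phi>' \<in> borel_measurable borel"
    unfolding \<phi>'_def[abs_def]
    using test_functionD(5)[OF \<phi>(1) i] by (rule borel_measurable_continuous_onI)
  obtain M where M: "\<And>x. \<bar>\<phi>' x\<bar> \<le> M"
    using test_functionD(6)[OF \<phi>(1) i] unfolding \<phi>'_def by blast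
  obtain M0 where M0: "\<And>x. \<bar>\<phi> x\<bar> \<le> M0"
    using test_functionD(2)[OF \<phi>(1)] by blast
  have deriv: "((\<lambda>s. \<phi> (x + s *\<^sub>R i)) has_real_derivative \<phi>' (x + s *\<^sub>R i)) (at s)" for x s
  proof -
    have "((\<lambda>s. \<phi> (x + s *\<^sub>R i)) has_derivative
        (\<lambda>h. frechet_derivative \<phi> (at (x + s *\<^sub>R i)) (h *\<^sub>R i))) (at s)"
      by (rule has_derivative_compose[OF _ test_functionD(4)[OF \<phi>(1)]])
        (auto intro!: derivative_eq_intros)
    moreover have "frechet_derivative \<phi> (at (x + s *\<^sub>R i)) (h *\<^sub>R i) = h * \<phi>' (x + s *\<^sub>R i)" for h
      unfolding \<phi>'_def
      using linear_cmul[OF has_derivative_linear[OF test_functionD(4)[OF \<phi>(1)]]] by simp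
    ultimately show ?thesis
      by (simp add: has_field_derivative_def mult_commute_abs)
  qed
  have mvt: "\<bar>\<phi> (x + t *\<^sub>R i) - \<phi> x\<bar> \<le> M * t" if t: "t > 0" for x t
  proof -
    obtain s where "\<phi> (x + t *\<^sub>R i) - \<phi> (x + 0 *\<^sub>R i) = (t - 0) * \<phi>' (x + s *\<^sub>R i)"
      using MVT2[OF t deriv] by blast
    then show ?thesis
      using M[of "x + s *\<^sub>R i"] t by (simp add: abs_mult mult.commute)
  qed
  \<comment> \<open>The \<open>+ 2\<close> makes \<open>t n < d\<close> strict already for
    \<open>n = 0\<close>.\<close>
  define t where "t n = d / real (n + 2)" for n
  have t: "t n > 0" "t n < d" for n
    using d by (auto simp: t_def field_simps add_pos_nonneg)
  have t0: "t \<longlonglongrightarrow> 0"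
    using LIMSEQ_Suc[OF LIMSEQ_Suc[OF tendsto_divide_0[OF tendsto_const
          filterlim_at_top_imp_at_infinity[OF filterlim_real_sequentially]]], of d]
    by (simp add: t_def[abs_def])
  let ?q = "\<lambda>n x. (\<phi> (x + t n *\<^sub>R i) - \<phi> x) / t n * F x"
  have intD: "integrable lborel (\<lambda>x. indicator D x * c :: real)" for c
    using D' by (intro integrable_mult_left) (auto simp: integrable_real_indicator)
  have Fb: "\<bar>F x\<bar> \<le> indicator D x * C" for x
    using C by (auto simp: F_def indicator_def)
  have int1: "integrable lborel (\<lambda>x. \<phi> (x + v) * F x)" for v
  proof (rule Bochner_Integration.integrable_bound[OF intD[of "M0 * \<bar>C\<bar>"]])
    show "AE x in lborel. norm (\<phi> (x + v) * F x) \<le> norm (indicator D x * (M0 * \<bar>C\<bar>))"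
    proof (intro AE_I2)
      fix x
      have "0 \<le> M0"
        using M0[of x] by linarith
      have "\<bar>\<phi> (x + v)\<bar> * \<bar>F x\<bar> \<le> M0 * (indicator D x * \<bar>C\<bar>)"
        using C[of x] \<open>0 \<le> M0\<close> by (intro mult_mono M0) (auto simp: F_def indicator_def)
      then show "norm (\<phi> (x + v) * F x) \<le> norm (indicator D x * (M0 * \<bar>C\<bar>))"
        using \<open>0 \<le> M0\<close> by (simp add: abs_mult mult.left_commute)
    qed
  qed measurable
  have int2: "integrable lborel (\<lambda>x. \<phi> x * F (x - v))" for v
  proof (rule Bochner_Integration.integrable_bound[OF intD[of "M0 * \<bar>C\<bar>"]])
    have "\<bar>F (x - v)\<bar> \<le> \<bar>C\<bar>" for x
      using C[of "x - v"] by (auto simp: F_def indicator_def)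
    then have "\<bar>\<phi> x\<bar> * \<bar>F (x - v)\<bar> \<le> indicator D x * (M0 * \<bar>C\<bar>)" for x
      using M0[of x] test_functionD(3)[OF \<phi>(1), of x]
      by (cases "x \<in> D") (auto intro!: mult_mono)
    moreover have "0 \<le> M0"
      using M0[of 0] by linarith
    ultimately show "AE x in lborel. norm (\<phi> x * F (x - v)) \<le> norm (indicator D x * (M0 * \<bar>C\<bar>))"
      by (intro AE_I2) (simp add: abs_mult)
  qed measurable
  have \<phi>int: "integrable lborel \<phi>"
    by (rule Bochner_Integration.integrable_bound[OF intD[of M0]])
      (use M0 test_functionD(3)[OF \<phi>(1)] in \<open>auto simp: indicator_def intro!: order_trans[OF _ abs_ge_self]\<close>)
  \<comment> \<open>\<open>F\<close> is \<open>f\<close> extended by zero and may jump across the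
    boundary of \<open>D\<close>. Where \<open>\<phi> x\<close> is nonzero, however, both
    \<open>x\<close> and the shifted point lie in \<open>D\<close>, and the Lipschitz bound of
    \<open>f\<close> applies.\<close>
  have quot: "\<bar>\<phi> x * F (x - t n *\<^sub>R i) / t n - \<phi> x * F x / t n\<bar> \<le> L * \<phi> x" for n x
  proof (cases "\<phi> x = 0")
    case False
    then have xK: "x \<in> ?K"
      by (simp add: closure_subset[THEN subsetD])
    have "dist x (x - t n *\<^sub>R i) < d"
      using t[of n] i by (simp add: dist_norm)
    then have "x - t n *\<^sub>R i \<in> ball x d"
      by (simp only: mem_ball)
    then have xD: "x \<in> D" "x - t n *\<^sub>R i \<in> D"
      using d(2) K(2) xK by blast+
    then have "\<bar>F (x - t n *\<^sub>R i) - F x\<bar> \<le> L * t n"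
      using lipschitz_onD(1)[OF f, of "x - t n *\<^sub>R i" x] t[of n] i
      by (simp add: F_def dist_norm)
    then have a: "\<bar>F (x - t n *\<^sub>R i) - F x\<bar> / t n \<le> L"
      using t[of n] by (simp add: field_simps)
    have b: "\<bar>\<phi> x * F (x - t n *\<^sub>R i) / t n - \<phi> x * F x / t n\<bar> =
        \<phi> x * (\<bar>F (x - t n *\<^sub>R i) - F x\<bar> / t n)"
      using \<phi>(2)[of x] t[of n]
      by (simp add: abs_mult flip: right_diff_distrib diff_divide_distrib)
    show ?thesis
      unfolding b mult.commute[of L] using a \<phi>(2) by (rule mult_left_mono)
  qed simp
  have bound: "\<bar>LINT x|lborel. ?q n x\<bar> \<le> L * (LINT x|lborel. \<phi> x)" for n
  proof -
    have "(LINT x|lborel. ?q n x) =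
        (LINT x|lborel. \<phi> (x + t n *\<^sub>R i) * F x / t n - \<phi> x * F x / t n)"
      by (simp add: diff_divide_distrib left_diff_distrib)
    also have "\<dots> = (LINT x|lborel. \<phi> (x + t n *\<^sub>R i) * F x) / t n - (LINT x|lborel. \<phi> x * F x) / t n"
      using int1[of "t n *\<^sub>R i"] int1[of 0] by simp
    also have "\<dots> = (LINT x|lborel. \<phi> x * F (x - t n *\<^sub>R i)) / t n - (LINT x|lborel. \<phi> x * F x) / t n"
      by (simp add: translation_test_integral)
    also have "\<dots> = (LINT x|lborel. \<phi> x * F (x - t n *\<^sub>R i) / t n - \<phi> x * F x / t n)"
      using int2[of "t n *\<^sub>R i"] int2[of 0] by simp
    finally have "\<bar>LINT x|lborel. ?q n x\<bar> =
        \<bar>LINT x|lborel. \<phi> x * F (x - t n *\<^sub>R i) / t n - \<phi> x * F x / t n\<bar>"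
      by simp
    also have "\<dots> \<le> (LINT x|lborel. L * \<phi> x)"
      using Bochner_Integration.integral_norm_bound_integral[of lborel
          "\<lambda>x. \<phi> x * F (x - t n *\<^sub>R i) / t n - \<phi> x * F x / t n" "\<lambda>x. L * \<phi> x"]
        int2[of "t n *\<^sub>R i"] int2[of 0] \<phi>int quot by simp
    finally show ?thesis
      by simp
  qed
  have lim: "(\<lambda>n. LINT x|lborel. ?q n x) \<longlonglongrightarrow> (LINT x|lborel. \<phi>' x * F x)"
  proof (rule integral_dominated_convergence[where w = "\<lambda>x. indicator D x * (M * C)"])
    show "AE x in lborel. (\<lambda>n. ?q n x) \<longlonglongrightarrow> \<phi>' x * F x"
    proof (intro AE_I2 tendsto_mult tendsto_const)
      fix x
      have "((\<lambda>h. (\<phi> (x + h *\<^sub>R i) - \<phi> x) / h) \<longlongrightarrow> \<phi>' x) (at 0)"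
        using deriv[of x 0] by (simp add: DERIV_def)
      moreover have "t n \<noteq> 0" for n
        using t(1)[of n] by simp
      then have "filterlim t (at 0) sequentially"
        by (intro filterlim_atI[OF t0] always_eventually) simp
      ultimately show "(\<lambda>n. (\<phi> (x + t n *\<^sub>R i) - \<phi> x) / t n) \<longlonglongrightarrow> \<phi>' x"
        by (rule filterlim_compose)
    qed
    show "AE x in lborel. norm (?q n x) \<le> indicator D x * (M * C)" for n
    proof (intro AE_I2)
      fix x
      have "\<bar>(\<phi> (x + t n *\<^sub>R i) - \<phi> x) / t n\<bar> \<le> M"
        using mvt[of "t n" x] t[of n] by (simp add: field_simps)
      then have "norm (?q n x) \<le> M * (indicator D x * C)"
        unfolding real_norm_def abs_mult using Fb[of x] M[of x]
        by (intro mult_mono) auto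
      then show "norm (?q n x) \<le> indicator D x * (M * C)"
        by (simp add: algebra_simps)
    qed
  qed (use intD in auto)
  have "\<bar>LINT x|lborel. \<phi>' x * F x\<bar> \<le> L * (LINT x|lborel. \<phi> x)"
    using LIMSEQ_le_const2[OF tendsto_rabs[OF lim]] bound by blast
  moreover have "(LINT x:D|lebesgue. \<phi>' x * f x) = (LINT x|lborel. \<phi>' x * F x)"
    unfolding set_lebesgue_integral_def F_def
    using Fm \<phi>'m by (subst integral_completion[symmetric])
      (auto simp: F_def[abs_def] algebra_simps intro!: measurable_completion borel_measurable_times)
  moreover have "(LINT x:D|lebesgue. \<phi> x) = (LINT x|lborel. \<phi> x)"
  proof -
    have "(\<lambda>x. indicator D x *\<^sub>R \<phi> x) = \<phi>"
      using test_functionD(3)[OF \<phi>(1)] by (auto simp: indicator_def fun_eq_iff)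
    then show ?thesis
      unfolding set_lebesgue_integral_def by (simp add: integral_completion)
  qed
  ultimately show ?thesis
    by (simp add: \<phi>'_def)
qed


text \<open>The sign of the integral is carried from bumps to finite unions of boxes, then to open
  sets by exhausting them with countably many boxes, and finally to the set where the function is
  negative, by outer regularity. There a nonnegative integral forces measure zero.\<close>

lemma AE_nonneg_of_test:
  fixes \<psi> :: "'a::euclidean_space \<Rightarrow> real"
  assumes D: "open D" "bounded D" and \<psi>: "\<psi> \<in> Linf D"
    and test: "\<And>\<phi>. test_function D \<phi> \<Longrightarrow> (\<And>x. 0 \<le> \<phi> x) \<Longrightarrow> 0 \<le> (LINT x:D|lebesgue. \<phi> x * \<psi> x)"
  shows "AE x\<in>D in lebesgue. 0 \<le> \<psi> x"
proof -
  define P where "P x = indicator D x * \<psi> x" for x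
  have P: "integrable lebesgue P"
    using Linf_set_integrable[OF \<psi> D, of "\<lambda>_. 1" 1]
    by (simp add: set_integrable_def P_def[abs_def])
  have Pm [measurable]: "P \<in> borel_measurable lebesgue"
    using P by (rule borel_measurable_integrable)
  obtain C where "AE x\<in>D in lebesgue. norm (\<psi> x) \<le> C"
    using \<psi> by (auto simp: Linf_def)
  then have C: "AE x in lebesgue. \<bar>P x\<bar> \<le> \<bar>C\<bar>"
    by eventually_elim (auto simp: P_def indicator_def)
  have setint: "integrable lebesgue (\<lambda>x. indicator A x * P x)" if "A \<in> sets lebesgue" for A
    using integrable_mult_indicator[OF that P] by simp
  let ?U = "\<lambda>S. (\<Union>c\<in>S. box (fst c) (snd c))"
  have fin: "0 \<le> (LINT x|lebesgue. indicator (?U S) x * P x)"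
    if S: "finite S" "(\<Union>c\<in>S. cbox (fst c) (snd c)) \<subseteq> D" for S
  proof -
    have lim: "(\<lambda>n. LINT x|lebesgue. boxes_bump S n x * P x) \<longlonglongrightarrow>
        (LINT x|lebesgue. indicator (?U S) x * P x)"
    proof (rule integral_dominated_convergence[where w = "\<lambda>x. \<bar>P x\<bar>"])
      show "AE x in lebesgue. (\<lambda>n. boxes_bump S n x * P x) \<longlonglongrightarrow> indicator (?U S) x * P x"
        by (intro AE_I2 tendsto_mult tendsto_const boxes_bump_tendsto S(1))
      show "AE x in lebesgue. norm (boxes_bump S n x * P x) \<le> \<bar>P x\<bar>" for n
        using boxes_bump_nonneg[of S n] boxes_bump_le[of S n]
        by (intro AE_I2) (auto simp: abs_mult intro!: mult_left_le_one_le)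
      have "boxes_bump S n \<in> borel_measurable lebesgue" for n
        using test_functionD(1)[OF test_function_boxes_bump[OF S]]
        by (simp add: borel_measurable_continuous_onI measurable_completion)
      then show "(\<lambda>x. boxes_bump S n x * P x) \<in> borel_measurable lebesgue" for n
        by measurable
      have "open (?U S)"
        by auto
      then have "?U S \<in> sets lebesgue"
        by (simp add: borel_open sets_completionI_sets)
      then show "(\<lambda>x. indicator (?U S) x * P x) \<in> borel_measurable lebesgue"
        by measurable
    qed (use P in auto)
    have "0 \<le> (LINT x|lebesgue. boxes_bump S n x * P x)" for n
      using test[OF test_function_boxes_bump[OF S] boxes_bump_nonneg]
      by (simp add: set_lebesgue_integral_def P_def mult.left_commute)
    then show ?thesis
      using LIMSEQ_le_const[OF lim] by blast
  qed
  have op: "0 \<le> (LINT x|lebesgue. indicator G x * P x)" if G: "open G" "G \<subseteq> D" for G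
  proof -
    let ?F = "{box a b |a b. cbox a b \<subseteq> G}"
    obtain F' where F': "F' \<subseteq> ?F" "countable F'" "\<Union>F' = \<Union>?F"
      using Lindelof[of ?F] by blast
    have "\<Union>?F = G"
    proof (intro equalityI subsetI)
      fix x assume "x \<in> G"
      then obtain a b where "cbox a b \<subseteq> G" "x \<in> box a b"
        using open_contains_cbox G by metis
      then show "x \<in> \<Union>?F"
        by blast
    qed (use box_subset_cbox in blast)
    show ?thesis
    proof (cases "F' = {}")
      case True
      then show ?thesis
        using F' \<open>\<Union>?F = G\<close> by simp
    next
      case False
      define B where "B = from_nat_into F'"
      have B: "range B = F'"
        unfolding B_def using False F'(2) by (rule range_from_nat_into)
      have "\<exists>c. B n = box (fst c) (snd c) \<and> cbox (fst c) (snd c) \<subseteq> G" for n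
      proof -
        have "B n \<in> ?F"
          using B F'(1) by blast
        then obtain a b where "B n = box a b" "cbox a b \<subseteq> G"
          by blast
        then show ?thesis
          by (intro exI[of _ "(a, b)"]) simp
      qed
      then obtain c where c: "\<And>n. B n = box (fst (c n)) (snd (c n))"
          "\<And>n. cbox (fst (c n)) (snd (c n)) \<subseteq> G"
        by metis
      have Gc: "G = (\<Union>n. box (fst (c n)) (snd (c n)))"
        using B F'(3) \<open>\<Union>?F = G\<close> c(1) by auto
      let ?V = "\<lambda>n. ?U (c ` {..n})"
      have mV: "?V n \<in> sets lebesgue" for n
        by (intro sets_completionI_sets) auto
      have mG: "G \<in> sets lebesgue"
        using G by (simp add: borel_open sets_completionI_sets)
      have "(\<lambda>n. LINT x|lebesgue. indicator (?V n) x * P x) \<longlonglongrightarrow> (LINT x|lebesgue. indicator G x * P x)"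
      proof (rule integral_dominated_convergence[where w = "\<lambda>x. \<bar>P x\<bar>"])
        show "AE x in lebesgue. (\<lambda>n. indicator (?V n) x * P x) \<longlonglongrightarrow> indicator G x * P x"
        proof (intro AE_I2 tendsto_mult tendsto_const)
          fix x
          have "incseq ?V"
            unfolding incseq_def by (intro allI impI UN_mono image_mono) auto
          from LIMSEQ_indicator_incseq[OF this, of x]
          show "(\<lambda>n. indicator (?V n) x :: real) \<longlonglongrightarrow> indicator G x"
            unfolding Gc by (rule back_subst[where P = "\<lambda>A. _ \<longlonglongrightarrow> indicator A x"]) auto
        qed
        show "AE x in lebesgue. norm (indicator (?V n) x * P x) \<le> \<bar>P x\<bar>" for n
          by (intro AE_I2) (auto simp: indicator_def)
        show "(\<lambda>x. indicator (?V n) x * P x) \<in> borel_measurable lebesgue" for n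
          by (rule borel_measurable_integrable[OF setint[OF mV]])
        show "(\<lambda>x. indicator G x * P x) \<in> borel_measurable lebesgue"
          by (rule borel_measurable_integrable[OF setint[OF mG]])
      qed (use P in auto)
      moreover have "0 \<le> (LINT x|lebesgue. indicator (?V n) x * P x)" for n
        by (rule fin) (use c(2) G(2) in auto)
      ultimately show ?thesis
        using LIMSEQ_le_const by blast
    qed
  qed
  define A where "A = {x. P x < 0}"
  have mA: "A \<in> sets lebesgue"
    unfolding A_def using Pm by (rule borel_measurable_less[of _ _ "\<lambda>_. 0", simplified, where M = lebesgue, simplified])
  have AD: "A \<subseteq> D"
    by (auto simp: A_def P_def indicator_def split: if_splits)
  \<comment> \<open>\<open>P\<close> is at most \<open>\<bar>C\<bar>\<close> almost everywhere, so
    enlarging \<open>A\<close> to an open set of excess measure at most \<open>e\<close> raises the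
    integral by at most \<open>\<bar>C\<bar> * e\<close>.\<close>
  have lower: "- (\<bar>C\<bar> * e) \<le> (LINT x|lebesgue. indicator A x * P x)" if e: "e > 0" for e
  proof -
    obtain G0 where G0: "open G0" "A \<subseteq> G0" "(G0 - A) \<in> lmeasurable" "emeasure lebesgue (G0 - A) < ennreal e"
      using sets_lebesgue_outer_open[OF mA e] .
    define G where "G = G0 \<inter> D"
    have G: "open G" "A \<subseteq> G" "G \<subseteq> D"
      using G0 D AD by (auto simp: G_def)
    have GA: "G - A \<in> sets lebesgue"
      using mA G(1) by (simp add: borel_open sets.Diff sets_completionI_sets)
    have em: "emeasure lebesgue (G - A) < ennreal e"
      by (rule le_less_trans[OF emeasure_mono G0(4)]) (use G0(3) in \<open>auto simp: G_def\<close>)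
    have lm: "G - A \<in> lmeasurable"
      using GA order_less_trans[OF em ennreal_less_top] by (intro fmeasurableI) simp_all
    have "measure lebesgue (G - A) \<le> e"
      using em lm e by (simp add: emeasure_eq_measure2 fmeasurableD2 less_imp_le ennreal_less_iff)
    have "0 \<le> (LINT x|lebesgue. indicator G x * P x)"
      by (rule op[OF G(1,3)])
    also have "\<dots> = (LINT x|lebesgue. indicator A x * P x + indicator (G - A) x * P x)"
      using G(2) by (intro Bochner_Integration.integral_cong) (auto simp: indicator_def)
    also have "\<dots> = (LINT x|lebesgue. indicator A x * P x) + (LINT x|lebesgue. indicator (G - A) x * P x)"
      using setint mA GA by (intro Bochner_Integration.integral_add) auto
    also have "(LINT x|lebesgue. indicator (G - A) x * P x) \<le> (LINT x|lebesgue. indicator (G - A) x * \<bar>C\<bar>)"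
    proof (rule integral_mono_AE)
      show "AE x in lebesgue. indicator (G - A) x * P x \<le> indicator (G - A) x * \<bar>C\<bar>"
        using C by eventually_elim (auto simp: indicator_def)
    qed (use setint GA lm in \<open>auto simp: fmeasurable_def integrable_real_indicator intro!: integrable_mult_left\<close>)
    also have "(LINT x|lebesgue. indicator (G - A) x * \<bar>C\<bar>) = measure lebesgue (G - A) * \<bar>C\<bar>"
      using lm by simp
    also have "\<dots> \<le> e * \<bar>C\<bar>"
      using \<open>measure lebesgue (G - A) \<le> e\<close> by (intro mult_right_mono) auto
    finally show ?thesis
      by (simp add: mult.commute)
  qed
  have "0 \<le> (LINT x|lebesgue. indicator A x * P x)"
  proof (rule field_le_epsilon)
    fix d :: real assume "d > 0"
    then have "- (\<bar>C\<bar> * (d / (\<bar>C\<bar> + 1))) \<le> (LINT x|lebesgue. indicator A x * P x)"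
      by (intro lower) auto
    moreover have "\<bar>C\<bar> * (d / (\<bar>C\<bar> + 1)) \<le> d"
      using \<open>d > 0\<close> by (simp add: field_simps)
    ultimately show "0 \<le> (LINT x|lebesgue. indicator A x * P x) + d"
      by linarith
  qed
  moreover have "0 \<le> (LINT x|lebesgue. - (indicator A x * P x))"
    by (intro integral_nonneg_AE AE_I2) (auto simp: indicator_def A_def)
  ultimately have "(LINT x|lebesgue. - (indicator A x * P x)) = 0"
    by simp
  then have "AE x in lebesgue. - (indicator A x * P x) = 0"
    by (subst (asm) integral_nonneg_eq_0_iff_AE)
      (use setint[OF mA] in \<open>auto simp: indicator_def A_def intro!: AE_I2\<close>)
  then show ?thesis
    by eventually_elim (auto simp: A_def P_def indicator_def split: if_splits)
qed

text \<open>Against a nonnegative \<open>\<phi>\<close>, the integral of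
  \<open>\<phi> * (L - g)\<close> is \<open>L\<close> times the integral of \<open>\<phi>\<close>
  plus the integral of \<open>f\<close> times the partial derivative of \<open>\<phi>\<close>. By
  \<open>lipschitz_test_derivative_bound\<close> the second summand cannot outweigh the
  first.\<close>

lemma weak_partial_le_lipschitz:
  fixes f g :: "'a::euclidean_space \<Rightarrow> real"
  assumes D: "open D" "bounded D" and f: "L-lipschitz_on D f"
    and g: "g \<in> Linf D" "weak_partial D i f g" and i: "i \<in> Basis"
  shows "AE x\<in>D in lebesgue. g x \<le> L"
proof -
  have "AE x\<in>D in lebesgue. 0 \<le> L + (-1) * g x"
  proof (rule AE_nonneg_of_test[OF D])
    have "D \<in> sets lebesgue"
      using D by (simp add: borel_open sets_completionI_sets)
    then have L: "(\<lambda>x. L) \<in> Linf D"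
      unfolding Linf_def set_borel_measurable_def by (auto intro!: exI[of _ "\<bar>L\<bar>"])
    show "(\<lambda>x. L + (-1) * g x) \<in> Linf D"
      by (intro Linf_add L Linf_bounded_linear[OF g(1)] bounded_linear_mult_right)
    fix \<phi> assume \<phi>: "test_function D \<phi>" "\<And>x. 0 \<le> \<phi> x"
    have "(LINT x:D|lebesgue. \<phi> x * (L + (-1) * g x)) =
        (LINT x:D|lebesgue. \<phi> x *\<^sub>R L - \<phi> x *\<^sub>R g x)"
      by (simp add: algebra_simps)
    also have "\<dots> = (LINT x:D|lebesgue. \<phi> x *\<^sub>R L) - (LINT x:D|lebesgue. \<phi> x *\<^sub>R g x)"
      by (intro set_integral_diff test_set_integrable[OF _ D \<phi>(1)] L g(1))
    also have "(LINT x:D|lebesgue. \<phi> x *\<^sub>R g x) =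
        - (LINT x:D|lebesgue. frechet_derivative \<phi> (at x) i *\<^sub>R f x)"
      using g(2) \<phi>(1) by (simp add: weak_partial_def)
    finally show "0 \<le> (LINT x:D|lebesgue. \<phi> x * (L + (-1) * g x))"
      using lipschitz_test_derivative_bound[OF D f \<phi> i] by (simp add: mult.commute)
  qed
  then show ?thesis
    by eventually_elim auto
qed

text \<open>The components along the basis vectors and along their negatives are bounded by
  \<open>L\<close>; comparing the norm with the sum of the absolute components costs the factor
  \<open>DIM('b)\<close>.\<close>

lemma weak_partial_norm_le:
  fixes f g :: "'a::euclidean_space \<Rightarrow> 'b::euclidean_space"
  assumes D: "open D" "bounded D" and f: "L-lipschitz_on D f" "f \<in> Linf D"
    and g: "g \<in> Linf D" "weak_partial D i f g" and i: "i \<in> Basis"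
  shows "AE x\<in>D in lebesgue. norm (g x) \<le> real DIM('b) * L"
proof -
  have le: "AE x\<in>D in lebesgue. g x \<bullet> u \<le> L" if "norm u = 1" for u
  proof (rule weak_partial_le_lipschitz[OF D _ _ _ i])
    show "L-lipschitz_on D (\<lambda>x. f x \<bullet> u)"
    proof (rule lipschitz_onI)
      fix x y assume "x \<in> D" "y \<in> D"
      have "dist (f x \<bullet> u) (f y \<bullet> u) \<le> dist (f x) (f y)"
        using Cauchy_Schwarz_ineq2[of "f x - f y" u] that
        by (simp add: dist_norm inner_diff_left)
      also have "\<dots> \<le> L * dist x y"
        using f(1) \<open>x \<in> D\<close> \<open>y \<in> D\<close> by (rule lipschitz_onD)
      finally show "dist (f x \<bullet> u) (f y \<bullet> u) \<le> L * dist x y" .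
    qed (use f(1) lipschitz_on_nonneg in blast)
    show "(\<lambda>x. g x \<bullet> u) \<in> Linf D"
      by (intro Linf_bounded_linear[OF g(1)] bounded_linear_inner_left)
    show "weak_partial D i (\<lambda>x. f x \<bullet> u) (\<lambda>x. g x \<bullet> u)"
      by (intro weak_partial_bounded_linear[OF g(2) f(2) g(1) D i] bounded_linear_inner_left)
  qed
  have "AE x in lebesgue. \<forall>u\<in>Basis. (x \<in> D \<longrightarrow> g x \<bullet> u \<le> L) \<and> (x \<in> D \<longrightarrow> g x \<bullet> (- u) \<le> L)"
  proof (intro AE_finite_allI AE_conjI)
    fix u :: 'b assume "u \<in> Basis"
    then show "AE x\<in>D in lebesgue. g x \<bullet> u \<le> L" "AE x\<in>D in lebesgue. g x \<bullet> (- u) \<le> L"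
      by (intro le; simp)+
  qed simp
  then show ?thesis
  proof eventually_elim
    case (elim x)
    have "norm (g x) \<le> real DIM('b) * L" if "x \<in> D"
    proof -
      have "norm (g x) \<le> (\<Sum>u\<in>Basis. \<bar>g x \<bullet> u\<bar>)"
        by (rule norm_le_l1)
      also have "\<dots> \<le> (\<Sum>u\<in>(Basis::'b set). L)"
        using elim that by (intro sum_mono) (auto simp: abs_le_iff)
      finally show ?thesis
        by simp
    qed
    then show ?case
      by blast
  qed
qed

text \<open>The norm selects weak derivatives with \<open>SOME\<close>. The preceding bound holds
  for every weak derivative, hence for the selected one, whose existence is part of
  \<open>f \<in> W1inf D\<close>.\<close>

lemma W1inf_norm_le_lipschitz:
  fixes f :: "'a::euclidean_space \<Rightarrow> 'b::euclidean_space"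
  assumes D: "open D" "bounded D" and f: "L-lipschitz_on D f" "f \<in> W1inf D"
    and B: "0 \<le> B" "\<And>x. x \<in> D \<Longrightarrow> norm (f x) \<le> B"
  shows "W1inf_norm D f \<le> B + real DIM('a) * (real DIM('b) * L)"
proof -
  have f': "f \<in> Linf D"
    using f(2) by (simp add: W1inf_def)
  have L: "0 \<le> L"
    using f(1) lipschitz_on_nonneg by blast
  have "Linf_norm D f \<le> B"
    using B by (intro Linf_norm_le) auto
  moreover have "Linf_norm D (SOME g. g \<in> Linf D \<and> weak_partial D i f g) \<le> real DIM('b) * L"
    if i: "i \<in> Basis" for i
  proof -
    have "\<exists>g. g \<in> Linf D \<and> weak_partial D i f g"
      using f(2) i by (auto simp: W1inf_def)
    from someI_ex[OF this] show ?thesis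
      using L by (intro Linf_norm_le weak_partial_norm_le[OF D f(1) f' _ _ i]) auto
  qed
  ultimately show ?thesis
    unfolding W1inf_norm_def
    using sum_mono[of "Basis::'a set" "\<lambda>i. Linf_norm D (SOME g. g \<in> Linf D \<and> weak_partial D i f g)"
        "\<lambda>_. real DIM('b) * L"] by auto
qed

section \<open>Series in \<open>W1inf\<close>\<close>

lemma suminf_Linf:
  fixes f :: "nat \<Rightarrow> 'a::euclidean_space \<Rightarrow> 'b::{banach, second_countable_topology}"
  assumes f: "\<And>n. f n \<in> Linf D" "\<And>n. AE x\<in>D in lebesgue. norm (f n x) \<le> a n" and a: "summable a"
  shows "(\<lambda>x. \<Sum>n. f n x) \<in> Linf D"
proof -
  have m: "(\<lambda>x. indicator D x *\<^sub>R f n x) \<in> borel_measurable lebesgue" for n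
    using f(1)[of n] by (simp add: Linf_def set_borel_measurable_def)
  have "(\<lambda>x. \<Sum>n. indicator D x *\<^sub>R f n x) = (\<lambda>x. indicator D x *\<^sub>R (\<Sum>n. f n x))"
    by (auto simp: indicator_def fun_eq_iff)
  then have "(\<lambda>x. indicator D x *\<^sub>R (\<Sum>n. f n x)) \<in> borel_measurable lebesgue"
    using borel_measurable_suminf[of "\<lambda>n x. indicator D x *\<^sub>R f n x" lebesgue, OF m] by simp
  moreover have "AE x in lebesgue. \<forall>n. x \<in> D \<longrightarrow> norm (f n x) \<le> a n"
    using f(2) by (subst AE_all_countable) blast
  then have "AE x\<in>D in lebesgue. norm (\<Sum>n. f n x) \<le> (\<Sum>n. a n)"
    by eventually_elim (auto intro!: norm_suminf_le a)
  ultimately show ?thesis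
    by (auto simp: Linf_def set_borel_measurable_def)
qed

text \<open>\<open>D\<close> has finite measure and the terms are dominated by
  \<open>M * a n\<close>, so sum and integral may be exchanged.\<close>

lemma sums_test_integral:
  fixes f :: "nat \<Rightarrow> 'a::euclidean_space \<Rightarrow> 'b::{banach, second_countable_topology}"
  assumes D: "open D" "bounded D"
    and f: "\<And>n. f n \<in> Linf D" "\<And>n. AE x\<in>D in lebesgue. norm (f n x) \<le> a n"
    and a: "summable a" "\<And>n. 0 \<le> a n"
    and u: "continuous_on UNIV u" "\<And>x. \<bar>u x\<bar> \<le> M"
  shows "(\<lambda>n. LINT x:D|lebesgue. u x *\<^sub>R f n x) sums (LINT x:D|lebesgue. u x *\<^sub>R (\<Sum>n. f n x))"
proof -
  let ?g = "\<lambda>n x. indicator D x *\<^sub>R u x *\<^sub>R f n x"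
  have M: "0 \<le> M"
    using u(2) abs_ge_zero order_trans by blast
  have all: "AE x in lebesgue. \<forall>n. x \<in> D \<longrightarrow> norm (f n x) \<le> a n"
    using f(2) by (subst AE_all_countable) blast
  have int: "integrable lebesgue (?g n)" for n
    using Linf_set_integrable[OF f(1) D u] by (simp add: set_integrable_def)
  have bnd: "norm (?g n x) \<le> indicator D x * (M * a n)" if "x \<in> D \<longrightarrow> norm (f n x) \<le> a n" for n x
    using that u(2)[of x] M by (auto simp: indicator_def intro!: mult_mono)
  have D': "D \<in> lmeasurable"
    using D by (simp add: lmeasurable_open)
  have a': "summable (\<lambda>n. M * a n)"
    by (intro summable_mult a)
  have "(\<lambda>n. integral\<^sup>L lebesgue (?g n)) sums (LINT x|lebesgue. (\<Sum>n. ?g n x))"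
  proof (rule sums_integral[OF int])
    show "AE x in lebesgue. summable (\<lambda>n. norm (?g n x))"
      using all
    proof eventually_elim
      case (elim x)
      have "norm (?g n x) \<le> M * a n" for n
        using bnd[of x n] elim M a(2)[of n] by (auto simp: indicator_def split: if_splits)
      then show ?case
        by (intro summable_comparison_test'[OF a', of 0]) simp
    qed
    have "(LINT x|lebesgue. norm (?g n x)) \<le> measure lebesgue D * (M * a n)" for n
    proof -
      have "(LINT x|lebesgue. norm (?g n x)) \<le> (LINT x|lebesgue. indicator D x * (M * a n))"
      proof (rule integral_mono_AE)
        show "AE x in lebesgue. norm (?g n x) \<le> indicator D x * (M * a n)"
          using all by eventually_elim (rule bnd, blast)
        show "integrable lebesgue (\<lambda>x. norm (?g n x))"
          by (rule integrable_norm[OF int])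
      qed (use D' in \<open>auto simp: fmeasurable_def integrable_real_indicator intro!: integrable_mult_left\<close>)
      then show ?thesis
        using D' by simp
    qed
    then show "summable (\<lambda>n. LINT x|lebesgue. norm (?g n x))"
      by (intro summable_comparison_test'[OF summable_mult[OF a'], of 0]) auto
  qed
  moreover have "(LINT x|lebesgue. (\<Sum>n. ?g n x)) = (LINT x|lebesgue. indicator D x *\<^sub>R u x *\<^sub>R (\<Sum>n. f n x))"
  proof (rule integral_cong_AE)
    show "AE x in lebesgue. (\<Sum>n. ?g n x) = indicator D x *\<^sub>R u x *\<^sub>R (\<Sum>n. f n x)"
      using all
    proof eventually_elim
      case (elim x)
      have "summable (\<lambda>n. f n x)" if "x \<in> D"
        using elim that by (intro summable_comparison_test'[OF a(1), of 0]) auto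
      then show ?case
        by (auto simp: indicator_def suminf_scaleR_right)
    qed
    show "(\<lambda>x. indicator D x *\<^sub>R u x *\<^sub>R (\<Sum>n. f n x)) \<in> borel_measurable lebesgue"
      using Linf_set_integrable[OF suminf_Linf[OF f a(1)] D u]
      by (intro borel_measurable_integrable) (simp add: set_integrable_def)
    show "(\<lambda>x. \<Sum>n. ?g n x) \<in> borel_measurable lebesgue"
      by (intro borel_measurable_suminf borel_measurable_integrable int)
  qed
  ultimately show ?thesis
    by (simp only: set_lebesgue_integral_def)
qed

text \<open>The sum of the weak derivatives of the terms is a weak derivative of the sum. It
  converges because \<open>weak_partial_norm_le\<close> controls each of them by the Lipschitz
  constant of its term.\<close>

lemma W1inf_suminf_lipschitz:
  fixes f :: "nat \<Rightarrow> 'a::euclidean_space \<Rightarrow> 'b::euclidean_space"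
  assumes D: "open D" "bounded D"
    and f: "\<And>n. f n \<in> W1inf D" "\<And>n x. x \<in> D \<Longrightarrow> norm (f n x) \<le> a n" "\<And>n. (a n)-lipschitz_on D (f n)"
    and a: "summable a"
  shows "(\<lambda>x. \<Sum>n. f n x) \<in> W1inf D"
proof -
  have fL: "f n \<in> Linf D" for n
    using f(1) by (simp add: W1inf_def)
  have fa: "AE x\<in>D in lebesgue. norm (f n x) \<le> a n" for n
    using f(2) by auto
  have a0: "0 \<le> a n" for n
    using f(3) lipschitz_on_nonneg by blast
  have "\<exists>g\<in>Linf D. weak_partial D i (\<lambda>x. \<Sum>n. f n x) g" if i: "i \<in> Basis" for i
  proof -
    have "\<forall>n. \<exists>g. g \<in> Linf D \<and> weak_partial D i (f n) g"
      using f(1) i by (auto simp: W1inf_def)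
    then obtain g where g: "\<And>n. g n \<in> Linf D" "\<And>n. weak_partial D i (f n) (g n)"
      by metis
    have ga: "AE x\<in>D in lebesgue. norm (g n x) \<le> real DIM('b) * a n" for n
      by (rule weak_partial_norm_le[OF D f(3) fL g i])
    have a': "summable (\<lambda>n. real DIM('b) * a n)"
      by (intro summable_mult a)
    have "weak_partial D i (\<lambda>x. \<Sum>n. f n x) (\<lambda>x. \<Sum>n. g n x)"
      unfolding weak_partial_def
    proof (intro allI impI)
      fix \<phi> assume \<phi>: "test_function D \<phi>"
      obtain M where M: "\<And>x. \<bar>\<phi> x\<bar> \<le> M"
        using test_functionD(2)[OF \<phi>] by blast
      obtain M' where M': "\<And>x. \<bar>frechet_derivative \<phi> (at x) i\<bar> \<le> M'"
        using test_functionD(6)[OF \<phi> i] by blast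
      have "(LINT x:D|lebesgue. frechet_derivative \<phi> (at x) i *\<^sub>R f n x) = - (LINT x:D|lebesgue. \<phi> x *\<^sub>R g n x)" for n
        using g(2) \<phi> by (simp add: weak_partial_def)
      then have "(\<lambda>n. - (LINT x:D|lebesgue. \<phi> x *\<^sub>R g n x)) sums
          (LINT x:D|lebesgue. frechet_derivative \<phi> (at x) i *\<^sub>R (\<Sum>n. f n x))"
        using sums_test_integral[OF D fL fa a a0 test_functionD(5)[OF \<phi> i] M'] by simp
      moreover have "(\<lambda>n. LINT x:D|lebesgue. \<phi> x *\<^sub>R g n x) sums (LINT x:D|lebesgue. \<phi> x *\<^sub>R (\<Sum>n. g n x))"
        using a0 by (intro sums_test_integral[OF D g(1) ga a' _ test_functionD(1)[OF \<phi>] M]) simp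
      ultimately show "(LINT x:D|lebesgue. frechet_derivative \<phi> (at x) i *\<^sub>R (\<Sum>n. f n x)) =
          - (LINT x:D|lebesgue. \<phi> x *\<^sub>R (\<Sum>n. g n x))"
        using sums_minus sums_unique2 by blast
    qed
    then show ?thesis
      using suminf_Linf[OF g(1) ga a'] by blast
  qed
  then show ?thesis
    using suminf_Linf[OF fL fa a] by (simp add: W1inf_def)
qed

section \<open>Periodic functions with bounded weak derivative\<close>

lemma Ck_cos_sin: "Ck k (cos :: real \<Rightarrow> real) \<and> Ck k (sin :: real \<Rightarrow> real)"
proof (induction k)
  case (Suc k)
  have "Ck (Suc k) (cos :: real \<Rightarrow> real)"
  proof (rule Ck_SucI[where f' = "\<lambda>x h. h * ((-1) * sin x)"])
    show "(cos has_derivative (\<lambda>h. h * ((-1) * sin x))) (at x)" for x :: real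
      by (auto intro!: derivative_eq_intros)
    show "Ck k (\<lambda>x. i * ((-1) * sin x))" for i :: real
      using Suc by (intro Ck_mult Ck_const) auto
  qed
  moreover have "Ck (Suc k) (sin :: real \<Rightarrow> real)"
  proof (rule Ck_SucI[where f' = "\<lambda>x h. h * cos x"])
    show "(sin has_derivative (\<lambda>h. h * cos x)) (at x)" for x :: real
      by (auto intro!: derivative_eq_intros)
    show "Ck k (\<lambda>x. i * cos x)" for i :: real
      using Suc by (intro Ck_mult Ck_const) auto
  qed
  ultimately show ?case
    by blast
qed (auto intro: continuous_intros)

lemma periodic_int_shift:
  fixes f :: "real \<Rightarrow> 'a"
  assumes "\<And>t. f (t + c) = f t"
  shows "f (t + of_int k * c) = f t"
proof (induction k arbitrary: t rule: int_induct[of _ 0])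
  case base
  then show ?case by simp
next
  case (step1 i)
  have "f (t + of_int (i + 1) * c) = f ((t + of_int i * c) + c)"
    by (simp add: algebra_simps)
  then show ?case
    using step1 assms by simp
next
  case (step2 i)
  have "f (t + of_int (i - 1) * c) = f ((t + of_int (i - 1) * c) + c)"
    using assms by simp
  also have "(t + of_int (i - 1) * c) + c = t + of_int i * c"
    by (simp add: algebra_simps)
  finally show ?case
    using step2 by simp
qed

text \<open>Locates the support of the periodic kernel: \<open>v\<close> is reduced modulo
  \<open>2 * pi\<close> to absolute value at most \<open>pi\<close>, where the cosine decreases with
  the absolute value.\<close>

lemma cos_gt_imp_near_period:
  assumes "cos \<tau> < cos v" "0 \<le> \<tau>" "\<tau> \<le> pi"
  obtains k :: int where "\<bar>v + of_int k * (2 * pi)\<bar> < \<tau>"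
proof -
  define w where "w = v + of_int (- round (v / (2 * pi))) * (2 * pi)"
  have "\<bar>v / (2 * pi) - of_int (round (v / (2 * pi)))\<bar> \<le> 1 / 2"
    using of_int_round_abs_le[of "v / (2 * pi)"] by (simp add: abs_minus_commute)
  then have "\<bar>v / (2 * pi) - of_int (round (v / (2 * pi)))\<bar> * (2 * pi) \<le> pi"
    by (simp add: field_simps)
  moreover have "w = (v / (2 * pi) - of_int (round (v / (2 * pi)))) * (2 * pi)"
    by (simp add: w_def left_diff_distrib)
  ultimately have w: "\<bar>w\<bar> \<le> pi"
    by (simp add: abs_mult)
  have "cos v = cos w"
    unfolding w_def by (rule periodic_int_shift[of cos "2 * pi", OF cos_periodic, symmetric])
  then have "cos \<tau> < cos \<bar>w\<bar>"
    using assms(1) by simp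
  then have "\<bar>w\<bar> < \<tau>"
    using cos_mono_less_eq[of \<tau> "\<bar>w\<bar>"] w assms by simp
  then show ?thesis
    using that[of "- round (v / (2 * pi))"] by (simp add: w_def)
qed

section \<open>Mollification with a periodic kernel\<close>

context
  fixes c :: real
begin

text \<open>A smooth function of \<open>cos (x - u)\<close> is periodic and smooth from the start,
  hence a legitimate test function for \<open>weak_deriv_per\<close>. It is nonzero exactly where
  \<open>cos (x - u)\<close> exceeds \<open>c\<close>, and it is not normalized.\<close>

definition per_bump :: "real \<Rightarrow> real \<Rightarrow> real" where
  "per_bump x u = flat1 (cos (x - u) - c)"

definition per_bump' :: "real \<Rightarrow> real \<Rightarrow> real" where
  "per_bump' x u = - (flat ([:0, 0, 1:] * (1 - pderiv 1)) (cos (x - u) - c) * sin (x - u))"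

lemma per_bump_deriv: "((\<lambda>x. per_bump x u) has_real_derivative per_bump' x u) (at x)"
  and per_bump_deriv2: "(per_bump x has_real_derivative - per_bump' x u) (at u)"
proof -
  have d: "((\<lambda>x. cos (x - u) - c) has_real_derivative - sin (x - u)) (at x)"
    "((\<lambda>u. cos (x - u) - c) has_real_derivative sin (x - u)) (at u)"
    by (auto intro!: derivative_eq_intros)
  show "((\<lambda>x. per_bump x u) has_real_derivative per_bump' x u) (at x)"
    "(per_bump x has_real_derivative - per_bump' x u) (at u)"
    using DERIV_chain2[OF flat_has_derivative[of 1] d(1)]
      DERIV_chain2[OF flat_has_derivative[of 1] d(2)]
    unfolding per_bump_def[abs_def] per_bump'_def by (simp_all only: mult_minus_right minus_minus)
qed

lemma continuous_per_bump: "continuous_on A (\<lambda>u. per_bump x u)"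
  and continuous_per_bump': "continuous_on B (\<lambda>z. per_bump' (fst z) (snd z))"
  unfolding per_bump_def per_bump'_def
  by (intro continuous_intros continuous_on_compose2[OF flat_continuous]; simp)+

lemma per_bump_nonneg: "0 \<le> per_bump x u"
  by (simp add: per_bump_def flat1_nonneg)

text \<open>The addition theorem writes the argument as sums and products of \<open>cos u\<close>
  and \<open>sin u\<close>, to which the closure rules of \<open>Ck\<close> apply.\<close>

lemma smooth_per_bump: "smooth (per_bump x)"
proof -
  have "Ck k (\<lambda>u. flat1 (cos x * cos u + (sin x * sin u + - c)))" for k
    by (intro Ck_flat Ck_add Ck_mult Ck_const; simp add: Ck_cos_sin)
  moreover have "per_bump x = (\<lambda>u. flat1 (cos x * cos u + (sin x * sin u + - c)))"
    by (simp add: fun_eq_iff per_bump_def cos_diff algebra_simps)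
  ultimately show ?thesis
    by (simp add: smooth_def)
qed

lemma per_bump_periodic: "per_bump x (u + 2 * pi) = per_bump x u"
proof -
  have "cos (x - (u + 2 * pi)) = cos (x - u)"
    using cos_periodic[of "x - u - 2 * pi"] by (simp add: algebra_simps)
  then show ?thesis
    by (simp add: per_bump_def)
qed

lemma mollified_deriv:
  assumes "continuous_on UNIV f"
  shows "((\<lambda>x. integral {0..2 * pi} (\<lambda>u. f u * per_bump x u)) has_real_derivative
    integral {0..2 * pi} (\<lambda>u. f u * per_bump' x u)) (at x)"
proof -
  have f: "continuous_on A f" for A
    using assms continuous_on_subset by blast
  have "((\<lambda>x. integral (cbox 0 (2 * pi)) (\<lambda>u. f u * per_bump x u)) has_real_derivative
    integral (cbox 0 (2 * pi)) (\<lambda>u. f u * per_bump' x u)) (at x within UNIV)"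
  proof (rule leibniz_rule_field_derivative)
    show "((\<lambda>x. f t * per_bump x t) has_real_derivative f t * per_bump' x t) (at x within UNIV)" for x t
      using DERIV_cmult[OF per_bump_deriv] by simp
    show "(\<lambda>u. f u * per_bump x u) integrable_on cbox 0 (2 * pi)" for x
      by (intro integrable_continuous continuous_intros f continuous_per_bump)
    show "continuous_on (UNIV \<times> cbox 0 (2 * pi)) (\<lambda>(x, t). f t * per_bump' x t)"
      unfolding split_beta
      by (intro continuous_intros continuous_per_bump' continuous_on_compose2[OF f]) auto
  qed auto
  then show ?thesis
    by simp
qed

text \<open>The kernel depends on \<open>x - u\<close> only, so its derivative in \<open>x\<close>
  is minus its derivative in \<open>u\<close>; the weak derivative condition then moves the
  derivative onto \<open>h\<close>, which is bounded by \<open>N\<close>.\<close>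

lemma mollified_deriv_bound:
  assumes f: "continuous_on UNIV f" and h: "weak_deriv_per f h" "h \<in> Linf {0..2 * pi}"
    and N: "AE u\<in>{0..2 * pi} in lebesgue. \<bar>h u\<bar> \<le> N"
  shows "\<bar>integral {0..2 * pi} (\<lambda>u. f u * per_bump' x u)\<bar> \<le>
    N * integral {0..2 * pi} (per_bump x)"
proof -
  let ?I = "{0..2 * pi}"
  have f': "continuous_on A f" for A
    using f continuous_on_subset by blast
  have cb': "continuous_on A (\<lambda>u. per_bump' x u)" for A
    unfolding per_bump'_def
    by (intro continuous_intros continuous_on_compose2[OF flat_continuous]) simp
  have der: "deriv (per_bump x) u = - per_bump' x u" for u
    using per_bump_deriv2 by (rule DERIV_imp_deriv)
  have int: "set_integrable lebesgue ?I (\<lambda>u. f u * per_bump' x u)"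
    by (intro absolutely_integrable_continuous_real continuous_intros f' cb')
  have intb: "set_integrable lebesgue ?I (per_bump x)"
    by (intro absolutely_integrable_continuous_real continuous_per_bump)
  have "- (LINT u:?I|lebesgue. f u * per_bump' x u) = (LINT u:?I|lebesgue. f u * deriv (per_bump x) u)"
    by (simp add: der set_lebesgue_integral_def)
  also have "\<dots> = - (LINT u:?I|lebesgue. h u * per_bump x u)"
    using h(1) smooth_per_bump[of x] per_bump_periodic[of x] unfolding weak_deriv_per_def by blast
  finally have "integral ?I (\<lambda>u. f u * per_bump' x u) = (LINT u:?I|lebesgue. h u * per_bump x u)"
    using set_lebesgue_integral_eq_integral(2)[OF int] by simp
  also have "\<bar>\<dots>\<bar> \<le> (LINT u|lebesgue. norm (indicator ?I u *\<^sub>R (h u * per_bump x u)))"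
    unfolding set_lebesgue_integral_def real_norm_def[symmetric] by (rule integral_norm_bound)
  also have "\<dots> \<le> (LINT u|lebesgue. N * (indicator ?I u *\<^sub>R per_bump x u))"
  proof (rule integral_mono_AE)
    show *: "AE u in lebesgue. norm (indicator ?I u *\<^sub>R (h u * per_bump x u)) \<le>
        N * (indicator ?I u *\<^sub>R per_bump x u)"
      using N
    proof eventually_elim
      case (elim u)
      then show ?case
        using per_bump_nonneg[of x u] by (auto simp: indicator_def abs_mult intro!: mult_right_mono)
    qed
    show i: "integrable lebesgue (\<lambda>u. N * (indicator ?I u *\<^sub>R per_bump x u))"
      using intb unfolding set_integrable_def by (rule integrable_mult_right)
    have "(\<lambda>u. indicator ?I u *\<^sub>R h u) \<in> borel_measurable lebesgue"
      using h(2) by (simp add: Linf_def set_borel_measurable_def)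
    moreover have "per_bump x \<in> borel_measurable lebesgue"
      by (simp add: measurable_completion borel_measurable_continuous_onI[OF continuous_per_bump])
    ultimately have "(\<lambda>u. (indicator ?I u *\<^sub>R h u) * per_bump x u) \<in> borel_measurable lebesgue"
      by (rule borel_measurable_times)
    then show "integrable lebesgue (\<lambda>u. norm (indicator ?I u *\<^sub>R (h u * per_bump x u)))"
      by (intro integrable_norm Bochner_Integration.integrable_bound[OF i])
        (use * in \<open>auto simp: mult.assoc elim!: eventually_mono intro: order_trans[OF _ abs_ge_self]\<close>)
  qed
  also have "\<dots> = N * integral ?I (per_bump x)"
    using set_lebesgue_integral_eq_integral(2)[OF intb] by (simp add: set_lebesgue_integral_def)
  finally show ?thesis .
qed

text \<open>The mass has derivative zero in \<open>x\<close>: \<open>mollified_deriv\<close> for the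
  constant function 1 gives the integral of \<open>per_bump' x\<close> over a full period, which is
  an increment of a periodic function.\<close>

lemma per_bump_integral_const:
  "integral {0..2 * pi} (per_bump x) = integral {0..2 * pi} (per_bump y)"
proof -
  have zero: "integral {0..2 * pi} (\<lambda>u. per_bump' x u) = 0" for x
  proof -
    have "((\<lambda>u. per_bump' x u) has_integral (- per_bump x (2 * pi)) - (- per_bump x 0)) {0..2 * pi}"
    proof (rule fundamental_theorem_of_calculus)
      show "((\<lambda>u. - per_bump x u) has_vector_derivative per_bump' x u) (at u within {0..2 * pi})" for u
        using DERIV_minus[OF per_bump_deriv2[of x u]]
        by (auto simp: has_real_derivative_iff_has_vector_derivative
            intro: has_vector_derivative_at_within)
    qed simp
    then show ?thesis
      using per_bump_periodic[of x 0] by (simp add: integral_unique)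
  qed
  have "((\<lambda>x. integral {0..2 * pi} (per_bump x)) has_real_derivative 0) (at x)" for x
    using mollified_deriv[of "\<lambda>_. 1" x] zero[of x] by simp
  then show ?thesis
    using DERIV_const_ratio_const[of x y "\<lambda>x. integral {0..2 * pi} (per_bump x)" 0]
    by (cases "x = y") auto
qed

end

text \<open>The convolution of \<open>f\<close> with a smooth periodic kernel has a derivative bounded by \<open>N\<close>
  times the mass of the kernel; the kernel is then concentrated near a point.\<close>

lemma weak_deriv_per_lipschitz:
  assumes f: "continuous_on UNIV f" "\<And>t. f (t + 2 * pi) = f t"
    and h: "weak_deriv_per f h" "h \<in> Linf {0..2 * pi}"
    and N: "AE u\<in>{0..2 * pi} in lebesgue. \<bar>h u\<bar> \<le> N"
  shows "\<bar>f s - f t\<bar> \<le> N * \<bar>s - t\<bar>"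
proof (rule field_le_epsilon)
  fix e :: real assume e: "e > 0"
  obtain d where d: "d > 0" "\<And>r v. r \<in> {s, t} \<Longrightarrow> \<bar>v - r\<bar> < d \<Longrightarrow> \<bar>f v - f r\<bar> < e / 2"
  proof -
    have "isCont f s" "isCont f t"
      using f(1) by (auto simp: continuous_on_eq_continuous_at)
    then obtain d1 d2 where "d1 > 0" "\<And>v. \<bar>v - s\<bar> < d1 \<Longrightarrow> \<bar>f v - f s\<bar> < e / 2"
      "d2 > 0" "\<And>v. \<bar>v - t\<bar> < d2 \<Longrightarrow> \<bar>f v - f t\<bar> < e / 2"
      using e unfolding continuous_at_eps_delta dist_real_def by (metis half_gt_zero)
    then show ?thesis
      by (intro that[of "min d1 d2"]) auto
  qed
  \<comment> \<open>\<open>\<tau> \<le> d\<close> confines the kernel to the range where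
    \<open>f\<close> varies by less than \<open>e / 2\<close>; \<open>0 < \<tau> < pi\<close> gives
    \<open>cos \<tau> < 1\<close>, so the kernel does not vanish identically.\<close>
  define \<tau> where "\<tau> = min d pi / 2"
  have \<tau>: "0 < \<tau>" "\<tau> \<le> d" "\<tau> < pi"
    using d(1) pi_gt_zero unfolding \<tau>_def by (auto simp: min_def)
  let ?K = "per_bump (cos \<tau>)"
  let ?m = "\<lambda>x. integral {0..2 * pi} (\<lambda>u. f u * ?K x u)"
  define I where "I = integral {0..2 * pi} (?K 0)"
  have I: "integral {0..2 * pi} (?K x) = I" for x
    unfolding I_def by (rule per_bump_integral_const)
  have "I \<noteq> 0"
  proof
    assume "I = 0"
    then have "\<forall>u\<in>{0..2 * pi}. ?K 0 u = 0"
      unfolding I_def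
      by (subst (asm) integral_eq_0_iff) (auto simp: per_bump_nonneg continuous_per_bump)
    then have "?K 0 0 = 0"
      by auto
    then have "1 \<le> cos \<tau>"
      by (simp add: per_bump_def flat1_eq_0)
    moreover have "cos \<tau> < 1"
      using \<tau> cos_monotone_0_pi[of 0 \<tau>] by simp
    ultimately show False
      by simp
  qed
  moreover have "0 \<le> I"
    unfolding I_def by (intro integral_nonneg integrable_continuous_real continuous_per_bump per_bump_nonneg)
  ultimately have I0: "0 < I"
    by simp
  have cf: "continuous_on A f" for A
    using f(1) continuous_on_subset by blast
  \<comment> \<open>The kernel has mass \<open>I\<close> rather than 1, so the smoothed function
    approximates \<open>f r * I\<close>.\<close>
  have near: "\<bar>?m r - f r * I\<bar> \<le> e / 2 * I" if r: "r \<in> {s, t}" for r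
  proof -
    have "?m r - f r * I = integral {0..2 * pi} (\<lambda>u. f u * ?K r u - f r * ?K r u)"
      unfolding I[of r, symmetric]
      by (subst integral_diff)
        (auto intro!: integrable_continuous_real continuous_intros cf continuous_per_bump)
    also have "norm \<dots> \<le> integral {0..2 * pi} (\<lambda>u. e / 2 * ?K r u)"
    proof (rule Henstock_Kurzweil_Integration.integral_norm_bound_integral)
      fix u
      show "norm (f u * ?K r u - f r * ?K r u) \<le> e / 2 * ?K r u"
      proof (cases "?K r u = 0")
        case False
        then have "cos \<tau> < cos (r - u)"
          by (simp add: per_bump_def flat1_eq_0)
        then obtain k where k: "\<bar>r - u + of_int k * (2 * pi)\<bar> < \<tau>"
          using cos_gt_imp_near_period[of \<tau> "r - u"] \<tau> by auto
        have "\<bar>(u + of_int (- k) * (2 * pi)) - r\<bar> < d"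
          using k \<tau> by (simp add: abs_less_iff)
        then have "\<bar>f (u + of_int (- k) * (2 * pi)) - f r\<bar> < e / 2"
          by (rule d(2)[OF r])
        moreover have "f (u + of_int (- k) * (2 * pi)) = f u"
          by (rule periodic_int_shift[of f "2 * pi", OF f(2)])
        ultimately have "\<bar>f u - f r\<bar> \<le> e / 2"
          by simp
        then have "\<bar>f u - f r\<bar> * ?K r u \<le> e / 2 * ?K r u"
          by (intro mult_right_mono per_bump_nonneg)
        then show ?thesis
          by (simp add: abs_mult per_bump_nonneg flip: left_diff_distrib)
      qed simp
    qed (auto intro!: integrable_continuous_real continuous_intros cf continuous_per_bump)
    also have "\<dots> = e / 2 * I"
      by (simp add: I)
    finally show ?thesis
      by simp
  qed
  have "norm (?m s - ?m t) \<le> (N * I) * norm (s - t)"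
  proof (rule field_differentiable_bound[of UNIV])
    show "(?m has_real_derivative integral {0..2 * pi} (\<lambda>u. f u * per_bump' (cos \<tau>) x u))
        (at x within UNIV)" for x
      using mollified_deriv[OF f(1)] by simp
    show "norm (integral {0..2 * pi} (\<lambda>u. f u * per_bump' (cos \<tau>) x u)) \<le> N * I" for x
      using mollified_deriv_bound[OF f(1) h N, of "cos \<tau>" x] by (simp add: I)
  qed auto
  then have "\<bar>?m s - ?m t\<bar> \<le> N * I * \<bar>s - t\<bar>"
    by simp
  moreover have "\<bar>f s * I - f t * I\<bar> \<le> \<bar>?m s - ?m t\<bar> + \<bar>?m s - f s * I\<bar> + \<bar>?m t - f t * I\<bar>"
    by linarith
  ultimately have "\<bar>f s * I - f t * I\<bar> \<le> N * I * \<bar>s - t\<bar> + e * I"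
    using near[of s] near[of t] by simp
  moreover have "\<bar>f s * I - f t * I\<bar> = \<bar>f s - f t\<bar> * I"
    using I0 by (simp only: left_diff_distrib[symmetric] abs_mult abs_of_pos)
  ultimately have "\<bar>f s - f t\<bar> * I \<le> (N * \<bar>s - t\<bar> + e) * I"
    by (simp add: algebra_simps)
  then show "\<bar>f s - f t\<bar> \<le> N * \<bar>s - t\<bar> + e"
    using I0 by simp
qed

text \<open>The set where the bound fails is open by continuity. If it is nonempty, then by
  periodicity it meets the open period interval, and a nonempty open set is not negligible.\<close>

lemma periodic_Linf_le:
  fixes f :: "real \<Rightarrow> real"
  assumes f: "continuous_on UNIV f" "\<And>t. f (t + 2 * pi) = f t"
    and N: "AE u\<in>{0..2 * pi} in lebesgue. \<bar>f u\<bar> \<le> N"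
  shows "\<bar>f t\<bar> \<le> N"
proof (rule ccontr)
  assume "\<not> \<bar>f t\<bar> \<le> N"
  define S where "S = {u. N < \<bar>f u\<bar>}"
  have S: "open S"
    unfolding S_def using f(1) by (intro open_Collect_less continuous_intros)
  define t' where "t' = t + of_int (- \<lfloor>t / (2 * pi)\<rfloor>) * (2 * pi)"
  have "t' \<in> S"
    unfolding S_def t'_def mem_Collect_eq periodic_int_shift[of f "2 * pi", OF f(2)]
    using \<open>\<not> \<bar>f t\<bar> \<le> N\<close> by simp
  have "0 \<le> t / (2 * pi) - of_int \<lfloor>t / (2 * pi)\<rfloor>" "t / (2 * pi) - of_int \<lfloor>t / (2 * pi)\<rfloor> \<le> 1"
    by linarith+
  then have "0 \<le> (t / (2 * pi) - of_int \<lfloor>t / (2 * pi)\<rfloor>) * (2 * pi)"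
    "(t / (2 * pi) - of_int \<lfloor>t / (2 * pi)\<rfloor>) * (2 * pi) \<le> 1 * (2 * pi)"
    by (intro mult_nonneg_nonneg mult_right_mono; simp)+
  then have "t' \<in> {0..2 * pi}"
    by (simp add: t'_def left_diff_distrib)
  then have "t' \<in> closure {0<..<2 * pi}"
    by simp
  then have ne: "S \<inter> {0<..<2 * pi} \<noteq> {}"
    using S \<open>t' \<in> S\<close> open_Int_closure_eq_empty[of S "{0<..<2 * pi}"] by blast
  have op: "open (S \<inter> {0<..<2 * pi})"
    using S by auto
  have "AE u in lebesgue. u \<notin> S \<inter> {0<..<2 * pi}"
    using N by eventually_elim (auto simp: S_def)
  then have "S \<inter> {0<..<2 * pi} \<in> null_sets lebesgue"
    using op by (subst AE_iff_null_sets) (auto simp: borel_open sets_completionI_sets)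
  then show False
    using open_not_negligible[OF op ne] by (simp add: negligible_iff_null_sets)
qed

text \<open>The link from the norm to pointwise estimates: the norm adds an essential bound of the
  function and one of a weak derivative, so it dominates both and serves as bound and as Lipschitz
  constant.\<close>

lemma W1inf_per_bounds:
  assumes "f \<in> W1inf_per"
  shows "\<bar>f t\<bar> \<le> W1inf_per_norm f" "\<bar>f s - f t\<bar> \<le> W1inf_per_norm f * \<bar>s - t\<bar>"
proof -
  define h where "h = (SOME g. g \<in> Linf {0..2 * pi} \<and> weak_deriv_per f g)"
  have f: "continuous_on UNIV f" "\<And>t. f (t + 2 * pi) = f t"
    and "\<exists>g. g \<in> Linf {0..2 * pi} \<and> weak_deriv_per f g"
    using assms by (auto simp: W1inf_per_def)
  from someI_ex[OF this(3)] have h: "h \<in> Linf {0..2 * pi}" "weak_deriv_per f h"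
    by (auto simp: h_def)
  have eq: "W1inf_per_norm f = Linf_norm {0..2 * pi} f + Linf_norm {0..2 * pi} h"
    by (simp add: W1inf_per_norm_def h_def)
  have fL: "f \<in> Linf {0..2 * pi}"
  proof -
    have "compact (f ` {0..2 * pi})"
      using f(1) by (meson compact_Icc compact_continuous_image continuous_on_subset subset_UNIV)
    then obtain B where "\<forall>y\<in>f ` {0..2 * pi}. \<bar>y\<bar> \<le> B"
      using compact_imp_bounded bounded_real by metis
    moreover have "f \<in> borel_measurable lebesgue"
      using f(1) by (simp add: borel_measurable_continuous_onI measurable_completion)
    then have "(\<lambda>x. indicator {0..2 * pi} x *\<^sub>R f x) \<in> borel_measurable lebesgue"
      by (intro borel_measurable_scaleR borel_measurable_indicator) auto
    ultimately show ?thesis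
      by (auto simp: Linf_def set_borel_measurable_def intro!: exI[of _ B] AE_I2)
  qed
  have "\<bar>f t\<bar> \<le> Linf_norm {0..2 * pi} f"
    using Linf_norm_AE[OF fL] by (intro periodic_Linf_le[OF f]) simp
  then show "\<bar>f t\<bar> \<le> W1inf_per_norm f"
    unfolding eq using Linf_norm_nonneg[OF h(1)] by simp
  have "\<bar>f s - f t\<bar> \<le> Linf_norm {0..2 * pi} h * \<bar>s - t\<bar>"
    using Linf_norm_AE[OF h(1)] by (intro weak_deriv_per_lipschitz[OF f h(2,1)]) simp
  also have "\<dots> \<le> W1inf_per_norm f * \<bar>s - t\<bar>"
    unfolding eq using Linf_norm_nonneg[OF fL] by (intro mult_right_mono) auto
  finally show "\<bar>f s - f t\<bar> \<le> W1inf_per_norm f * \<bar>s - t\<bar>" .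
qed

section \<open>Radial change of variables\<close>

lemma nn_integral_scaleR:
  fixes f :: "'a::euclidean_space \<Rightarrow> ennreal"
  assumes [measurable]: "f \<in> borel_measurable borel" and v: "0 < v"
  shows "(\<integral>\<^sup>+ x. f x \<partial>lborel) = (\<integral>\<^sup>+ x. f (v *\<^sub>R x) * ennreal (v ^ DIM('a)) \<partial>lborel)"
proof -
  have "(\<integral>\<^sup>+ x. f x \<partial>lborel) =
      (\<integral>\<^sup>+ x. f x \<partial>density (distr lborel borel (\<lambda>x. 0 + v *\<^sub>R x)) (\<lambda>_. \<bar>v\<bar> ^ DIM('a)))"
    using lborel_affine[of v "0::'a"] v by simp
  also have "\<dots> = (\<integral>\<^sup>+ x. f (v *\<^sub>R x) * ennreal (v ^ DIM('a)) \<partial>lborel)"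
    using v by (subst nn_integral_density) (auto simp: nn_integral_distr mult.commute)
  finally show ?thesis .
qed

text \<open>For a factor \<open>q\<close> that is constant on rays and takes finitely many values, the map
  \<open>x \<mapsto> q x *\<^sub>R x\<close> is a dilation on each of finitely many cones. The general case is a limit of
  this one, so no regularity of \<open>q\<close> beyond measurability is needed and the Jacobian is
  \<open>q x ^ DIM('a)\<close>.\<close>

lemma nn_integral_radial_finite:
  fixes q :: "'a::euclidean_space \<Rightarrow> real"
  assumes [measurable]: "f \<in> borel_measurable borel" "q \<in> borel_measurable borel"
    and hom: "\<And>c x. 0 < c \<Longrightarrow> q (c *\<^sub>R x) = q x" and pos: "\<And>x. 0 < q x" and fin: "finite (range q)"
  shows "(\<integral>\<^sup>+ x. f (q x *\<^sub>R x) * ennreal (q x ^ DIM('a)) \<partial>lborel) = (\<integral>\<^sup>+ x. f x \<partial>lborel)"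
proof -
  have split: "g x = (\<Sum>v\<in>range q. indicator {y. q y = v} x * g x)" for g :: "'a \<Rightarrow> ennreal" and x
  proof -
    have "(\<Sum>v\<in>range q. indicator {y. q y = v} x * g x) = (\<Sum>v\<in>range q. if v = q x then g x else 0)"
      by (intro sum.cong) auto
    then show ?thesis
      using fin by simp
  qed
  have [measurable]: "{y. q y = v} \<in> sets borel" for v
    by measurable
  have "(\<integral>\<^sup>+ x. f (q x *\<^sub>R x) * ennreal (q x ^ DIM('a)) \<partial>lborel) =
      (\<integral>\<^sup>+ x. (\<Sum>v\<in>range q. indicator {y. q y = v} x * (f (q x *\<^sub>R x) * ennreal (q x ^ DIM('a)))) \<partial>lborel)"
    by (intro nn_integral_cong split)
  also have "\<dots> = (\<Sum>v\<in>range q. \<integral>\<^sup>+ x. indicator {y. q y = v} x * (f (q x *\<^sub>R x) * ennreal (q x ^ DIM('a))) \<partial>lborel)"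
    by (rule nn_integral_sum) measurable
  also have "\<dots> = (\<Sum>v\<in>range q. \<integral>\<^sup>+ x. indicator {y. q y = v} x * f x \<partial>lborel)"
  proof (intro sum.cong refl)
    fix v assume "v \<in> range q"
    then have v: "0 < v"
      using pos by auto
    have "(\<integral>\<^sup>+ x. indicator {y. q y = v} x * f x \<partial>lborel) =
        (\<integral>\<^sup>+ x. indicator {y. q y = v} (v *\<^sub>R x) * f (v *\<^sub>R x) * ennreal (v ^ DIM('a)) \<partial>lborel)"
      by (rule nn_integral_scaleR[OF _ v]) measurable
    also have "\<dots> = (\<integral>\<^sup>+ x. indicator {y. q y = v} x * (f (q x *\<^sub>R x) * ennreal (q x ^ DIM('a))) \<partial>lborel)"
      using hom[OF v] by (intro nn_integral_cong) (auto simp: indicator_def)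
    finally show "(\<integral>\<^sup>+ x. indicator {y. q y = v} x * (f (q x *\<^sub>R x) * ennreal (q x ^ DIM('a))) \<partial>lborel) =
        (\<integral>\<^sup>+ x. indicator {y. q y = v} x * f x \<partial>lborel)" ..
  qed
  also have "\<dots> = (\<integral>\<^sup>+ x. (\<Sum>v\<in>range q. indicator {y. q y = v} x * f x) \<partial>lborel)"
    by (rule nn_integral_sum[symmetric]) measurable
  also have "\<dots> = (\<integral>\<^sup>+ x. f x \<partial>lborel)"
    by (intro nn_integral_cong split[symmetric])
  finally show ?thesis .
qed

context
  fixes q :: "'a::euclidean_space \<Rightarrow> real" and m M :: real
  assumes q_borel [measurable]: "q \<in> borel_measurable borel"
    and q_hom: "\<And>c x. 0 < c \<Longrightarrow> q (c *\<^sub>R x) = q x"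
    and m: "0 < m" "\<And>x. m \<le> q x" and M: "\<And>x. q x \<le> M"
begin

text \<open>Rounding \<open>q\<close> yields a factor with finite range, to which the finite case
  applies; continuity of \<open>\<phi>\<close> lets the integrands with the rounded factor
  converge.\<close>

lemma nn_integral_radial_continuous:
  fixes \<phi> :: "'a \<Rightarrow> real"
  assumes \<phi>: "continuous_on UNIV \<phi>" "\<And>x. 0 \<le> \<phi> x" "\<And>x. \<phi> x \<le> 1" "\<And>x. R < norm x \<Longrightarrow> \<phi> x = 0"
  shows "(\<integral>\<^sup>+ x. ennreal (\<phi> (q x *\<^sub>R x)) * ennreal (q x ^ DIM('a)) \<partial>lborel) = (\<integral>\<^sup>+ x. ennreal (\<phi> x) \<partial>lborel)"
proof -
  \<comment> \<open>Rounding up keeps \<open>Q n\<close> above \<open>q\<close>, hence above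
    \<open>m\<close>: for all \<open>n\<close>, \<open>\<phi> (Q n x *\<^sub>R x)\<close> vanishes
    once \<open>norm x > R / m\<close>, which gives a common integrable bound.\<close>
  define Q where "Q n x = real_of_int (\<lfloor>real (Suc n) * q x\<rfloor> + 1) / real (Suc n)" for n x
  have q_pos: "0 < q x" for x
    using m(1) m(2)[of x] by linarith
  have Q: "q x \<le> Q n x" "Q n x \<le> q x + 1 / real (Suc n)" for n x
  proof -
    have "q x * real (Suc n) \<le> real_of_int (\<lfloor>real (Suc n) * q x\<rfloor> + 1)"
      "real_of_int (\<lfloor>real (Suc n) * q x\<rfloor> + 1) \<le> real (Suc n) * q x + 1"
      by (simp_all add: mult.commute)
    then show "q x \<le> Q n x" "Q n x \<le> q x + 1 / real (Suc n)"
      unfolding Q_def by (simp_all add: field_simps del: of_nat_Suc of_int_add)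
  qed
  have [measurable]: "Q n \<in> borel_measurable borel" for n
    unfolding Q_def by measurable
  have [measurable]: "\<phi> \<in> borel_measurable borel"
    using \<phi>(1) by (rule borel_measurable_continuous_onI)
  have [measurable]: "cball (0::'a) (R / m) \<in> sets borel"
    by (simp add: borel_closed)
  have Q_fin: "finite (range (Q n))" for n
  proof -
    have "\<lfloor>real (Suc n) * q x\<rfloor> \<in> {0..\<lfloor>real (Suc n) * M\<rfloor>}" for x
    proof -
      have "0 \<le> real (Suc n) * q x" "real (Suc n) * q x \<le> real (Suc n) * M"
        using q_pos[of x] M[of x] by (simp_all del: of_nat_Suc)
      then show ?thesis
        by (simp del: of_nat_Suc add: floor_mono[OF \<open>_ \<le> real (Suc n) * M\<close>])
    qed
    then have "range (Q n) \<subseteq> (\<lambda>k. real_of_int (k + 1) / real (Suc n)) ` {0..\<lfloor>real (Suc n) * M\<rfloor>}"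
      unfolding Q_def by blast
    then show ?thesis
      by (rule finite_subset) auto
  qed
  have eq: "(\<integral>\<^sup>+ x. ennreal (\<phi> (Q n x *\<^sub>R x)) * ennreal (Q n x ^ DIM('a)) \<partial>lborel) =
      (\<integral>\<^sup>+ x. ennreal (\<phi> x) \<partial>lborel)" for n
  proof (rule nn_integral_radial_finite[OF _ _ _ _ Q_fin])
    show "0 < Q n x" for x
      using q_pos Q(1) by (rule less_le_trans)
    show "Q n (c *\<^sub>R x) = Q n x" if "0 < c" for c x
      using q_hom[OF that] by (simp add: Q_def)
  qed measurable
  have Qlim: "(\<lambda>n. Q n x) \<longlonglongrightarrow> q x" for x
  proof (rule tendsto_sandwich[OF _ _ tendsto_const])
    show "(\<lambda>n. q x + 1 / real (Suc n)) \<longlonglongrightarrow> q x"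
      using LIMSEQ_inverse_real_of_nat_add[of "q x"] by (simp add: inverse_eq_divide)
  qed (use Q in auto)
  have "(\<lambda>n. \<integral>\<^sup>+ x. ennreal (\<phi> (Q n x *\<^sub>R x)) * ennreal (Q n x ^ DIM('a)) \<partial>lborel) \<longlonglongrightarrow>
      (\<integral>\<^sup>+ x. ennreal (\<phi> (q x *\<^sub>R x)) * ennreal (q x ^ DIM('a)) \<partial>lborel)"
  proof (rule nn_integral_dominated_convergence
      [where w = "\<lambda>x. ennreal ((M + 1) ^ DIM('a)) * indicator (cball 0 (R / m)) x"])
    show "AE x in lborel. ennreal (\<phi> (Q n x *\<^sub>R x)) * ennreal (Q n x ^ DIM('a)) \<le>
        ennreal ((M + 1) ^ DIM('a)) * indicator (cball 0 (R / m)) x" for n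
    proof (intro AE_I2)
      fix x
      show "ennreal (\<phi> (Q n x *\<^sub>R x)) * ennreal (Q n x ^ DIM('a)) \<le>
        ennreal ((M + 1) ^ DIM('a)) * indicator (cball 0 (R / m)) x"
      proof (cases "x \<in> cball 0 (R / m)")
        case True
        have "Q n x \<le> M + 1"
        proof -
          have "1 / real (Suc n) \<le> 1"
            by simp
          then show ?thesis
            using Q(2)[of n x] M[of x] by linarith
        qed
        moreover have "0 \<le> Q n x"
          using q_pos[of x] Q(1)[of x n] by linarith
        ultimately have "\<phi> (Q n x *\<^sub>R x) * Q n x ^ DIM('a) \<le> 1 * (M + 1) ^ DIM('a)"
          using \<phi> by (intro mult_mono power_mono) auto
        then show ?thesis
          using True \<phi>(2) \<open>0 \<le> Q n x\<close> by (simp flip: ennreal_mult add: ennreal_leI)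
      next
        case False
        then have "R < m * norm x"
          using m(1) by (simp add: field_simps)
        also have "\<dots> \<le> Q n x * norm x"
          using m(2)[of x] Q(1)[of x n] by (intro mult_right_mono) auto
        finally have "R < norm (Q n x *\<^sub>R x)"
          using q_pos[of x] Q(1)[of x n] by simp
        then show ?thesis
          using \<phi>(4) by simp
      qed
    qed
    show "(\<integral>\<^sup>+ x. ennreal ((M + 1) ^ DIM('a)) * indicator (cball (0::'a) (R / m)) x \<partial>lborel) < \<infinity>"
      using emeasure_bounded_finite[OF bounded_cball[of "0::'a" "R / m"]]
      by (subst nn_integral_cmult_indicator) (auto simp: ennreal_mult_less_top)
    show "AE x in lborel. (\<lambda>n. ennreal (\<phi> (Q n x *\<^sub>R x)) * ennreal (Q n x ^ DIM('a))) \<longlonglongrightarrow>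
        ennreal (\<phi> (q x *\<^sub>R x)) * ennreal (q x ^ DIM('a))"
    proof (intro AE_I2)
      fix x
      have "isCont \<phi> (q x *\<^sub>R x)"
        using \<phi>(1) by (simp add: continuous_on_eq_continuous_at)
      then have "(\<lambda>n. \<phi> (Q n x *\<^sub>R x)) \<longlonglongrightarrow> \<phi> (q x *\<^sub>R x)"
        by (rule isCont_tendsto_compose) (intro tendsto_intros Qlim)
      then have "(\<lambda>n. ennreal (\<phi> (Q n x *\<^sub>R x) * Q n x ^ DIM('a))) \<longlonglongrightarrow>
          ennreal (\<phi> (q x *\<^sub>R x) * q x ^ DIM('a))"
        by (intro tendsto_intros Qlim)
      moreover have "0 \<le> Q n x" for n
        using q_pos[of x] Q(1)[of x n] by linarith
      ultimately show "(\<lambda>n. ennreal (\<phi> (Q n x *\<^sub>R x)) * ennreal (Q n x ^ DIM('a))) \<longlonglongrightarrow>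
        ennreal (\<phi> (q x *\<^sub>R x)) * ennreal (q x ^ DIM('a))"
        using \<phi>(2) q_pos by (simp add: ennreal_mult less_imp_le)
    qed
  qed measurable
  then show ?thesis
    unfolding eq by (simp add: LIMSEQ_const_iff)
qed

text \<open>A Borel measure with the right values on boxes is Lebesgue measure. The indicator of a
  box is the monotone limit of continuous bumps, for which the change of variables is known.\<close>

lemma distr_radial:
  "lborel = distr (density lborel (\<lambda>x. ennreal (q x ^ DIM('a)))) borel (\<lambda>x. q x *\<^sub>R x)"
proof (rule lborel_eqI)
  fix l u :: 'a assume lu: "\<And>b. b \<in> Basis \<Longrightarrow> l \<bullet> b \<le> u \<bullet> b"
  have [measurable]: "box_bump l u n \<in> borel_measurable borel" for n
    by (rule borel_measurable_continuous_onI[OF continuous_box_bump])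
  obtain R where R: "\<And>x. x \<in> box l u \<Longrightarrow> norm x \<le> R"
    using bounded_box[of l u] by (auto simp: bounded_iff)
  have eq: "(\<integral>\<^sup>+ x. ennreal (box_bump l u n (q x *\<^sub>R x)) * ennreal (q x ^ DIM('a)) \<partial>lborel) =
      (\<integral>\<^sup>+ x. ennreal (box_bump l u n x) \<partial>lborel)" for n
    by (rule nn_integral_radial_continuous[where R = R])
      (auto simp: continuous_box_bump box_bump_nonneg box_bump_le intro!: box_bump_outside dest: R)
  have "(\<lambda>n. \<integral>\<^sup>+ x. ennreal (box_bump l u n x) \<partial>lborel) \<longlonglongrightarrow> (\<integral>\<^sup>+ x. ennreal (indicator (box l u) x) \<partial>lborel)"
    by (rule nn_integral_LIMSEQ)
      (auto simp: incseq_def le_fun_def intro!: ennreal_leI box_bump_mono tendsto_ennrealI box_bump_tendsto)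
  moreover have "(\<lambda>n. \<integral>\<^sup>+ x. ennreal (box_bump l u n (q x *\<^sub>R x)) * ennreal (q x ^ DIM('a)) \<partial>lborel) \<longlonglongrightarrow>
      (\<integral>\<^sup>+ x. ennreal (indicator (box l u) (q x *\<^sub>R x)) * ennreal (q x ^ DIM('a)) \<partial>lborel)"
  proof (rule nn_integral_LIMSEQ)
    show "incseq (\<lambda>n x. ennreal (box_bump l u n (q x *\<^sub>R x)) * ennreal (q x ^ DIM('a)))"
      by (auto simp: incseq_def le_fun_def intro!: mult_right_mono ennreal_leI box_bump_mono)
    show "(\<lambda>n. ennreal (box_bump l u n (q x *\<^sub>R x)) * ennreal (q x ^ DIM('a))) \<longlonglongrightarrow>
      ennreal (indicator (box l u) (q x *\<^sub>R x)) * ennreal (q x ^ DIM('a))" for x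
      using m(1) m(2)[of x] tendsto_ennrealI[OF tendsto_mult[OF box_bump_tendsto[of l u "q x *\<^sub>R x"]
          tendsto_const[of "q x ^ DIM('a)"]]]
      by (simp add: ennreal_mult box_bump_nonneg)
  qed measurable
  moreover have ind: "(indicator (box l u) (q x *\<^sub>R x) :: real) = indicator {x. q x *\<^sub>R x \<in> box l u} x" for x
    by (simp add: indicator_def)
  ultimately have "(\<integral>\<^sup>+ x. ennreal (indicator (box l u) (q x *\<^sub>R x)) * ennreal (q x ^ DIM('a)) \<partial>lborel) =
      (\<integral>\<^sup>+ x. ennreal (indicator (box l u) x) \<partial>lborel)"
    unfolding eq using LIMSEQ_unique by blast
  also have "\<dots> = emeasure lborel (box l u)"
    by (simp add: ennreal_indicator)
  finally have "(\<integral>\<^sup>+ x. indicator {x. q x *\<^sub>R x \<in> box l u} x * ennreal (q x ^ DIM('a)) \<partial>lborel) =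
      ennreal (\<Prod>b\<in>Basis. (u - l) \<bullet> b)"
    using lu unfolding ind by (simp add: ennreal_indicator emeasure_lborel_box)
  then show "emeasure (distr (density lborel (\<lambda>x. ennreal (q x ^ DIM('a)))) borel (\<lambda>x. q x *\<^sub>R x)) (box l u) =
      ennreal (\<Prod>b\<in>Basis. (u - l) \<bullet> b)"
    by (simp add: emeasure_distr emeasure_density mult.commute vimage_def)
qed simp

lemma integral_radial:
  fixes g :: "'a \<Rightarrow> 'b::{banach, second_countable_topology}"
  assumes [measurable]: "g \<in> borel_measurable borel"
  shows "(LINT y|lborel. g y) = (LINT x|lborel. (q x ^ DIM('a)) *\<^sub>R g (q x *\<^sub>R x))"
proof -
  have "0 \<le> q x" for x
    using m(1) m(2)[of x] by linarith
  then show ?thesis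
    by (subst distr_radial) (simp add: integral_distr integral_density)
qed

end

section \<open>Lipschitz boundaries are negligible\<close>

text \<open>Near a boundary point the boundary lies on the graph of \<open>\<gamma>\<close> over the
  hyperplane orthogonal to \<open>e\<close>, and the graph is the image of this negligible
  hyperplane under the Lipschitz map \<open>w + \<gamma> w *\<^sub>R e\<close>.\<close>

lemma negligible_frontier_lipschitz_domain:
  fixes D :: "'a::euclidean_space set"
  assumes "lipschitz_domain D"
  shows "negligible (frontier D)"
proof (subst locally_negligible_alt, rule ballI)
  fix x assume x: "x \<in> frontier D"
  have op: "open D"
    using assms by (simp add: lipschitz_domain_def)
  obtain e \<gamma> L \<epsilon> where e: "norm e = 1" "0 < \<epsilon>" and \<gamma>: "L-lipschitz_on {w. w \<bullet> e = 0} \<gamma>"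
    and D: "D \<inter> ball x \<epsilon> = {z \<in> ball x \<epsilon>. \<gamma> (z - (z \<bullet> e) *\<^sub>R e) < z \<bullet> e}"
    using assms x unfolding lipschitz_domain_def by meson
  have ee: "e \<bullet> e = 1"
    using e by (simp add: dot_square_norm)
  define H where "H = {w. w \<bullet> e = 0}"
  define P where "P z = z - (z \<bullet> e) *\<^sub>R e" for z
  have Diff: "z \<in> D \<longleftrightarrow> \<gamma> (P z) < z \<bullet> e" if "z \<in> ball x \<epsilon>" for z
    using eqset_imp_iff[OF D, of z] that by (simp add: P_def)
  have PH: "P z \<in> H" for z
    by (simp add: P_def H_def inner_diff_left ee)
  have "continuous_on UNIV (\<gamma> \<circ> P)"
  proof (rule continuous_on_compose)
    show "continuous_on UNIV P"
      unfolding P_def by (intro continuous_intros)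
    show "continuous_on (range P) \<gamma>"
      using PH lipschitz_on_continuous_on[OF \<gamma>] continuous_on_subset unfolding H_def by blast
  qed
  then have c: "continuous_on UNIV (\<lambda>z. \<gamma> (P z))"
    by (simp add: o_def)
  have sub: "frontier D \<inter> ball x \<epsilon> \<subseteq> (\<lambda>w. w + \<gamma> w *\<^sub>R e) ` H"
  proof
    fix w assume w: "w \<in> frontier D \<inter> ball x \<epsilon>"
    have "w \<notin> D"
      using w op by (simp add: frontier_def interior_open)
    then have 1: "w \<bullet> e \<le> \<gamma> (P w)"
      using Diff[of w] w by auto
    \<comment> \<open>Strictly below the graph there is an open set without points of
      \<open>D\<close>, hence no boundary point.\<close>
    have "\<not> w \<bullet> e < \<gamma> (P w)"
    proof
      assume "w \<bullet> e < \<gamma> (P w)"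
      define U where "U = {z. z \<bullet> e < \<gamma> (P z)} \<inter> ball x \<epsilon>"
      have "open U"
        unfolding U_def by (intro open_Int open_Collect_less c continuous_intros open_ball)
      moreover have "w \<in> U"
        using w \<open>w \<bullet> e < \<gamma> (P w)\<close> by (simp add: U_def)
      moreover have "U \<inter> D = {}"
        using Diff by (auto simp: U_def)
      ultimately have "w \<notin> closure D"
        using open_Int_closure_eq_empty[of U D] by blast
      then show False
        using w by (simp add: frontier_def)
    qed
    with 1 have "w \<bullet> e = \<gamma> (P w)"
      by simp
    then have "w = P w + \<gamma> (P w) *\<^sub>R e"
      by (simp add: P_def)
    then show "w \<in> (\<lambda>w. w + \<gamma> w *\<^sub>R e) ` H"
      using PH by blast
  qed
  have "negligible ((\<lambda>w. w + \<gamma> w *\<^sub>R e) ` H)"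
  proof (rule negligible_locally_Lipschitz_image)
    have "H = {w. e \<bullet> w = 0}"
      by (auto simp: H_def inner_commute)
    moreover have "e \<noteq> 0"
      using e by auto
    ultimately show "negligible H"
      by (simp add: negligible_hyperplane)
    fix w assume "w \<in> H"
    have "norm (v + \<gamma> v *\<^sub>R e - (w + \<gamma> w *\<^sub>R e)) \<le> (1 + L) * norm (v - w)" if "v \<in> H" for v
    proof -
      have "v + \<gamma> v *\<^sub>R e - (w + \<gamma> w *\<^sub>R e) = (v - w) + (\<gamma> v - \<gamma> w) *\<^sub>R e"
        by (simp add: algebra_simps)
      also have "norm \<dots> \<le> norm (v - w) + \<bar>\<gamma> v - \<gamma> w\<bar>"
        using norm_triangle_ineq[of "v - w" "(\<gamma> v - \<gamma> w) *\<^sub>R e"] e by simp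
      also have "\<bar>\<gamma> v - \<gamma> w\<bar> \<le> L * norm (v - w)"
        using lipschitz_onD[OF \<gamma>, of v w] that \<open>w \<in> H\<close> by (simp add: H_def dist_norm)
      finally show ?thesis
        by (simp add: algebra_simps)
    qed
    then show "\<exists>T B. open T \<and> w \<in> T \<and>
        (\<forall>v\<in>H \<inter> T. norm (v + \<gamma> v *\<^sub>R e - (w + \<gamma> w *\<^sub>R e)) \<le> B * norm (v - w))"
      by (intro exI[of _ UNIV] exI[of _ "1 + L"]) auto
  qed simp
  then have "negligible (frontier D \<inter> ball x \<epsilon>)"
    using sub by (rule negligible_subset)
  then show "\<exists>U. openin (top_of_set (frontier D)) U \<and> x \<in> U \<and> negligible U"
    using x e(2) by (intro exI[of _ "frontier D \<inter> ball x \<epsilon>"]) auto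
qed

section \<open>Holomorphic extension of the Green function\<close>

text \<open>The Bessel function of order zero, and below it the harmonic-number part of the Bessel
  function of the second kind, both as power series in the square of the argument.\<close>

definition bessel_series :: "complex \<Rightarrow> complex" where
  "bessel_series s = (\<Sum>k. ((-1) ^ k / ((fact k)\<^sup>2 * 4 ^ k)) * s ^ k)"

definition bessel_harm_series :: "complex \<Rightarrow> complex" where
  "bessel_harm_series s = (\<Sum>k. ((-1) ^ k * of_real (harm k) / ((fact k)\<^sup>2 * 4 ^ k)) * s ^ k)"

lemma harm_le_fact: "harm k \<le> (fact k :: real)"
proof -
  have "harm k \<le> (\<Sum>i=1..k. 1 :: real)"
    unfolding harm_def by (intro sum_mono) (auto simp: field_simps)
  also have "\<dots> \<le> fact k"
    using fact_ge_self[of k] of_nat_le_iff[of k "fact k", where 'a = real] by simp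
  finally show ?thesis .
qed

text \<open>Both series are dominated by the exponential series in \<open>norm s / 4\<close>: one of
  the two factorials absorbs the coefficient, which is 1 or \<open>harm k\<close>.\<close>

lemma summable_bessel_series: "summable (\<lambda>k. ((-1) ^ k / ((fact k)\<^sup>2 * 4 ^ k)) * (s::complex) ^ k)"
  and summable_bessel_harm_series:
    "summable (\<lambda>k. ((-1) ^ k * of_real (harm k) / ((fact k)\<^sup>2 * 4 ^ k)) * (s::complex) ^ k)"
proof -
  have s: "summable (\<lambda>k. inverse (fact k) * (norm s / 4) ^ k)"
    using summable_exp[of "norm s / 4"] by simp
  have n: "norm ((-1) ^ k * of_real c / ((fact k)\<^sup>2 * 4 ^ k) * s ^ k) \<le> inverse (fact k) * (norm s / 4) ^ k"
    if c: "0 \<le> c" "c \<le> fact k" for c :: real and k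
  proof -
    have "norm ((-1) ^ k * of_real c / ((fact k)\<^sup>2 * 4 ^ k) * s ^ k) =
        c / fact k * (inverse (fact k) * (norm s / 4) ^ k)"
      using c by (simp add: norm_mult norm_divide norm_power power2_eq_square power_divide field_simps)
    also have "\<dots> \<le> 1 * (inverse (fact k) * (norm s / 4) ^ k)"
      using c by (intro mult_right_mono) auto
    finally show ?thesis
      by simp
  qed
  show "summable (\<lambda>k. ((-1) ^ k / ((fact k)\<^sup>2 * 4 ^ k)) * s ^ k)"
    by (rule summable_comparison_test'[OF s, of 0]) (use n[of 1] in simp)
  show "summable (\<lambda>k. ((-1) ^ k * of_real (harm k) / ((fact k)\<^sup>2 * 4 ^ k)) * s ^ k)"
    by (rule summable_comparison_test'[OF s, of 0]) (use n harm_le_fact harm_nonneg in blast)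
qed

lemma holomorphic_bessel_series: "bessel_series holomorphic_on A"
  and holomorphic_bessel_harm_series: "bessel_harm_series holomorphic_on A"
  unfolding bessel_series_def[abs_def] bessel_harm_series_def[abs_def] holomorphic_on_def
    field_differentiable_def
  using termdiffs_strong_converges_everywhere[OF summable_bessel_series]
    termdiffs_strong_converges_everywhere[OF summable_bessel_harm_series]
    has_field_derivative_at_within by blast+

lemma bessel_J0_eq: "complex_of_real (bessel_J0 t) = bessel_series (of_real (t\<^sup>2))"
proof -
  have eq: "complex_of_real ((-1) ^ k / (fact k)\<^sup>2 * (t / 2) ^ (2 * k)) =
      ((-1) ^ k / ((fact k)\<^sup>2 * 4 ^ k)) * of_real (t\<^sup>2) ^ k" for k
    by (simp add: power_mult power_divide)
  have "summable (\<lambda>k. complex_of_real ((-1) ^ k / (fact k)\<^sup>2 * (t / 2) ^ (2 * k)))"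
    unfolding eq by (rule summable_bessel_series)
  then have "summable (\<lambda>k. (-1) ^ k / (fact k)\<^sup>2 * (t / 2) ^ (2 * k))"
    by (simp only: summable_complex_of_real)
  from suminf_of_real[OF this, where 'a = complex] show ?thesis
    unfolding bessel_J0_def bessel_series_def eq by simp
qed

lemma bessel_harm_eq:
  "complex_of_real (\<Sum>k. (-1) ^ k * harm k / (fact k)\<^sup>2 * (t / 2) ^ (2 * k)) = bessel_harm_series (of_real (t\<^sup>2))"
proof -
  have eq: "complex_of_real ((-1) ^ k * harm k / (fact k)\<^sup>2 * (t / 2) ^ (2 * k)) =
      ((-1) ^ k * of_real (harm k) / ((fact k)\<^sup>2 * 4 ^ k)) * of_real (t\<^sup>2) ^ k" for k
    by (simp add: power_mult power_divide)
  have "summable (\<lambda>k. complex_of_real ((-1) ^ k * harm k / (fact k)\<^sup>2 * (t / 2) ^ (2 * k)))"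
    unfolding eq by (rule summable_bessel_harm_series)
  then have "summable (\<lambda>k. (-1) ^ k * harm k / (fact k)\<^sup>2 * (t / 2) ^ (2 * k))"
    by (simp only: summable_complex_of_real)
  from suminf_of_real[OF this, where 'a = complex] show ?thesis
    unfolding bessel_harm_series_def eq by simp
qed

text \<open>As a function of the squared distance the Green function extends holomorphically to the
  right half-plane: the Bessel series involve only even powers of the distance.\<close>

definition green_sq :: "real \<Rightarrow> complex \<Rightarrow> complex" where
  "green_sq \<kappa>\<^sub>0 s = (let w = of_real (\<kappa>\<^sub>0\<^sup>2) * s in \<i> / 4 * (bessel_series w + \<i> * (of_real (2 / pi) *
     ((Ln w / 2 - of_real (ln 2) + of_real euler_mascheroni) * bessel_series w - bessel_harm_series w))))"

text \<open>Multiplication by \<open>\<kappa>\<^sub>0\<^sup>2\<close> keeps the real part positive,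
  so the argument of \<open>Ln\<close> avoids the branch cut.\<close>

lemma holomorphic_green_sq:
  assumes "0 < \<kappa>\<^sub>0"
  shows "green_sq \<kappa>\<^sub>0 holomorphic_on {s. 0 < Re s}"
proof -
  have *: "(\<lambda>s. of_real (\<kappa>\<^sub>0\<^sup>2) * s) holomorphic_on {s. 0 < Re s}"
    by (intro holomorphic_intros)
  have h: "(\<lambda>s. bessel_series (of_real (\<kappa>\<^sub>0\<^sup>2) * s)) holomorphic_on {s. 0 < Re s}"
    "(\<lambda>s. bessel_harm_series (of_real (\<kappa>\<^sub>0\<^sup>2) * s)) holomorphic_on {s. 0 < Re s}"
    using holomorphic_on_compose[OF * holomorphic_bessel_series]
      holomorphic_on_compose[OF * holomorphic_bessel_harm_series] by (simp_all add: o_def)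
  have "of_real (\<kappa>\<^sub>0\<^sup>2) * s \<notin> \<real>\<^sub>\<le>\<^sub>0" if "0 < Re s" for s
  proof -
    have "0 < Re (of_real (\<kappa>\<^sub>0\<^sup>2) * s)"
      using assms that by (simp del: of_real_power)
    then show ?thesis
      unfolding complex_nonpos_Reals_iff by linarith
  qed
  then have l: "(\<lambda>s. Ln (of_real (\<kappa>\<^sub>0\<^sup>2) * s)) holomorphic_on {s. 0 < Re s}"
    by (intro holomorphic_on_Ln' *) blast
  show ?thesis
    unfolding green_sq_def[abs_def] Let_def by (intro h l holomorphic_intros) auto
qed

lemma green_eq_green_sq:
  fixes z :: "real^2"
  assumes "0 < \<kappa>\<^sub>0" "z \<noteq> 0"
  shows "green \<kappa>\<^sub>0 z = green_sq \<kappa>\<^sub>0 (of_real ((norm z)\<^sup>2))"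
proof -
  define t where "t = \<kappa>\<^sub>0 * norm z"
  have t: "0 < t"
    using assms by (simp add: t_def)
  have w: "of_real (\<kappa>\<^sub>0\<^sup>2) * of_real ((norm z)\<^sup>2) = complex_of_real (t\<^sup>2)"
    by (simp add: t_def power_mult_distrib)
  \<comment> \<open>The only part that is not a power series in \<open>t\<^sup>2\<close>: the
    logarithm of \<open>t\<close> is half the logarithm of its square.\<close>
  have "complex_of_real (ln (t / 2)) = Ln (of_real (t\<^sup>2)) / 2 - of_real (ln 2)"
  proof -
    have "ln (t / 2) = ln (t\<^sup>2) / 2 - ln 2"
      using t by (simp add: ln_div ln_realpow)
    then show ?thesis
      using t by (simp add: Ln_of_real flip: of_real_power)
  qed
  then have "hankel_H0 t = bessel_series (of_real (t\<^sup>2)) + \<i> * (of_real (2 / pi) *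
     ((Ln (of_real (t\<^sup>2)) / 2 - of_real (ln 2) + of_real euler_mascheroni) * bessel_series (of_real (t\<^sup>2))
      - bessel_harm_series (of_real (t\<^sup>2))))"
    unfolding hankel_H0_def Complex_eq bessel_Y0_def bessel_J0_eq[symmetric] bessel_harm_eq[symmetric]
    by simp
  then show ?thesis
    unfolding green_def green_sq_def Let_def w t_def[symmetric] by simp
qed

section \<open>Radial maps of the plane\<close>

lemma polar_angle_scaleR: "0 < c \<Longrightarrow> polar_angle (c *\<^sub>R x) = polar_angle x"
proof -
  assume "0 < c"
  have "Complex (c * x $ 1) (c * x $ 2) = of_real c * Complex (x $ 1) (x $ 2)"
    by (simp add: complex_eq_iff)
  then show ?thesis
    using \<open>0 < c\<close> by (simp add: polar_angle_def)
qed

lemma norm_real2: "norm (x :: real^2) = cmod (Complex (x $ 1) (x $ 2))"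
  by (simp add: norm_vec_def L2_set_def sum_2 cmod_def)

lemma polar_decomposition:
  "x = norm x *\<^sub>R vector [cos (polar_angle x), sin (polar_angle x)]"
  unfolding vec_eq_iff forall_2 norm_real2 polar_angle_def
  using cos_Arg2pi[of "Complex (x $ 1) (x $ 2)"] sin_Arg2pi[of "Complex (x $ 1) (x $ 2)"] by simp

lemma polar_angle_bounds: "0 \<le> polar_angle x" "polar_angle x < 2 * pi"
  by (simp_all add: polar_angle_def Arg2pi)

lemma polar_angle_polar:
  assumes "0 < s" "0 \<le> \<phi>" "\<phi> < 2 * pi"
  shows "polar_angle (s *\<^sub>R vector [cos \<phi>, sin \<phi>]) = \<phi>"
proof -
  have "of_real s * exp (\<i> * of_real \<phi>) = Complex (s * cos \<phi>) (s * sin \<phi>)"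
    by (simp add: complex_eq_iff Re_exp Im_exp)
  then show ?thesis
    unfolding polar_angle_def using Arg2pi_unique[of s \<phi>] assms by simp
qed

lemma norm_direction: "norm (vector [cos \<phi>, sin \<phi>] :: real^2) = 1"
  by (simp add: norm_real2 cmod_def)

text \<open>\<open>Arg2pi\<close> jumps at the positive real axis, but the sets where it exceeds a
  given value are open.\<close>

lemma borel_measurable_polar_angle [measurable]: "polar_angle \<in> borel_measurable borel"
proof -
  have "Arg2pi \<in> borel_measurable borel"
    by (intro borel_measurableI_greater) (simp add: borel_open open_Arg2pi2pi_gt)
  moreover have "(\<lambda>x :: real^2. Complex (x $ 1) (x $ 2)) \<in> borel_measurable borel"
    by (intro borel_measurable_continuous_onI) (auto simp: Complex_eq intro!: continuous_intros)
  ultimately show ?thesis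
    unfolding polar_angle_def[abs_def] by (rule measurable_compose[rotated])
qed

text \<open>The inequality \<open>s * cos s \<le> sin s\<close> at \<open>s = t / 2\<close>,
  multiplied by \<open>2 * cos (t / 2)\<close>, bounds \<open>t / 2 * (1 + cos t)\<close> by
  \<open>sin t\<close>, and \<open>cos t\<close> is nonnegative here.\<close>

lemma half_le_sin:
  assumes "0 \<le> t" "t \<le> pi / 2"
  shows "t \<le> 2 * sin t"
proof -
  have le: "s * cos s \<le> sin s" if s: "0 \<le> s" "s \<le> pi" for s :: real
  proof -
    have "sin 0 - 0 * cos 0 \<le> sin s - s * cos s"
    proof (rule DERIV_nonneg_imp_nondecreasing[OF s(1)])
      fix x assume "0 \<le> x" "x \<le> s"
      then have "0 \<le> x * sin x"
        using s by (intro mult_nonneg_nonneg sin_ge_zero) auto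
      moreover have "((\<lambda>x. sin x - x * cos x) has_real_derivative x * sin x) (at x)"
        by (auto intro!: derivative_eq_intros simp: algebra_simps)
      ultimately show "\<exists>y. ((\<lambda>x. sin x - x * cos x) has_real_derivative y) (at x) \<and> 0 \<le> y"
        by blast
    qed
    then show ?thesis
      by simp
  qed
  have c: "0 \<le> cos (t / 2)"
    using assms by (intro cos_ge_zero) auto
  have "t / 2 \<le> t / 2 * (1 + cos t)"
    using assms cos_ge_zero[of t] by (simp add: algebra_simps)
  also have "1 + cos t = 2 * (cos (t / 2))\<^sup>2"
    using cos_double_cos[of "t / 2"] by simp
  also have "t / 2 * (2 * (cos (t / 2))\<^sup>2) = 2 * ((t / 2 * cos (t / 2)) * cos (t / 2))"
    by (simp add: power2_eq_square)
  also have "\<dots> \<le> 2 * (sin (t / 2) * cos (t / 2))"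
    using assms c by (intro mult_left_mono mult_right_mono le) auto
  also have "\<dots> = sin t"
    using sin_double[of "t / 2"] by simp
  finally show ?thesis
    by simp
qed

text \<open>The angle has no Lipschitz bound near the origin; the factor \<open>norm y\<close>
  compensates for this. With \<open>v\<close> the difference of the angles, reduced by periodicity
  to at most \<open>pi\<close> in absolute value, the squared distance is \<open>(norm x - norm
  y)\<^sup>2 + 4 * norm x * norm y * (sin (v / 2))\<^sup>2\<close>, and \<open>half_le_sin\<close>
  compares \<open>v\<close> with the chord.\<close>

lemma periodic_polar_lipschitz:
  fixes q :: "real \<Rightarrow> real" and x y :: "real^2"
  assumes per: "\<And>t. q (t + 2 * pi) = q t" and lip: "\<And>s t. \<bar>q s - q t\<bar> \<le> K * \<bar>s - t\<bar>"
    and le: "norm y \<le> norm x"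
  shows "norm y * \<bar>q (polar_angle x) - q (polar_angle y)\<bar> \<le> 2 * K * norm (x - y)"
proof -
  have K: "0 \<le> K"
    using lip[of 1 0] by (simp add: order_trans[OF abs_ge_zero])
  define w where "w = polar_angle x - polar_angle y"
  obtain k :: int where k: "\<bar>w + of_int k * (2 * pi)\<bar> \<le> pi"
  proof (cases "w = pi \<or> \<bar>w\<bar> \<le> pi")
    case True
    then show ?thesis
      using that[of 0] by auto
  next
    case False
    then have "pi < \<bar>w\<bar>" "\<bar>w\<bar> < 2 * pi"
      using polar_angle_bounds[of x] polar_angle_bounds[of y] by (auto simp: w_def)
    then show ?thesis
      using that[of 1] that[of "-1"] by (cases "w < 0") (auto simp: abs_if split: if_splits)
  qed
  define v where "v = w + of_int k * (2 * pi)"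
  have "q (polar_angle x) = q (polar_angle x + of_int k * (2 * pi))"
    by (rule periodic_int_shift[of q "2 * pi", OF per, symmetric])
  also have "polar_angle x + of_int k * (2 * pi) = polar_angle y + v"
    by (simp add: v_def w_def)
  finally have "\<bar>q (polar_angle x) - q (polar_angle y)\<bar> \<le> K * \<bar>v\<bar>"
    using lip[of "polar_angle y + v" "polar_angle y"] by simp
  moreover have "\<bar>v\<bar> \<le> 4 * \<bar>sin (v / 2)\<bar>"
  proof -
    have "\<bar>v\<bar> / 2 \<le> 2 * sin (\<bar>v\<bar> / 2)"
      using k by (intro half_le_sin) (auto simp: v_def)
    also have "sin (\<bar>v\<bar> / 2) \<le> \<bar>sin (v / 2)\<bar>"
      by (cases "0 \<le> v") auto
    finally show ?thesis
      by simp
  qed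
  ultimately have 1: "\<bar>q (polar_angle x) - q (polar_angle y)\<bar> \<le> K * (4 * \<bar>sin (v / 2)\<bar>)"
    using K by (meson mult_left_mono order_trans)
  have "(2 * norm y * \<bar>sin (v / 2)\<bar>)\<^sup>2 \<le> (norm (x - y))\<^sup>2"
  proof -
    let ?a = "norm x" and ?b = "norm y" and ?s = "polar_angle x" and ?t = "polar_angle y"
    have "x - y = ?a *\<^sub>R vector [cos ?s, sin ?s] - ?b *\<^sub>R vector [cos ?t, sin ?t]"
      using polar_decomposition[of x] polar_decomposition[of y] by simp
    also have "(norm (\<dots> :: real^2))\<^sup>2 = (?a * cos ?s - ?b * cos ?t)\<^sup>2 + (?a * sin ?s - ?b * sin ?t)\<^sup>2"
      by (simp add: norm_real2 cmod_def)
    also have "\<dots> = ?a\<^sup>2 * ((sin ?s)\<^sup>2 + (cos ?s)\<^sup>2) + ?b\<^sup>2 * ((sin ?t)\<^sup>2 + (cos ?t)\<^sup>2)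
        - 2 * ?a * ?b * (cos ?s * cos ?t + sin ?s * sin ?t)"
      by (simp only: power2_eq_square) algebra
    also have "\<dots> = ?a\<^sup>2 + ?b\<^sup>2 - 2 * ?a * ?b * cos w"
      by (simp add: w_def cos_diff)
    also have "cos w = cos v"
      unfolding v_def using periodic_int_shift[of cos "2 * pi" w k] by simp
    also have "cos v = 1 - 2 * (sin (v / 2))\<^sup>2"
      using cos_double_sin[of "v / 2"] by simp
    also have "?a\<^sup>2 + ?b\<^sup>2 - 2 * ?a * ?b * (1 - 2 * (sin (v / 2))\<^sup>2) =
        (?a - ?b)\<^sup>2 + 4 * (?a * ?b) * (sin (v / 2))\<^sup>2"
      by (simp only: power2_eq_square) algebra
    finally have "(norm (x - y))\<^sup>2 = (?a - ?b)\<^sup>2 + 4 * (?a * ?b) * (sin (v / 2))\<^sup>2" .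
    moreover have "4 * (?b * ?b) * (sin (v / 2))\<^sup>2 \<le> 4 * (?a * ?b) * (sin (v / 2))\<^sup>2"
      using le by (intro mult_right_mono mult_left_mono) auto
    moreover have "(2 * ?b * \<bar>sin (v / 2)\<bar>)\<^sup>2 = 4 * (?b * ?b) * (sin (v / 2))\<^sup>2"
      by (simp add: power_mult_distrib power2_eq_square)
    ultimately show ?thesis
      using zero_le_power2[of "?a - ?b"] by linarith
  qed
  then have 2: "2 * norm y * \<bar>sin (v / 2)\<bar> \<le> norm (x - y)"
    by (rule power2_le_imp_le) simp
  have "norm y * \<bar>q (polar_angle x) - q (polar_angle y)\<bar> \<le> norm y * (K * (4 * \<bar>sin (v / 2)\<bar>))"
    using 1 by (intro mult_left_mono) auto
  also have "\<dots> = 2 * K * (2 * norm y * \<bar>sin (v / 2)\<bar>)"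
    by simp
  also have "\<dots> \<le> 2 * K * norm (x - y)"
    using 2 K by (intro mult_left_mono) auto
  finally show ?thesis .
qed


section \<open>Complexified vectors\<close>

lemma norm_vector_scalar_mult: "norm (c *s v) = cmod c * norm (v :: complex^'n)"
  by (simp add: norm_vec_def L2_set_def norm_mult power_mult_distrib real_sqrt_mult
      flip: sum_distrib_left)

lemma norm_cvec [simp]: "norm (cvec x) = norm x"
  by (simp add: norm_vec_def cvec_def)

lemma cvec_diff: "cvec (x - y) = cvec x - cvec y"
  and cvec_scaleR: "cvec (r *\<^sub>R x) = complex_of_real r *s cvec x"
  by (simp_all add: cvec_def vec_eq_iff)

lemma bounded_linear_scalar_cvec: "bounded_linear (\<lambda>x. c *s cvec x)"
proof (rule bounded_linear_intro)
  show "norm (c *s cvec x) \<le> norm x * cmod c" for x :: "real^'n"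
    by (simp add: norm_vector_scalar_mult mult.commute)
  show "c *s cvec (x + y) = c *s cvec x + c *s cvec y" for x y :: "real^'n"
    by (simp add: cvec_def vec_eq_iff algebra_simps)
  show "c *s cvec (r *\<^sub>R x) = r *\<^sub>R (c *s cvec x)" for r and x :: "real^'n"
    by (simp add: cvec_def vec_eq_iff scaleR_conv_of_real[where 'a = complex])
qed

lemma bounded_linear_scalar_left: "bounded_linear (\<lambda>c :: complex. c *s v)"
proof (rule bounded_linear_intro)
  show "norm (c *s v) \<le> norm c * norm v" for c
    by (simp add: norm_vector_scalar_mult)
qed (simp_all add: vec_eq_iff algebra_simps scaleR_conv_of_real[where 'a = complex])

text \<open>Collects what is used of the radius functions: pointwise and Lipschitz bounds in place
  of weak derivatives. The same \<open>b j\<close> plays both roles, and \<open>D\<close> may be any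
  bounded open set that stays within the reference radius.\<close>

locale radial_family =
  fixes \<rho>h :: "real \<Rightarrow> real" and \<rho> :: "nat \<Rightarrow> real \<Rightarrow> real" and b :: "nat \<Rightarrow> real"
    and rmin rmax Lh :: real and D :: "(real^2) set"
  assumes rho_le: "\<And>j t. \<bar>\<rho> j t\<bar> \<le> b j"
    and rho_lip: "\<And>j s t. \<bar>\<rho> j s - \<rho> j t\<bar> \<le> b j * \<bar>s - t\<bar>"
    and rho_per: "\<And>j t. \<rho> j (t + 2 * pi) = \<rho> j t"
    and rhoh_bounds: "0 < rmin" "\<And>t. rmin \<le> \<rho>h t" "\<And>t. \<rho>h t \<le> rmax"
    and rhoh_lip: "\<And>s t. \<bar>\<rho>h s - \<rho>h t\<bar> \<le> Lh * \<bar>s - t\<bar>"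
    and rhoh_per: "\<And>t. \<rho>h (t + 2 * pi) = \<rho>h t"
    and summable_b: "summable b"
    and open_D: "open D" and bounded_D: "bounded D"
    and D_le: "\<And>x. x \<in> D \<Longrightarrow> norm x \<le> \<rho>h (polar_angle x)"
begin

lemma rhoh_pos: "0 < \<rho>h t"
  using rhoh_bounds(1,2) by (rule less_le_trans)

lemma b_nonneg: "0 \<le> b j"
  using rho_le[of j 0] by linarith

lemma Lh_nonneg: "0 \<le> Lh"
  using rhoh_lip[of 1 0] by (simp add: order_trans[OF abs_ge_zero])

definition ratio :: "nat \<Rightarrow> real \<Rightarrow> real" where
  "ratio j t = \<rho> j t / \<rho>h t"

text \<open>Quotient rule: the Lipschitz constant of \<open>\<rho> j / \<rho>h\<close> per unit of
  \<open>b j\<close>.\<close>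

definition ratio_lip :: real where
  "ratio_lip = 1 / rmin + Lh / rmin\<^sup>2"

text \<open>The first summand bounds the factor \<open>ratio j\<close>, the second comes from its
  variation with the angle through \<open>periodic_polar_lipschitz\<close>, both per unit of
  \<open>b j\<close>.\<close>

definition field_lip :: real where
  "field_lip = 1 / rmin + 2 * ratio_lip"

text \<open>The partial derivative of the transformation with respect to the parameter
  \<open>y j\<close>.\<close>

definition basis_field :: "nat \<Rightarrow> real^2 \<Rightarrow> real^2" where
  "basis_field j x = ratio j (polar_angle x) *\<^sub>R x"

lemma field_lip_nonneg: "0 \<le> field_lip"
  using rhoh_bounds(1) Lh_nonneg by (simp add: field_lip_def ratio_lip_def)

lemma ratio_lipschitz: "\<bar>ratio j s - ratio j t\<bar> \<le> (b j * ratio_lip) * \<bar>s - t\<bar>"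
proof -
  have "ratio j s - ratio j t = (\<rho> j s - \<rho> j t) / \<rho>h s + \<rho> j t * (\<rho>h t - \<rho>h s) / (\<rho>h s * \<rho>h t)"
    using rhoh_pos[of s] rhoh_pos[of t] by (simp add: ratio_def field_simps)
  also have "\<bar>\<dots>\<bar> \<le> \<bar>(\<rho> j s - \<rho> j t) / \<rho>h s\<bar> + \<bar>\<rho> j t * (\<rho>h t - \<rho>h s) / (\<rho>h s * \<rho>h t)\<bar>"
    by (rule abs_triangle_ineq)
  also have "\<bar>(\<rho> j s - \<rho> j t) / \<rho>h s\<bar> \<le> b j * \<bar>s - t\<bar> / rmin"
    unfolding abs_divide
    using rho_lip[of j s t] rhoh_bounds(1,2) rhoh_pos[of s] b_nonneg[of j]
    by (intro frac_le mult_nonneg_nonneg) auto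
  also have "\<bar>\<rho> j t * (\<rho>h t - \<rho>h s) / (\<rho>h s * \<rho>h t)\<bar> \<le> b j * (Lh * \<bar>s - t\<bar>) / (rmin * rmin)"
    unfolding abs_divide abs_mult
    using rho_le[of j t] rhoh_lip[of t s] rhoh_bounds(1,2) rhoh_pos[of s] rhoh_pos[of t]
      b_nonneg[of j] Lh_nonneg
    by (intro frac_le mult_mono mult_nonneg_nonneg mult_pos_pos) (auto simp: abs_minus_commute)
  also have "b j * \<bar>s - t\<bar> / rmin + b j * (Lh * \<bar>s - t\<bar>) / (rmin * rmin) = (b j * ratio_lip) * \<bar>s - t\<bar>"
    by (simp add: ratio_lip_def field_simps power2_eq_square)
  finally show ?thesis
    by simp
qed

lemma abs_ratio_le: "\<bar>ratio j t\<bar> \<le> b j / rmin"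
  unfolding ratio_def abs_divide using rho_le[of j t] rhoh_bounds(1,2) rhoh_pos[of t] b_nonneg[of j]
  by (intro frac_le) auto

text \<open>In the splitting of the difference, the variation of the ratio multiplies the point of
  smaller norm, as \<open>periodic_polar_lipschitz\<close> requires; the other case follows by
  symmetry.\<close>

lemma basis_field_lipschitz: "(field_lip * b j)-lipschitz_on A (basis_field j)"
proof (rule lipschitz_onI)
  have *: "norm (basis_field j x - basis_field j y) \<le> field_lip * b j * norm (x - y)"
    if le: "norm y \<le> norm x" for x y
  proof -
    have "basis_field j x - basis_field j y =
        ratio j (polar_angle x) *\<^sub>R (x - y) + (ratio j (polar_angle x) - ratio j (polar_angle y)) *\<^sub>R y"
      by (simp add: basis_field_def algebra_simps)
    also have "norm \<dots> \<le> \<bar>ratio j (polar_angle x)\<bar> * norm (x - y) +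
        norm y * \<bar>ratio j (polar_angle x) - ratio j (polar_angle y)\<bar>"
      by (rule norm_triangle_le) (simp add: mult.commute)
    also have "\<dots> \<le> b j / rmin * norm (x - y) + 2 * (b j * ratio_lip) * norm (x - y)"
    proof (intro add_mono mult_right_mono abs_ratio_le norm_ge_zero)
      show "norm y * \<bar>ratio j (polar_angle x) - ratio j (polar_angle y)\<bar> \<le> 2 * (b j * ratio_lip) * norm (x - y)"
        by (rule periodic_polar_lipschitz[OF _ ratio_lipschitz le])
          (simp add: ratio_def rho_per rhoh_per)
    qed
    also have "\<dots> = field_lip * b j * norm (x - y)"
      by (simp add: field_lip_def algebra_simps)
    finally show ?thesis .
  qed
  show "dist (basis_field j x) (basis_field j y) \<le> field_lip * b j * dist x y" for x y
    using *[of y x] *[of x y] by (cases "norm y \<le> norm x") (auto simp: dist_norm norm_minus_commute)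
qed (simp add: field_lip_nonneg b_nonneg)

lemma norm_basis_field_le:
  assumes "x \<in> D"
  shows "norm (basis_field j x) \<le> b j"
proof -
  let ?t = "polar_angle x"
  have "norm (basis_field j x) = \<bar>\<rho> j ?t\<bar> * (norm x / \<rho>h ?t)"
    using rhoh_pos[of ?t] by (simp add: basis_field_def ratio_def)
  also have "\<dots> \<le> b j * 1"
    using rho_le[of j ?t] D_le[OF assms] rhoh_pos[of ?t] b_nonneg[of j] by (intro mult_mono) auto
  finally show ?thesis
    by simp
qed

section \<open>Transformations with complex parameters\<close>

definition zratio :: "(nat \<Rightarrow> complex) \<Rightarrow> real \<Rightarrow> complex" where
  "zratio z t = (of_real (\<rho>h t) + (\<Sum>j. z j * of_real (\<rho> j t))) / of_real (\<rho>h t)"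

definition zmap :: "(nat \<Rightarrow> complex) \<Rightarrow> real^2 \<Rightarrow> complex^2" where
  "zmap z x = zratio z (polar_angle x) *s cvec x"

text \<open>The complex parameters that are close to the cube in the weighted \<open>\<ell>\<^sup>1\<close> sense; this contains
  the polystadia of all admissible sequences.\<close>

definition near :: "real \<Rightarrow> (nat \<Rightarrow> complex) \<Rightarrow> (nat \<Rightarrow> real) \<Rightarrow> bool" where
  "near \<epsilon> z y \<longleftrightarrow> y \<in> param_cube \<and> summable (\<lambda>j. cmod (z j - of_real (y j)) * b j) \<and>
     (\<Sum>j. cmod (z j - of_real (y j)) * b j) \<le> \<epsilon>"

lemma summable_bounded_coeff:
  assumes "summable (\<lambda>j. cmod (z j) * b j)"
  shows "summable (\<lambda>j. z j * of_real (\<rho> j t))"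
  by (rule summable_comparison_test'[OF assms, of 0])
    (auto simp: norm_mult intro!: mult_left_mono rho_le)

lemma param_cube_abs_le: "y \<in> param_cube \<Longrightarrow> \<bar>y j\<bar> \<le> 1"
  by (auto simp: param_cube_def abs_le_iff minus_le_iff)

lemma cube_summable: "y \<in> param_cube \<Longrightarrow> summable (\<lambda>j. cmod (of_real (y j)) * b j)"
  by (rule summable_comparison_test'[OF summable_b, of 0])
    (auto simp: param_cube_abs_le abs_mult b_nonneg intro!: mult_left_le_one_le)

lemma near_summable:
  assumes "near \<epsilon> z y"
  shows "summable (\<lambda>j. cmod (z j) * b j)"
proof (rule summable_comparison_test'[of _ 0])
  show "summable (\<lambda>j. cmod (z j - of_real (y j)) * b j + cmod (of_real (y j)) * b j)"
    using assms by (intro summable_add cube_summable) (auto simp: near_def)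
  show "norm (cmod (z j) * b j) \<le> cmod (z j - of_real (y j)) * b j + cmod (of_real (y j)) * b j" for j
    using norm_triangle_ineq[of "z j - of_real (y j)" "of_real (y j)"] b_nonneg[of j]
    by (simp add: abs_mult mult_right_mono flip: distrib_right)
qed

lemma near_self: "y \<in> param_cube \<Longrightarrow> 0 \<le> \<epsilon> \<Longrightarrow> near \<epsilon> (\<lambda>j. of_real (y j)) y"
  by (simp add: near_def)

lemma summable_real_coeff: "y \<in> param_cube \<Longrightarrow> summable (\<lambda>j. y j * \<rho> j t)"
  using summable_bounded_coeff[OF cube_summable] by (simp flip: of_real_mult)

lemma zratio_real:
  assumes "y \<in> param_cube"
  shows "zratio (\<lambda>j. of_real (y j)) t = of_real (param_radius \<rho>h \<rho> y t / \<rho>h t)"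
  unfolding zratio_def param_radius_def
  using suminf_of_real[OF summable_real_coeff[OF assms], of t, where 'a = complex] by simp

lemma zmap_real:
  assumes "y \<in> param_cube"
  shows "zmap (\<lambda>j. of_real (y j)) x = cvec (affine_transformation \<rho>h \<rho> y x)"
  by (simp add: zmap_def zratio_real[OF assms] affine_transformation_def cvec_scaleR)

lemma zmap_diff:
  assumes z: "summable (\<lambda>j. cmod (z j) * b j)" and z': "summable (\<lambda>j. cmod (z' j) * b j)"
  shows "zmap z x = zmap z' x + (\<Sum>j. (z j - z' j) *s cvec (basis_field j x))"
proof -
  let ?t = "polar_angle x"
  note s = summable_bounded_coeff[OF z, of ?t] summable_bounded_coeff[OF z', of ?t]
  have eq: "(z j - z' j) * of_real (ratio j ?t) = (z j * of_real (\<rho> j ?t) - z' j * of_real (\<rho> j ?t)) / of_real (\<rho>h ?t)" for j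
    by (simp add: ratio_def algebra_simps)
  have sm: "summable (\<lambda>j. (z j - z' j) * of_real (ratio j ?t))"
    unfolding eq by (intro summable_divide summable_diff s)
  have "zratio z ?t - zratio z' ?t = (\<Sum>j. (z j - z' j) * of_real (ratio j ?t))"
    unfolding eq
    by (simp add: suminf_divide summable_diff s suminf_diff zratio_def flip: diff_divide_distrib)
  then have "zmap z x - zmap z' x = (\<Sum>j. (z j - z' j) * of_real (ratio j ?t)) *s cvec x"
    by (simp add: zmap_def vector_sub_rdistrib flip: vec.scale_left_diff_distrib)
  also have "\<dots> = (\<Sum>j. ((z j - z' j) * of_real (ratio j ?t)) *s cvec x)"
    by (rule bounded_linear.suminf[OF bounded_linear_scalar_left sm])
  also have "\<dots> = (\<Sum>j. (z j - z' j) *s cvec (basis_field j x))"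
    by (simp add: basis_field_def cvec_scaleR)
  finally show ?thesis
    by (simp add: algebra_simps)
qed

lemma zratio_upd:
  assumes "summable (\<lambda>j. cmod (z j) * b j)"
  shows "zratio (z(k := w)) t = zratio z t + (w - z k) * of_real (ratio k t)"
proof -
  have "(\<lambda>j. z j * of_real (\<rho> j t) + (if j = k then (w - z k) * of_real (\<rho> k t) else 0)) sums
      ((\<Sum>j. z j * of_real (\<rho> j t)) + (w - z k) * of_real (\<rho> k t))"
    by (intro sums_add sums_single summable_sums summable_bounded_coeff assms)
  moreover have "(\<lambda>j. z j * of_real (\<rho> j t) + (if j = k then (w - z k) * of_real (\<rho> k t) else 0)) =
      (\<lambda>j. (z(k := w)) j * of_real (\<rho> j t))"
    by (auto simp: fun_eq_iff algebra_simps)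
  ultimately have "(\<Sum>j. (z(k := w)) j * of_real (\<rho> j t)) =
      (\<Sum>j. z j * of_real (\<rho> j t)) + (w - z k) * of_real (\<rho> k t)"
    by (simp add: sums_iff)
  then show ?thesis
    unfolding zratio_def ratio_def by (simp add: add_divide_distrib)
qed

text \<open>The map is affine in each single parameter, with a fixed field as direction. All
  separate holomorphy rests on this.\<close>

lemma zmap_upd:
  assumes "summable (\<lambda>j. cmod (z j) * b j)"
  shows "zmap (z(k := w)) x = zmap z x + (w - z k) *s cvec (basis_field k x)"
  by (simp add: zmap_def zratio_upd[OF assms] basis_field_def cvec_scaleR vector_sadd_rdistrib)

text \<open>A bound for the values plus \<open>DIM(real^2)\<close> weak partial derivatives, each at
  most \<open>DIM(complex^2) * field_lip\<close>, per unit of the weighted coefficient sum; the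
  product form is a convenient upper bound.\<close>

definition nbhd_const :: real where
  "nbhd_const = (1 + field_lip) * (1 + real DIM(real^2) * real DIM(complex^2))"

lemma nbhd_const_pos: "0 < nbhd_const"
  using field_lip_nonneg by (simp add: nbhd_const_def add_pos_nonneg)

lemma scaled_lipschitz:
  "(cmod c * (field_lip * b j))-lipschitz_on A (\<lambda>x. c *s cvec (basis_field j x))"
proof (rule lipschitz_onI)
  fix x y
  have "c *s cvec (basis_field j x) - c *s cvec (basis_field j y) = c *s cvec (basis_field j x - basis_field j y)"
    by (simp add: cvec_diff vector_ssub_ldistrib)
  then have "dist (c *s cvec (basis_field j x)) (c *s cvec (basis_field j y)) =
      cmod c * dist (basis_field j x) (basis_field j y)"
    by (simp add: dist_norm norm_vector_scalar_mult)
  also have "\<dots> \<le> cmod c * (field_lip * b j * dist x y)"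
    by (intro mult_left_mono lipschitz_onD[OF basis_field_lipschitz[of j UNIV]]) auto
  finally show "dist (c *s cvec (basis_field j x)) (c *s cvec (basis_field j y)) \<le>
      cmod c * (field_lip * b j) * dist x y"
    by (simp add: algebra_simps)
qed (simp add: field_lip_nonneg b_nonneg)

lemma scaled_W1inf:
  assumes "basis_field j \<in> W1inf D"
  shows "(\<lambda>x. c *s cvec (basis_field j x)) \<in> W1inf D"
  by (rule W1inf_bounded_linear[OF assms open_D bounded_D bounded_linear_scalar_cvec])

lemma perturbation_norm:
  assumes W: "\<And>j. basis_field j \<in> W1inf D" and c: "summable (\<lambda>j. cmod (c j) * b j)"
  shows "(\<lambda>x. \<Sum>j. c j *s cvec (basis_field j x)) \<in> W1inf D"
    and "W1inf_norm D (\<lambda>x. \<Sum>j. c j *s cvec (basis_field j x)) \<le> nbhd_const * (\<Sum>j. cmod (c j) * b j)"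
    and "x \<in> D \<Longrightarrow> norm (\<Sum>j. c j *s cvec (basis_field j x)) \<le> (\<Sum>j. cmod (c j) * b j)"
proof -
  let ?S = "\<Sum>j. cmod (c j) * b j"
  have bnd: "norm (c j *s cvec (basis_field j x)) \<le> cmod (c j) * b j" if "x \<in> D" for j x
    using norm_basis_field_le[OF that] by (simp add: norm_vector_scalar_mult mult_left_mono)
  have sm: "summable (\<lambda>j. c j *s cvec (basis_field j x))" if "x \<in> D" for x
    by (rule summable_comparison_test'[OF c, of 0]) (use bnd[OF that] in simp)
  have S: "0 \<le> ?S"
    by (intro suminf_nonneg c) (simp add: b_nonneg)
  show le: "norm (\<Sum>j. c j *s cvec (basis_field j x)) \<le> ?S" if "x \<in> D" for x
    by (intro norm_suminf_le c bnd that)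
  show W': "(\<lambda>x. \<Sum>j. c j *s cvec (basis_field j x)) \<in> W1inf D"
  \<comment> \<open>One sequence has to bound both the terms and their Lipschitz constants; the
    factor \<open>1 + field_lip\<close> covers both.\<close>
  proof (rule W1inf_suminf_lipschitz[OF open_D bounded_D scaled_W1inf[OF W]])
    show "norm (c j *s cvec (basis_field j x)) \<le> (1 + field_lip) * (cmod (c j) * b j)" if "x \<in> D" for j x
      using bnd[OF that, of j] field_lip_nonneg b_nonneg[of j] by (simp add: distrib_right add_increasing2)
    show "((1 + field_lip) * (cmod (c j) * b j))-lipschitz_on D (\<lambda>x. c j *s cvec (basis_field j x))" for j
      by (rule lipschitz_on_le[OF scaled_lipschitz])
        (use b_nonneg[of j] in \<open>simp add: algebra_simps\<close>)
    show "summable (\<lambda>j. (1 + field_lip) * (cmod (c j) * b j))"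
      by (intro summable_mult c)
  qed
  \<comment> \<open>The norm is estimated through the Lipschitz constant of the whole sum, since
    membership in \<open>W1inf\<close> is already known.\<close>
  have lip: "(field_lip * ?S)-lipschitz_on D (\<lambda>x. \<Sum>j. c j *s cvec (basis_field j x))"
  proof (rule lipschitz_onI)
    fix x y assume xy: "x \<in> D" "y \<in> D"
    have "dist (\<Sum>j. c j *s cvec (basis_field j x)) (\<Sum>j. c j *s cvec (basis_field j y)) =
        norm (\<Sum>j. c j *s cvec (basis_field j x) - c j *s cvec (basis_field j y))"
      unfolding dist_norm by (simp add: suminf_diff sm xy)
    also have "\<dots> \<le> (\<Sum>j. cmod (c j) * b j * (field_lip * dist x y))"
    proof (rule norm_suminf_le)
      show "norm (c j *s cvec (basis_field j x) - c j *s cvec (basis_field j y)) \<le>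
          cmod (c j) * b j * (field_lip * dist x y)" for j
        using lipschitz_onD[OF scaled_lipschitz[of "c j" j UNIV], of x y]
        by (simp add: dist_norm algebra_simps)
      show "summable (\<lambda>j. cmod (c j) * b j * (field_lip * dist x y))"
        by (intro summable_mult2 c)
    qed
    also have "\<dots> = field_lip * ?S * dist x y"
      using suminf_mult2[OF c, of "field_lip * dist x y"] by (simp add: algebra_simps)
    finally show "dist (\<Sum>j. c j *s cvec (basis_field j x)) (\<Sum>j. c j *s cvec (basis_field j y)) \<le>
      field_lip * ?S * dist x y" .
  qed (simp add: S field_lip_nonneg)
  have "W1inf_norm D (\<lambda>x. \<Sum>j. c j *s cvec (basis_field j x)) \<le>
      ?S + real DIM(real^2) * (real DIM(complex^2) * (field_lip * ?S))"
    by (rule W1inf_norm_le_lipschitz[OF open_D bounded_D lip W' S le])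
  also have "\<dots> \<le> nbhd_const * ?S"
    using S field_lip_nonneg by (simp add: nbhd_const_def algebra_simps)
  finally show "W1inf_norm D (\<lambda>x. \<Sum>j. c j *s cvec (basis_field j x)) \<le> nbhd_const * ?S" .
qed

text \<open>A single nonzero coefficient turns the estimates for series into estimates for one
  field.\<close>

lemma single_perturbation:
  "(\<lambda>x. \<Sum>j. (if j = k then c else 0) *s cvec (basis_field j x)) = (\<lambda>x. c *s cvec (basis_field k x))"
  "(\<lambda>j. cmod (if j = k then c else 0) * b j) sums (cmod c * b k)"
proof -
  have "(\<lambda>j. (if j = k then c else 0) *s cvec (basis_field j x)) =
      (\<lambda>j. if j = k then c *s cvec (basis_field k x) else 0)" for x
    by auto
  moreover have "(\<lambda>j. if j = k then c *s cvec (basis_field k x) else 0) sums (c *s cvec (basis_field k x))" for x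
    using sums_single[of k "\<lambda>j. c *s cvec (basis_field k x)"] by simp
  ultimately show "(\<lambda>x. \<Sum>j. (if j = k then c else 0) *s cvec (basis_field j x)) = (\<lambda>x. c *s cvec (basis_field k x))"
    by (simp add: sums_iff fun_eq_iff)
  have "(\<lambda>j. cmod (if j = k then c else 0) * b j) = (\<lambda>j. if j = k then cmod c * b k else 0)"
    by auto
  then show "(\<lambda>j. cmod (if j = k then c else 0) * b j) sums (cmod c * b k)"
    using sums_single[of k "\<lambda>j. cmod c * b k"] by simp
qed

lemma scaled_W1inf_norm:
  assumes W: "\<And>j. basis_field j \<in> W1inf D"
  shows "W1inf_norm D (\<lambda>x. c *s cvec (basis_field k x)) \<le> nbhd_const * (cmod c * b k)"
  using perturbation_norm(2)[OF W sums_summable[OF single_perturbation(2)[of k c]]]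
    sums_unique[OF single_perturbation(2)[of k c]]
  by (simp only: single_perturbation(1))

text \<open>The complex map differs from the real transformation at \<open>y\<close> by the series
  with coefficients \<open>z j - y j\<close>, whose weighted sum is at most
  \<open>\<epsilon>\<close>.\<close>

lemma near_zmap:
  assumes W: "\<And>j. basis_field j \<in> W1inf D"
    and r: "\<And>y. y \<in> param_cube \<Longrightarrow> affine_transformation \<rho>h \<rho> y \<in> W1inf D"
    and near: "near \<epsilon> z y"
  shows "zmap z \<in> W1inf D"
    and "W1inf_norm D (\<lambda>x. zmap z x - cvec (affine_transformation \<rho>h \<rho> y x)) \<le> nbhd_const * \<epsilon>"
    and "x \<in> D \<Longrightarrow> norm (zmap z x - cvec (affine_transformation \<rho>h \<rho> y x)) \<le> \<epsilon>"
proof -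
  have y: "y \<in> param_cube" and s: "summable (\<lambda>j. cmod (z j - of_real (y j)) * b j)"
    and le: "(\<Sum>j. cmod (z j - of_real (y j)) * b j) \<le> \<epsilon>"
    using near by (auto simp: near_def)
  have eq: "zmap z x = cvec (affine_transformation \<rho>h \<rho> y x) +
      (\<Sum>j. (z j - of_real (y j)) *s cvec (basis_field j x))" for x
    using zmap_diff[OF near_summable[OF near] cube_summable[OF y]] by (simp add: zmap_real[OF y])
  note p = perturbation_norm[OF W s]
  have "bounded_linear (cvec :: real^2 \<Rightarrow> complex^2)"
    using bounded_linear_scalar_cvec[of 1] by simp
  then have "(\<lambda>x. cvec (affine_transformation \<rho>h \<rho> y x)) \<in> W1inf D"
    by (rule W1inf_bounded_linear[OF r[OF y] open_D bounded_D])
  then have "(\<lambda>x. cvec (affine_transformation \<rho>h \<rho> y x) +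
      (\<Sum>j. (z j - of_real (y j)) *s cvec (basis_field j x))) \<in> W1inf D"
    by (rule W1inf_add[OF _ p(1) open_D bounded_D])
  then show "zmap z \<in> W1inf D"
    by (simp only: eq[symmetric])
  show "W1inf_norm D (\<lambda>x. zmap z x - cvec (affine_transformation \<rho>h \<rho> y x)) \<le> nbhd_const * \<epsilon>"
    unfolding eq add_diff_cancel_left'
    by (rule order_trans[OF p(2) mult_left_mono[OF le]]) (use nbhd_const_pos in simp)
  show "norm (zmap z x - cvec (affine_transformation \<rho>h \<rho> y x)) \<le> \<epsilon>" if "x \<in> D"
    unfolding eq add_diff_cancel_left' by (rule order_trans[OF p(3)[OF that] le])
qed

lemma near_zratio_le:
  assumes "near \<epsilon> z y"
  shows "cmod (zratio z t) \<le> (rmax + (\<epsilon> + suminf b)) / rmin"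
proof -
  have s: "summable (\<lambda>j. cmod (z j) * b j)"
    by (rule near_summable[OF assms])
  have y: "y \<in> param_cube" and s': "summable (\<lambda>j. cmod (z j - of_real (y j)) * b j)"
    and le: "(\<Sum>j. cmod (z j - of_real (y j)) * b j) \<le> \<epsilon>"
    using assms by (auto simp: near_def)
  have "cmod (\<Sum>j. z j * of_real (\<rho> j t)) \<le> (\<Sum>j. cmod (z j) * b j)"
    by (intro norm_suminf_le s) (auto simp: norm_mult intro!: mult_left_mono rho_le)
  also have "\<dots> \<le> (\<Sum>j. cmod (z j - of_real (y j)) * b j + b j)"
  proof (intro suminf_le s summable_add s' summable_b)
    fix j
    have "cmod (z j) \<le> cmod (z j - of_real (y j)) + 1"
      using norm_triangle_ineq[of "z j - of_real (y j)" "of_real (y j)"] param_cube_abs_le[OF y, of j]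
      by simp
    then show "cmod (z j) * b j \<le> cmod (z j - of_real (y j)) * b j + b j"
      using mult_right_mono[OF _ b_nonneg[of j]] by (fastforce simp: distrib_right)
  qed
  also have "\<dots> \<le> \<epsilon> + suminf b"
    using le by (simp add: suminf_add[OF s' summable_b, symmetric])
  finally have "cmod (of_real (\<rho>h t) + (\<Sum>j. z j * of_real (\<rho> j t))) \<le> rmax + (\<epsilon> + suminf b)"
    using rhoh_pos[of t] rhoh_bounds(3)[of t]
    by (intro norm_triangle_mono) auto
  then show ?thesis
    unfolding zratio_def norm_divide norm_of_real
    using rhoh_bounds(1,2) rhoh_pos[of t] by (intro frac_le) (auto intro: order_trans[OF norm_ge_zero])
qed

lemma continuous_rho: "continuous_on A (\<rho> j)" and continuous_rhoh: "continuous_on A \<rho>h"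
proof -
  have "(b j)-lipschitz_on A (\<rho> j)" "Lh-lipschitz_on A \<rho>h"
    using rho_lip rhoh_lip b_nonneg Lh_nonneg by (auto intro!: lipschitz_onI simp: dist_real_def)
  then show "continuous_on A (\<rho> j)" "continuous_on A \<rho>h"
    using lipschitz_on_continuous_on by blast+
qed

lemma borel_measurable_zratio [measurable]: "(\<lambda>x. zratio z (polar_angle x)) \<in> borel_measurable borel"
proof -
  have [measurable]: "\<rho> j \<in> borel_measurable borel" "\<rho>h \<in> borel_measurable borel" for j
    by (intro borel_measurable_continuous_onI continuous_rho continuous_rhoh)+
  show ?thesis
    unfolding zratio_def by measurable
qed

lemma borel_measurable_zmap [measurable]: "zmap z \<in> borel_measurable borel"
proof -
  have "continuous_on UNIV (\<lambda>p :: complex \<times> (real^2). fst p *s cvec (snd p))"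
    unfolding cvec_def vector_scalar_mult_def
    by (intro continuous_on_vec_lambda continuous_intros)
  then have "(\<lambda>p :: complex \<times> (real^2). fst p *s cvec (snd p)) \<in> borel_measurable borel"
    by (rule borel_measurable_continuous_onI)
  moreover have "(\<lambda>x. (zratio z (polar_angle x), x)) \<in> borel_measurable borel"
    by (intro borel_measurable_Pair borel_measurable_zratio) simp
  ultimately have "(\<lambda>x. fst (zratio z (polar_angle x), x) *s cvec (snd (zratio z (polar_angle x), x))) \<in> borel_measurable borel"
    by (rule measurable_compose[rotated])
  then show ?thesis
    by (simp add: zmap_def[abs_def])
qed

end

section \<open>Holomorphic dependence on parameters\<close>

text \<open>Write \<open>z = r * u\<close> with \<open>norm u = 1\<close>. The midpoint of
  \<open>u\<close> and its conjugate is the point \<open>Re u\<close> of the interval, and its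
  distance to \<open>w\<close> is at most \<open>((r - 1) + (1 - 1 / r)) / 2\<close>.\<close>

lemma bernstein_ellipse_subset_stadium:
  assumes "1 < s"
  shows "bernstein_ellipse s \<subseteq> stadium s"
proof
  fix w assume "w \<in> bernstein_ellipse s"
  then obtain z where z: "1 \<le> norm z" "norm z \<le> s" and w: "w = (z + inverse z) / 2"
    by (auto simp: bernstein_ellipse_def)
  define r where "r = norm z"
  have r: "1 \<le> r" "r \<le> s"
    using z by (auto simp: r_def)
  have z0: "z \<noteq> 0"
    using z by auto
  define u where "u = z / of_real r"
  have u: "norm u = 1"
    using z0 by (simp add: u_def r_def norm_divide)
  have "inverse z = cnj u / of_real r"
  proof -
    have "z * (cnj u / of_real r) = 1"
      using z0 by (simp add: u_def r_def complex_norm_square[symmetric] power2_eq_square)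
    then show ?thesis
      by (rule inverse_unique)
  qed
  then have w': "w = (of_real r * u + cnj u / of_real r) / 2"
    using z0 w by (simp add: u_def r_def)
  have "of_real (Re u) = (u + cnj u) / 2"
    by (simp add: complex_add_cnj)
  moreover have "of_real (r - 1) * u = of_real r * u - u"
    "of_real (1 / r - 1) * cnj u = cnj u / of_real r - cnj u"
    by (simp_all add: left_diff_distrib)
  ultimately have "w - of_real (Re u) = (of_real (r - 1) * u + of_real (1 / r - 1) * cnj u) / 2"
    unfolding w' by (simp only: add_divide_distrib diff_divide_distrib add_diff_add)
  also have "norm \<dots> \<le> (norm (of_real (r - 1) * u) + norm (of_real (1 / r - 1) * cnj u)) / 2"
    unfolding norm_divide by (simp add: norm_triangle_ineq divide_right_mono)
  also have "norm (of_real (r - 1) * u) = r - 1"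
    unfolding norm_mult norm_of_real u using r by simp
  also have "norm (of_real (1 / r - 1) * cnj u) = 1 - 1 / r"
    unfolding norm_mult norm_of_real complex_mod_cnj u using r by simp
  \<comment> \<open>For \<open>r > 1\<close> the second summand is strictly smaller than the first;
    for \<open>r = 1\<close> both vanish and strictness comes from \<open>1 < s\<close>.\<close>
  also have "((r - 1) + (1 - 1 / r)) / 2 < s - 1"
  proof (cases "r = 1")
    case False
    then have "0 < (r - 1) * (r - 1)"
      using r by simp
    then have "1 - 1 / r < r - 1"
      using r by (simp add: field_simps)
    moreover obtain c where "1 / r = c"
      by blast
    ultimately show ?thesis
      using r by simp
  qed (use assms in simp)
  finally have dw: "dist w (of_real (Re u)) < s - 1"
    by (simp add: dist_norm)
  have mem: "of_real (Re u) \<in> complex_of_real ` {-1..1}"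
    using abs_Re_le_cmod[of u] u by (intro imageI) (auto simp: abs_le_iff)
  show "w \<in> stadium s"
    unfolding stadium_def mem_Collect_eq by (rule le_less_trans[OF infdist_le[OF mem] dw])
qed

lemma stadium_near_interval:
  assumes "z \<in> stadium s"
  obtains y :: real where "-1 \<le> y" "y \<le> 1" "cmod (z - of_real y) < s - 1"
proof -
  have "compact (complex_of_real ` {-1..1})"
    by (intro compact_continuous_image continuous_intros) auto
  then obtain x where "x \<in> complex_of_real ` {-1..1}" "infdist z (complex_of_real ` {-1..1}) = dist z x"
    using infdist_attains_inf[of "complex_of_real ` {-1..1}" z] compact_imp_closed by auto
  then show ?thesis
    using assms that by (auto simp: stadium_def dist_norm)
qed

lemma open_stadium: "open (stadium s)"
  unfolding stadium_def by (intro open_Collect_less continuous_intros)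

text \<open>Cauchy's inequality converts the bound \<open>g\<close> into a bound
  \<open>g \<xi> / r\<close> for the derivative and hence for the difference quotients; dominated
  convergence along sequences then gives the derivative of the integral.\<close>

lemma holomorphic_integral:
  fixes H :: "complex \<Rightarrow> 'a \<Rightarrow> complex"
  assumes S: "open S" and m: "\<And>w. w \<in> S \<Longrightarrow> H w \<in> borel_measurable M"
    and hol: "\<And>\<xi>. (\<lambda>w. H w \<xi>) holomorphic_on S"
    and g: "integrable M g" "\<And>w \<xi>. w \<in> S \<Longrightarrow> norm (H w \<xi>) \<le> g \<xi>"
  shows "(\<lambda>w. integral\<^sup>L M (H w)) holomorphic_on S"
  unfolding holomorphic_on_def field_differentiable_def
proof (intro ballI)
  fix w0 assume w0: "w0 \<in> S"
  obtain e where e: "0 < e" "cball w0 e \<subseteq> S"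
    using S w0 open_contains_cball by blast
  \<comment> \<open>Half the radius: discs of radius \<open>r\<close> around points of
    \<open>cball w0 r\<close> stay in \<open>S\<close>, as Cauchy's inequality needs.\<close>
  define r where "r = e / 2"
  have r: "0 < r"
    using e by (simp add: r_def)
  have sub: "cball w r \<subseteq> S" if "w \<in> cball w0 r" for w
  proof
    fix v assume "v \<in> cball w r"
    then have "dist w0 v \<le> e"
      using dist_triangle[of w0 v w] that by (simp add: r_def)
    then show "v \<in> S"
      using e by auto
  qed
  have int: "integrable M (H w)" if "w \<in> S" for w
    by (rule Bochner_Integration.integrable_bound[OF g(1) m[OF that]])
      (use g(2)[OF that] in \<open>auto intro!: AE_I2 intro: order_trans[OF _ abs_ge_self]\<close>)
  have lip: "norm (H w \<xi> - H w0 \<xi>) \<le> g \<xi> / r * norm (w - w0)" if w: "w \<in> cball w0 r" for w \<xi>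
  proof (rule field_differentiable_bound[of "cball w0 r" _ "deriv (\<lambda>w. H w \<xi>)"])
    fix v assume v: "v \<in> cball w0 r"
    have "v \<in> S"
      using sub[OF v] r by auto
    then show "((\<lambda>w. H w \<xi>) has_field_derivative deriv (\<lambda>w. H w \<xi>) v) (at v within cball w0 r)"
      using hol S holomorphic_derivI by (metis has_field_derivative_at_within)
    have "norm ((deriv ^^ 1) (\<lambda>w. H w \<xi>) v) \<le> fact 1 * g \<xi> / r ^ 1"
    proof (rule Cauchy_inequality[OF _ _ r])
      show "(\<lambda>w. H w \<xi>) holomorphic_on ball v r"
        using hol sub[OF v] ball_subset_cball holomorphic_on_subset by blast
      show "continuous_on (cball v r) (\<lambda>w. H w \<xi>)"
        using hol sub[OF v] holomorphic_on_imp_continuous_on holomorphic_on_subset by blast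
      fix x assume "norm (v - x) = r"
      then have "x \<in> cball v r"
        by (simp add: dist_norm)
      then show "norm (H x \<xi>) \<le> g \<xi>"
        using sub[OF v] g(2) by blast
    qed
    then show "norm (deriv (\<lambda>w. H w \<xi>) v) \<le> g \<xi> / r"
      by simp
  qed (use w r in auto)
  have lim: "(\<lambda>h. (H (w0 + h) \<xi> - H w0 \<xi>) / h) \<midarrow>0\<rightarrow> deriv (\<lambda>w. H w \<xi>) w0" for \<xi>
    using holomorphic_derivI[OF hol S w0, of \<xi> UNIV] by (simp add: DERIV_def)
  let ?D = "\<integral>\<xi>. deriv (\<lambda>w. H w \<xi>) w0 \<partial>M"
  have "(\<lambda>h. (integral\<^sup>L M (H (w0 + h)) - integral\<^sup>L M (H w0)) / h) \<midarrow>0\<rightarrow> ?D"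
    unfolding tendsto_at_iff_sequentially comp_def
  proof (intro allI impI)
    fix X :: "nat \<Rightarrow> complex" assume X: "\<forall>n. X n \<in> UNIV - {0}" "X \<longlonglongrightarrow> 0"
    then obtain N where N: "\<And>n. N \<le> n \<Longrightarrow> norm (X n) < r"
      using LIMSEQ_D[of X 0 r] r by auto
    define Y where "Y n = X (n + N)" for n
    have Y: "Y n \<noteq> 0" "norm (Y n) < r" for n
      using X N by (auto simp: Y_def)
    have Y0: "Y \<longlonglongrightarrow> 0"
      unfolding Y_def using X by (simp add: LIMSEQ_ignore_initial_segment)
    have w: "w0 + Y n \<in> cball w0 r" for n
      using Y(2)[of n] by (simp add: dist_norm)
    then have wS: "w0 + Y n \<in> S" for n
      using sub[of w0] r by auto
    have YL: "(\<lambda>n. (H (w0 + Y n) \<xi> - H w0 \<xi>) / Y n) \<longlonglongrightarrow> deriv (\<lambda>w. H w \<xi>) w0" for \<xi>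
      by (rule filterlim_compose[OF lim filterlim_atI[OF Y0]]) (simp add: Y)
    have Qm: "(\<lambda>\<xi>. (H (w0 + Y n) \<xi> - H w0 \<xi>) / Y n) \<in> borel_measurable M" for n
      using m[OF wS] m[OF w0] by measurable
    have "(\<lambda>n. \<integral>\<xi>. (H (w0 + Y n) \<xi> - H w0 \<xi>) / Y n \<partial>M) \<longlonglongrightarrow> ?D"
    proof (rule integral_dominated_convergence[where w = "\<lambda>\<xi>. g \<xi> / r"])
      show "(\<lambda>\<xi>. deriv (\<lambda>w. H w \<xi>) w0) \<in> borel_measurable M"
        by (rule borel_measurable_LIMSEQ_metric[OF Qm YL])
      show "AE \<xi> in M. norm ((H (w0 + Y n) \<xi> - H w0 \<xi>) / Y n) \<le> g \<xi> / r" for n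
      proof (intro AE_I2)
        fix \<xi>
        have "norm (H (w0 + Y n) \<xi> - H w0 \<xi>) \<le> g \<xi> / r * norm (Y n)"
          using lip[OF w[of n], of \<xi>] by simp
        then show "norm ((H (w0 + Y n) \<xi> - H w0 \<xi>) / Y n) \<le> g \<xi> / r"
          using Y(1)[of n] by (simp add: norm_divide divide_le_eq)
      qed
    qed (use g(1) Qm YL in auto)
    moreover have "(\<integral>\<xi>. (H (w0 + Y n) \<xi> - H w0 \<xi>) / Y n \<partial>M) =
        (integral\<^sup>L M (H (w0 + Y n)) - integral\<^sup>L M (H w0)) / Y n" for n
      using int[OF wS] int[OF w0] by simp
    ultimately have "(\<lambda>n. (integral\<^sup>L M (H (w0 + Y n)) - integral\<^sup>L M (H w0)) / Y n) \<longlonglongrightarrow> ?D"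
      by (simp only:)
    then have "(\<lambda>n. (integral\<^sup>L M (H (w0 + X (n + N))) - integral\<^sup>L M (H w0)) / X (n + N)) \<longlonglongrightarrow> ?D"
      by (simp only: Y_def)
    then show "(\<lambda>n. (integral\<^sup>L M (H (w0 + X n)) - integral\<^sup>L M (H w0)) / X n) \<longlonglongrightarrow> ?D"
      by (rule LIMSEQ_offset)
  qed
  then have "((\<lambda>w. integral\<^sup>L M (H w)) has_field_derivative ?D) (at w0)"
    by (simp add: DERIV_def)
  then show "\<exists>f'. ((\<lambda>w. integral\<^sup>L M (H w)) has_field_derivative f') (at w0 within S)"
    using has_field_derivative_at_within by blast
qed

text \<open>The closed \<open>e\<close>-neighborhood of a compact set is compact, being its sum with
  a closed ball, so continuity yields one bound for all base points \<open>c\<close>.\<close>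

lemma compact_neighborhood_bound:
  fixes f :: "'a::euclidean_space \<Rightarrow> 'b::real_normed_vector"
  assumes C: "compact C" "C \<subseteq> W" and W: "open W" "continuous_on W f"
  obtains e K where "0 < e" "0 \<le> K"
    "\<And>c v. c \<in> C \<Longrightarrow> norm (v - c) \<le> e \<Longrightarrow> v \<in> W \<and> norm (f v) \<le> K"
proof -
  obtain e where e: "0 < e" "(\<Union>x\<in>C. cball x e) \<subseteq> W"
    using compact_subset_open_imp_cball_epsilon_subset[OF C(1) W(1) C(2)] by blast
  define N where "N = {x + y |x y. x \<in> C \<and> y \<in> cball 0 e}"
  have N: "compact N"
    unfolding N_def by (intro compact_sums C compact_cball)
  have mem: "v \<in> N" if "c \<in> C" "norm (v - c) \<le> e" for c v
    unfolding N_def using that by (intro CollectI exI[of _ c] exI[of _ "v - c"]) simp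
  have "N \<subseteq> W"
  proof
    fix v assume "v \<in> N"
    then obtain x y where "v = x + y" "x \<in> C" "norm y \<le> e"
      by (auto simp: N_def)
    then have "v \<in> cball x e"
      by (simp add: dist_norm)
    then show "v \<in> W"
      using e(2) \<open>x \<in> C\<close> by blast
  qed
  then have "compact (f ` N)"
    using N W(2) compact_continuous_image continuous_on_subset by blast
  then obtain K where K: "\<And>v. v \<in> N \<Longrightarrow> norm (f v) \<le> K"
    using compact_imp_bounded by (fastforce simp: bounded_iff)
  show ?thesis
  proof (rule that[OF e(1), of "max 0 K"])
    show "v \<in> W \<and> norm (f v) \<le> max 0 K" if "c \<in> C" "norm (v - c) \<le> e" for c v
      using mem[OF that] K \<open>N \<subseteq> W\<close> by (auto simp: le_max_iff_disj)
  qed simp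
qed

text \<open>Compactness of the closure makes the supremum finite. Point evaluation is thus bounded,
  and differentiability with values in \<open>Vh\<close> can be read off pointwise.\<close>

lemma Vh_norm_ge:
  assumes "bounded D" "continuous_on (closure D) f" "\<xi> \<in> closure D"
  shows "norm (f \<xi>) \<le> Vh_norm D f"
proof -
  have "compact ((\<lambda>x. norm (f x)) ` closure D)"
    using assms by (intro compact_continuous_image continuous_on_norm) (auto simp: compact_closure)
  then have "bdd_above ((\<lambda>x. norm (f x)) ` closure D)"
    by (intro bounded_imp_bdd_above compact_imp_bounded)
  then show ?thesis
    unfolding Vh_norm_def using assms(3) by (rule cSUP_upper[rotated])
qed

lemma holomorphic_Cn_line:
  assumes "holomorphic_Cn f W" "a + w *s c \<in> W"
  shows "(\<lambda>w. f (a + w *s c)) field_differentiable (at w)"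
proof -
  obtain f' where f': "(f has_derivative f') (at (a + w *s c))" "\<And>k v. f' (k *s v) = k * f' v"
    using assms unfolding holomorphic_Cn_def by blast
  have "((\<lambda>w. a + w *s c) has_derivative (\<lambda>h. h *s c)) (at w)"
    using has_derivative_add[OF has_derivative_const
        bounded_linear_imp_has_derivative[OF bounded_linear_scalar_left]] by simp
  then have "((\<lambda>w. f (a + w *s c)) has_derivative (\<lambda>h. f' (h *s c))) (at w)"
    by (rule has_derivative_compose) (rule f'(1))
  then have "((\<lambda>w. f (a + w *s c)) has_field_derivative f' c) (at w)"
    by (simp add: has_field_derivative_def f'(2) mult_commute_abs)
  then show ?thesis
    by (auto simp: field_differentiable_def)
qed

lemma holomorphic_Cn_continuous_on: "holomorphic_Cn f W \<Longrightarrow> continuous_on W f"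
  unfolding holomorphic_Cn_def
  by (meson continuous_at_imp_continuous_on has_derivative_continuous)

text \<open>The terms tend to zero, so eventually \<open>b j < 1\<close>, and then
  \<open>b j \<le> b j powr p\<close>.\<close>

lemma summable_of_summable_p:
  assumes "summable_p p b" "0 < p" "p < 1" "\<And>j. 0 \<le> b j"
  shows "summable b"
proof -
  have s: "summable (\<lambda>j. b j powr p)"
    using assms by (simp add: summable_p_def)
  then have "(\<lambda>j. b j powr p) \<longlonglongrightarrow> 0"
    by (rule summable_LIMSEQ_zero)
  then have "eventually (\<lambda>j. b j powr p < 1) sequentially"
    by (rule order_tendstoD) simp
  then have "eventually (\<lambda>j. norm (b j) \<le> b j powr p) sequentially"
  proof eventually_elim
    case (elim j)
    show ?case
    proof (cases "b j = 0")
      case False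
      then have "0 < b j"
        using assms(4)[of j] by simp
      have "b j < 1"
      proof (rule ccontr)
        assume "\<not> b j < 1"
        then have "1 \<le> b j powr p"
          using assms(2) by (simp add: ge_one_powr_ge_zero)
        with elim show False
          by simp
      qed
      have "b j powr 1 \<le> b j powr p"
        using \<open>0 < b j\<close> \<open>b j < 1\<close> assms(3) by (intro powr_mono') auto
      then show ?thesis
        using \<open>0 < b j\<close> by simp
    qed simp
  qed
  then show ?thesis
    by (rule summable_comparison_test_ev[OF _ s])
qed

section \<open>The Newton potential\<close>

text \<open>The squared distance continued without conjugation: a polynomial in the entries of
  \<open>v\<close>, hence holomorphic.\<close>

definition dist_sq :: "real^2 \<Rightarrow> complex^2 \<Rightarrow> complex" where
  "dist_sq x v = (of_real (x $ 1) - v $ 1)\<^sup>2 + (of_real (x $ 2) - v $ 2)\<^sup>2"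

lemma continuous_dist_sq: "continuous_on A (dist_sq x)"
  unfolding dist_sq_def[abs_def] by (intro continuous_intros)

lemma dist_sq_cvec: "dist_sq x (cvec y) = of_real ((norm (x - y))\<^sup>2)"
  by (simp add: dist_sq_def cvec_def norm_real2 cmod_def)

lemma open_dist_sq: "open {v. 0 < Re (dist_sq x v)}"
  by (intro open_Collect_less continuous_on_Re continuous_dist_sq continuous_intros)

lemma continuous_green_dist_sq:
  assumes "0 < \<kappa>\<^sub>0"
  shows "continuous_on {v. 0 < Re (dist_sq x v)} (\<lambda>v. green_sq \<kappa>\<^sub>0 (dist_sq x v))"
  by (rule continuous_on_compose2[OF holomorphic_on_imp_continuous_on[OF holomorphic_green_sq[OF assms]]
        continuous_dist_sq]) auto

lemma green_dist_sq_line: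
  assumes "0 < \<kappa>\<^sub>0" "0 < Re (dist_sq x (a + w *s c))"
  shows "(\<lambda>w. green_sq \<kappa>\<^sub>0 (dist_sq x (a + w *s c))) field_differentiable (at w)"
proof -
  have "(\<lambda>w. dist_sq x (a + w *s c)) field_differentiable (at w)"
    unfolding dist_sq_def vector_add_component vector_smult_component
    by (intro derivative_intros)
  moreover have "open {s. 0 < Re s}"
    by (intro open_Collect_less continuous_intros)
  then have "green_sq \<kappa>\<^sub>0 field_differentiable (at (dist_sq x (a + w *s c)))"
    using holomorphic_on_imp_differentiable_at[OF holomorphic_green_sq[OF assms(1)]] assms(2) by blast
  ultimately show ?thesis
    using field_differentiable_compose by (fastforce simp: o_def)
qed

context radial_family
begin

section \<open>A compact set that contains all transformed domains\<close>

definition outer_radius :: "real \<Rightarrow> real" where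
  "outer_radius t = \<rho>h t + (\<Sum>j. \<bar>\<rho> j t\<bar>)"

text \<open>Unlike in \<open>polar_body\<close>, the angle \<open>2 * pi\<close> is included: the
  parameter set is then closed and bounded, and the body is compact as its continuous image.\<close>

definition outer_body :: "(real^2) set" where
  "outer_body = (\<lambda>p. fst p *\<^sub>R vector [cos (snd p), sin (snd p)]) `
     {p. 0 \<le> fst p \<and> fst p \<le> outer_radius (snd p) \<and> 0 \<le> snd p \<and> snd p \<le> 2 * pi}"

lemma summable_abs_rho: "summable (\<lambda>j. \<bar>\<rho> j t\<bar>)"
  by (rule summable_comparison_test'[OF summable_b, of 0]) (simp add: rho_le)

lemma continuous_outer_radius: "continuous_on A outer_radius"
proof -
  have "\<bar>(\<Sum>j. \<bar>\<rho> j s\<bar>) - (\<Sum>j. \<bar>\<rho> j t\<bar>)\<bar> \<le> suminf b * \<bar>s - t\<bar>" for s t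
  proof -
    have "norm (\<Sum>j. \<bar>\<rho> j s\<bar> - \<bar>\<rho> j t\<bar>) \<le> (\<Sum>j. b j * \<bar>s - t\<bar>)"
    proof (rule norm_suminf_le)
      show "norm (\<bar>\<rho> j s\<bar> - \<bar>\<rho> j t\<bar>) \<le> b j * \<bar>s - t\<bar>" for j
        using rho_lip[of j s t] by (simp add: order_trans[OF abs_triangle_ineq3])
    qed (intro summable_mult2 summable_b)
    then show ?thesis
      by (simp add: suminf_diff[OF summable_abs_rho summable_abs_rho, symmetric]
          suminf_mult2[OF summable_b, symmetric])
  qed
  moreover have "0 \<le> suminf b"
    by (intro suminf_nonneg summable_b b_nonneg)
  ultimately have "(suminf b)-lipschitz_on A (\<lambda>t. \<Sum>j. \<bar>\<rho> j t\<bar>)"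
    by (intro lipschitz_onI) (auto simp: dist_real_def)
  then show ?thesis
    unfolding outer_radius_def[abs_def]
    by (intro continuous_on_add continuous_rhoh lipschitz_on_continuous_on)
qed

lemma compact_outer_body: "compact outer_body"
  unfolding outer_body_def
proof (rule compact_continuous_image)
  have "vector [cos s, sin s] = cos s *\<^sub>R axis 1 1 + sin s *\<^sub>R (axis 2 1 :: real^2)" for s
    by (simp add: vec_eq_iff forall_2 axis_def)
  then show "continuous_on A (\<lambda>p :: real \<times> real. fst p *\<^sub>R (vector [cos (snd p), sin (snd p)] :: real^2))" for A
    by (simp only:) (intro continuous_intros)
  let ?S = "{p. 0 \<le> fst p \<and> fst p \<le> outer_radius (snd p) \<and> 0 \<le> snd p \<and> snd p \<le> 2 * pi}"
  have c: "continuous_on UNIV (\<lambda>p :: real \<times> real. outer_radius (snd p))"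
    by (rule continuous_on_compose2[OF continuous_outer_radius]) (auto intro: continuous_intros)
  have "closed ?S"
    by (intro closed_Collect_conj closed_Collect_le c continuous_intros)
  moreover have "?S \<subseteq> {0..rmax + suminf b} \<times> {0..2 * pi}"
  proof -
    have *: "outer_radius t \<le> rmax + suminf b" for t
      unfolding outer_radius_def
      by (intro add_mono rhoh_bounds suminf_le summable_abs_rho summable_b rho_le)
    then show ?thesis
      by (auto intro!: order_trans[OF _ *])
  qed
  then have "bounded ?S"
    by (rule bounded_subset[rotated]) (intro bounded_Times bounded_closed_interval)
  ultimately show "compact ?S"
    by (simp add: compact_eq_bounded_closed)
qed

text \<open>Supplies the uniformity in \<open>y\<close>: the compact set on the right does not
  depend on the parameter.\<close>

lemma affine_in_outer_body:
  assumes y: "y \<in> param_cube" and \<xi>: "\<xi> \<in> D" and pos: "0 \<le> param_radius \<rho>h \<rho> y (polar_angle \<xi>)"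
  shows "affine_transformation \<rho>h \<rho> y \<xi> \<in> outer_body"
proof -
  let ?t = "polar_angle \<xi>"
  have "(\<Sum>j. y j * \<rho> j ?t) \<le> (\<Sum>j. \<bar>\<rho> j ?t\<bar>)"
  proof (intro suminf_le summable_real_coeff y summable_abs_rho)
    show "y j * \<rho> j ?t \<le> \<bar>\<rho> j ?t\<bar>" for j
      using mult_right_mono[OF param_cube_abs_le[OF y, of j] abs_ge_zero[of "\<rho> j ?t"]]
      by (simp flip: abs_mult add: abs_le_iff)
  qed
  then have le: "param_radius \<rho>h \<rho> y ?t \<le> outer_radius ?t"
    by (simp add: param_radius_def outer_radius_def)
  let ?s = "param_radius \<rho>h \<rho> y ?t * (norm \<xi> / \<rho>h ?t)"
  have "norm \<xi> / \<rho>h ?t \<le> 1"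
    using D_le[OF \<xi>] rhoh_pos[of ?t] by simp
  then have "?s \<le> param_radius \<rho>h \<rho> y ?t"
    using pos rhoh_pos[of ?t] by (intro mult_right_le_one_le) auto
  then have "0 \<le> ?s \<and> ?s \<le> outer_radius ?t"
    using le pos rhoh_pos[of ?t] by (auto intro!: mult_nonneg_nonneg)
  moreover have "affine_transformation \<rho>h \<rho> y \<xi> = ?s *\<^sub>R vector [cos ?t, sin ?t]"
    unfolding affine_transformation_def
    by (subst (3) polar_decomposition) (simp add: field_simps)
  ultimately show ?thesis
    unfolding outer_body_def
    by (intro image_eqI[of _ _ "(?s, ?t)"]) (auto simp: polar_angle_bounds less_imp_le)
qed

text \<open>At each angle the largest radius is attained by the parameters \<open>y\<^sub>j = sgn (\<rho>\<^sub>j(t))\<close>.\<close>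

lemma notin_outer_body:
  assumes "\<And>y. y \<in> param_cube \<Longrightarrow> x \<notin> polar_body (param_radius \<rho>h \<rho> y)"
  shows "x \<notin> outer_body"
proof
  assume "x \<in> outer_body"
  then obtain s t0 where st: "x = s *\<^sub>R vector [cos t0, sin t0]" "0 \<le> s" "s \<le> outer_radius t0"
      "0 \<le> t0" "t0 \<le> 2 * pi"
    by (auto simp: outer_body_def)
  \<comment> \<open>\<open>polar_body\<close> uses angles below \<open>2 * pi\<close>; the end point
    is moved to 0, where point and radius are the same.\<close>
  define t where "t = (if t0 = 2 * pi then 0 else t0)"
  have per: "outer_radius (2 * pi) = outer_radius 0"
    using rho_per[of _ 0] rhoh_per[of 0] by (simp add: outer_radius_def)
  have t: "x = s *\<^sub>R vector [cos t, sin t]" "s \<le> outer_radius t" "0 \<le> t" "t < 2 * pi"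
    using st per by (auto simp: t_def)
  define y where "y j = sgn (\<rho> j t)" for j
  have "y \<in> param_cube"
    by (auto simp: param_cube_def y_def sgn_real_def)
  moreover have "param_radius \<rho>h \<rho> y t = outer_radius t"
    by (simp add: param_radius_def outer_radius_def y_def abs_sgn mult.commute)
  ultimately show False
    using assms t st(2) by (auto simp: polar_body_def)
qed

text \<open>Since \<open>q\<close> is constant on rays, the inverse of the transformation is
  division by \<open>q\<close>. Composed with it, \<open>k\<close> is a Borel function that agrees
  almost everywhere with the integrand cut off to the image, which also supplies the measurability
  of the latter.\<close>

lemma integral_affine_image:
  fixes f k :: "real^2 \<Rightarrow> complex"
  assumes y: "y \<in> param_cube" and pos: "0 < lo" "\<And>t. lo \<le> param_radius \<rho>h \<rho> y t"
    and le: "\<And>t. param_radius \<rho>h \<rho> y t \<le> rmax"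
    and k [measurable]: "k \<in> borel_measurable borel"
    and f: "\<And>\<xi>. k \<xi> \<noteq> 0 \<Longrightarrow> \<xi> \<in> D"
    and AE: "AE \<eta> in lebesgue. \<forall>\<xi>\<in>D. \<eta> = affine_transformation \<rho>h \<rho> y \<xi> \<longrightarrow> f \<eta> = k \<xi>"
  shows "(LINT \<eta>:affine_transformation \<rho>h \<rho> y ` D|lebesgue. f \<eta>) =
    (LINT \<xi>|lborel. (zratio (\<lambda>j. of_real (y j)) (polar_angle \<xi>))\<^sup>2 * k \<xi>)"
proof -
  let ?r = "affine_transformation \<rho>h \<rho> y"
  define q where "q \<xi> = param_radius \<rho>h \<rho> y (polar_angle \<xi>) / \<rho>h (polar_angle \<xi>)" for \<xi>
  have qz: "zratio (\<lambda>j. of_real (y j)) (polar_angle \<xi>) = of_real (q \<xi>)" for \<xi>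
    by (simp add: zratio_real[OF y] q_def)
  have r: "?r \<xi> = q \<xi> *\<^sub>R \<xi>" for \<xi>
    by (simp add: affine_transformation_def q_def)
  have q_borel [measurable]: "q \<in> borel_measurable borel"
  proof -
    have "(\<lambda>\<xi>. Re (zratio (\<lambda>j. of_real (y j)) (polar_angle \<xi>))) \<in> borel_measurable borel"
      by measurable
    then show ?thesis
      by (simp add: qz[abs_def])
  qed
  have hom: "q (c *\<^sub>R \<xi>) = q \<xi>" if "0 < c" for c \<xi>
    by (simp add: q_def polar_angle_scaleR[OF that])
  have rmax: "0 < rmax"
    using rhoh_bounds(3)[of 0] rhoh_pos[of 0] by linarith
  have low: "0 < lo / rmax"
    using pos rmax by simp
  have q_low: "lo / rmax \<le> q \<xi>" for \<xi>
    unfolding q_def using pos rhoh_bounds(3) rhoh_pos order_trans[OF less_imp_le[OF pos(1)] pos(2)]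
    by (intro frac_le) auto
  have q_up: "q \<xi> \<le> rmax / rmin" for \<xi>
    unfolding q_def using le rhoh_bounds rmax by (intro frac_le) auto
  have q_pos: "0 < q \<xi>" for \<xi>
    using low q_low[of \<xi>] by linarith
  define s where "s \<eta> = (1 / q \<eta>) *\<^sub>R \<eta>" for \<eta>
  have sr: "s (q \<xi> *\<^sub>R \<xi>) = \<xi>" for \<xi>
    using q_pos[of \<xi>] hom[OF q_pos, of \<xi> \<xi>] by (simp add: s_def)
  have rs: "?r (s \<eta>) = \<eta>" for \<eta>
  proof -
    have "q (s \<eta>) = q \<eta>"
      unfolding s_def by (rule hom) (use q_pos[of \<eta>] in simp)
    then show ?thesis
      using q_pos[of \<eta>] unfolding r by (simp add: s_def)
  qed
  have ks [measurable]: "(\<lambda>\<eta>. k (s \<eta>)) \<in> borel_measurable borel"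
    unfolding s_def by measurable
  have AE': "AE \<eta> in lebesgue. k (s \<eta>) = indicator (?r ` D) \<eta> *\<^sub>R f \<eta>"
    using AE
  proof eventually_elim
    case (elim \<eta>)
    show ?case
    proof (cases "\<eta> \<in> ?r ` D")
      case True
      then obtain \<xi> where \<xi>: "\<xi> \<in> D" "\<eta> = ?r \<xi>"
        by blast
      then have "s \<eta> = \<xi>"
        using sr by (simp add: r)
      then show ?thesis
        using \<xi> elim by auto
    next
      case False
      then have "s \<eta> \<notin> D"
        using rs[of \<eta>] by force
      then have "k (s \<eta>) = 0"
        using f by blast
      then show ?thesis
        using False by simp
    qed
  qed
  have km: "(\<lambda>\<eta>. k (s \<eta>)) \<in> borel_measurable lebesgue"
    using ks by (simp add: measurable_completion)
  have "(LINT \<eta>:?r ` D|lebesgue. f \<eta>) = (LINT \<eta>|lebesgue. k (s \<eta>))"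
    unfolding set_lebesgue_integral_def
    by (rule integral_cong_AE[symmetric, OF km borel_measurable_AE[OF km AE'] AE'])
  also have "\<dots> = (LINT \<eta>|lborel. k (s \<eta>))"
    using ks by (simp add: integral_completion)
  also have "\<dots> = (LINT \<xi>|lborel. (q \<xi> ^ DIM(real^2)) *\<^sub>R k (s (q \<xi> *\<^sub>R \<xi>)))"
    by (rule integral_radial[OF q_borel hom low q_low q_up ks])
  also have "\<dots> = (LINT \<xi>|lborel. (zratio (\<lambda>j. of_real (y j)) (polar_angle \<xi>))\<^sup>2 * k \<xi>)"
    by (simp only: sr qz) (simp add: scaleR_conv_of_real[where 'a = complex])
  finally show ?thesis .
qed

end

text \<open>Treats one subdomain \<open>P\<close>. \<open>\<Phi>\<close> stands for the extended
  product of Green function and contrast, \<open>U\<close> for the extended discrete solution; the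
  bounds are asked for at parameters near the cube only.\<close>

locale newton_piece = radial_family +
  fixes \<epsilon> K B :: real and P :: "(real^2) set" and W :: "(complex^2) set"
    and \<Phi> :: "complex^2 \<Rightarrow> complex" and U :: "(real^2 \<Rightarrow> complex^2) \<Rightarrow> real^2 \<Rightarrow> complex"
    and \<T> :: "(real^2) set set"
  assumes P: "open P" "P \<subseteq> D" and K: "0 \<le> K" and B: "0 \<le> B"
    and basis_W1inf: "\<And>j. basis_field j \<in> W1inf D"
    and W: "open W" "continuous_on W \<Phi>"
    and \<Phi>_line: "\<And>a w c. a + w *s c \<in> W \<Longrightarrow> (\<lambda>w. \<Phi> (a + w *s c)) field_differentiable (at w)"
    and near_\<Phi>: "\<And>z y \<xi>. near \<epsilon> z y \<Longrightarrow> \<xi> \<in> P \<Longrightarrow> zmap z \<xi> \<in> W \<and> norm (\<Phi> (zmap z \<xi>)) \<le> K"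
    and near_Vh: "\<And>z y. near \<epsilon> z y \<Longrightarrow> U (zmap z) \<in> Vh D \<T>"
    and near_U: "\<And>z y \<xi>. near \<epsilon> z y \<Longrightarrow> \<xi> \<in> D \<Longrightarrow> norm (U (zmap z) \<xi>) \<le> B"
    and near_frechet: "\<And>z y. near \<epsilon> z y \<Longrightarrow> frechet_differentiable_W1inf D \<T> U (zmap z)"
begin

definition integrand :: "(nat \<Rightarrow> complex) \<Rightarrow> real^2 \<Rightarrow> complex" where
  "integrand z \<xi> = \<Phi> (zmap z \<xi>) * (zratio z (polar_angle \<xi>))\<^sup>2 * U (zmap z) \<xi>"

definition integrand_bound :: real where
  "integrand_bound = K * ((rmax + (\<epsilon> + suminf b)) / rmin)\<^sup>2 * B"

text \<open>Continuity of \<open>\<Phi>\<close> is known on \<open>W\<close> only; cut off by the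
  indicator of \<open>W\<close> it is Borel, and nothing changes over \<open>P\<close> because
  \<open>zmap z\<close> maps \<open>P\<close> into \<open>W\<close>.\<close>

lemma piece_factor_measurable:
  assumes "near \<epsilon> z y"
  shows "(\<lambda>\<xi>. indicator P \<xi> *\<^sub>R (\<Phi> (zmap z \<xi>) * U (zmap z) \<xi>)) \<in> borel_measurable borel"
proof -
  have "(\<lambda>v. indicator W v *\<^sub>R \<Phi> v) \<in> borel_measurable borel"
    using W by (intro borel_measurable_continuous_on_indicator) auto
  from measurable_compose[OF borel_measurable_zmap this]
  have "(\<lambda>\<xi>. indicator W (zmap z \<xi>) *\<^sub>R \<Phi> (zmap z \<xi>)) \<in> borel_measurable borel" .
  moreover have "continuous_on P (U (zmap z))"
    using near_Vh[OF assms] P closure_subset[of D] by (auto simp: Vh_def intro: continuous_on_subset)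
  then have "(\<lambda>\<xi>. indicator P \<xi> *\<^sub>R U (zmap z) \<xi>) \<in> borel_measurable borel"
    using P by (intro borel_measurable_continuous_on_indicator) auto
  ultimately have "(\<lambda>\<xi>. (indicator W (zmap z \<xi>) *\<^sub>R \<Phi> (zmap z \<xi>)) * (indicator P \<xi> *\<^sub>R U (zmap z) \<xi>)) \<in> borel_measurable borel"
    by (rule borel_measurable_times)
  moreover have "(indicator W (zmap z \<xi>) *\<^sub>R \<Phi> (zmap z \<xi>)) * (indicator P \<xi> *\<^sub>R U (zmap z) \<xi>) =
      indicator P \<xi> *\<^sub>R (\<Phi> (zmap z \<xi>) * U (zmap z) \<xi>)" for \<xi>
    using near_\<Phi>[OF assms, of \<xi>] by (auto simp: indicator_def)
  ultimately show ?thesis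
    by (simp only:)
qed

lemma integrand_measurable:
  assumes "near \<epsilon> z y"
  shows "(\<lambda>\<xi>. indicator P \<xi> *\<^sub>R integrand z \<xi>) \<in> borel_measurable borel"
proof -
  have "(\<lambda>\<xi>. (zratio z (polar_angle \<xi>))\<^sup>2 * (indicator P \<xi> *\<^sub>R (\<Phi> (zmap z \<xi>) * U (zmap z) \<xi>))) \<in> borel_measurable borel"
    using piece_factor_measurable[OF assms] by measurable
  then show ?thesis
    by (simp add: integrand_def mult_ac)
qed

lemma integrand_norm_le:
  assumes "near \<epsilon> z y"
  shows "norm (indicator P \<xi> *\<^sub>R integrand z \<xi>) \<le> indicator P \<xi> * integrand_bound"
proof (cases "\<xi> \<in> P")
  case True
  have "norm (integrand z \<xi>) \<le> K * ((rmax + (\<epsilon> + suminf b)) / rmin)\<^sup>2 * B"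
    unfolding integrand_def norm_mult norm_power
    using near_\<Phi>[OF assms True] near_zratio_le[OF assms, of "polar_angle \<xi>"] near_U[OF assms, of \<xi>] True P K B
    by (intro mult_mono power_mono mult_nonneg_nonneg) auto
  then show ?thesis
    using True by (simp add: integrand_bound_def)
qed simp

lemma indicator_integrable: "integrable lebesgue (\<lambda>\<xi>. indicator P \<xi> * c :: real)"
  using lmeasurable_open[OF bounded_subset[OF bounded_D P(2)] P(1)]
  by (intro integrable_mult_left) (auto simp: fmeasurable_def integrable_real_indicator)

lemma integrand_integrable:
  assumes "near \<epsilon> z y"
  shows "integrable lebesgue (\<lambda>\<xi>. indicator P \<xi> *\<^sub>R integrand z \<xi>)"
  by (rule Bochner_Integration.integrable_bound[OF indicator_integrable[of integrand_bound]])
    (use integrand_measurable[OF assms] order_trans[OF integrand_norm_le[OF assms] abs_ge_self]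
      in \<open>auto simp: measurable_completion\<close>)

lemma integrand_integral_le:
  assumes "near \<epsilon> z y"
  shows "norm (LINT \<xi>:P|lebesgue. integrand z \<xi>) \<le> (LINT \<xi>|lebesgue. indicator P \<xi> * integrand_bound)"
  unfolding set_lebesgue_integral_def
proof (rule Bochner_Integration.integral_norm_bound_integral)
  show "integrable lebesgue (\<lambda>\<xi>. indicator P \<xi> *\<^sub>R integrand z \<xi>)"
    by (rule integrand_integrable[OF assms])
qed (rule indicator_integrable, rule integrand_norm_le[OF assms])

text \<open>Moving one parameter moves \<open>zmap\<close> along a complex line in direction
  \<open>F\<close>, so the derivative is the Frechet derivative applied to \<open>F\<close>,
  evaluated at \<open>\<xi>\<close>.\<close>

lemma U_field_differentiable:
  assumes S: "open S" "z k \<in> S" "\<And>w. w \<in> S \<Longrightarrow> \<exists>y. near \<epsilon> (z(k := w)) y" and \<xi>: "\<xi> \<in> D"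
  shows "(\<lambda>w. U (zmap (z(k := w))) \<xi>) field_differentiable (at (z k))"
proof -
  obtain y where near: "near \<epsilon> z y"
    using S(3)[OF S(2)] by auto
  define F where "F = (\<lambda>x. cvec (basis_field k x))"
  have upd: "zmap (z(k := z k + c)) = (\<lambda>x. zmap z x + c *s F x)" for c
    using zmap_upd[OF near_summable[OF near]] by (simp add: fun_eq_iff F_def)
  obtain L where L0: "(\<forall>w\<in>W1inf D. L w \<in> Vh D \<T>) \<and>
     (\<forall>w\<in>W1inf D. \<forall>w'\<in>W1inf D. L (\<lambda>x. w x + w' x) = (\<lambda>x. L w x + L w' x)) \<and>
     (\<forall>c. \<forall>w\<in>W1inf D. L (\<lambda>x. c *s w x) = (\<lambda>x. c * L w x)) \<and>
     (\<exists>C. \<forall>w\<in>W1inf D. Vh_norm D (L w) \<le> C * W1inf_norm D w) \<and>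
     (\<forall>e>0. \<exists>\<eta>>0. \<forall>w\<in>W1inf D. W1inf_norm D w < \<eta> \<longrightarrow>
        Vh_norm D (\<lambda>x. U (\<lambda>t. zmap z t + w t) x - U (zmap z) x - L w x) \<le> e * W1inf_norm D w)"
    using near_frechet[OF near] unfolding frechet_differentiable_W1inf_def by (elim exE) (rule that)
  note L = L0[THEN conjunct1, rule_format] L0[THEN conjunct2, THEN conjunct2, THEN conjunct1, rule_format]
    L0[THEN conjunct2, THEN conjunct2, THEN conjunct2, THEN conjunct2, THEN spec, THEN mp]
  have cF: "(\<lambda>x. c *s F x) \<in> W1inf D" for c
    unfolding F_def by (rule scaled_W1inf[OF basis_W1inf])
  have F: "F \<in> W1inf D"
    using cF[of 1] by simp
  \<comment> \<open>The summand 1 keeps \<open>N\<close> positive even if \<open>b k = 0\<close>,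
    since \<open>N\<close> occurs as a divisor below.\<close>
  define N where "N = nbhd_const * b k + 1"
  have N: "0 < N"
    using nbhd_const_pos b_nonneg[of k] by (simp add: N_def add_nonneg_pos)
  have cF_norm: "W1inf_norm D (\<lambda>x. c *s F x) \<le> N * cmod c" for c
    unfolding F_def
    by (rule order_trans[OF scaled_W1inf_norm[OF basis_W1inf]]) (simp add: N_def algebra_simps)
  obtain d1 where d1: "0 < d1" "ball (z k) d1 \<subseteq> S"
    using S open_contains_ball by blast
  have cl: "\<xi> \<in> closure D"
    using \<xi> closure_subset by blast
  have "(\<lambda>c. (U (zmap (z(k := z k + c))) \<xi> - U (zmap (z(k := z k))) \<xi>) / c) \<midarrow>0\<rightarrow> L F \<xi>"
  proof (rule LIM_I)
    fix e :: real assume e: "0 < e"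
    \<comment> \<open>The factor 2 leaves room for a strict inequality at the end.\<close>
    then have "0 < e / (2 * N)"
      using N by simp
    from L(3)[OF this] obtain \<eta> where \<eta>: "0 < \<eta>" "\<And>w. w \<in> W1inf D \<Longrightarrow> W1inf_norm D w < \<eta> \<Longrightarrow>
        Vh_norm D (\<lambda>x. U (\<lambda>t. zmap z t + w t) x - U (zmap z) x - L w x) \<le> e / (2 * N) * W1inf_norm D w"
      by blast
    show "\<exists>s>0. \<forall>c. c \<noteq> 0 \<and> norm (c - 0) < s \<longrightarrow>
        norm ((U (zmap (z(k := z k + c))) \<xi> - U (zmap (z(k := z k))) \<xi>) / c - L F \<xi>) < e"
    proof (intro exI[of _ "min d1 (\<eta> / N)"] conjI allI impI)
      show "0 < min d1 (\<eta> / N)"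
        using d1 \<eta> N by simp
      fix c :: complex assume "c \<noteq> 0 \<and> norm (c - 0) < min d1 (\<eta> / N)"
      then have c: "c \<noteq> 0" "norm c < d1" "N * norm c < \<eta>"
        using N by (auto simp: field_simps)
      then have "z k + c \<in> S"
        using d1 by (auto simp: dist_norm)
      then obtain y' where near': "near \<epsilon> (z(k := z k + c)) y'"
        using S(3) by blast
      let ?f = "\<lambda>x. U (\<lambda>t. zmap z t + c *s F t) x - U (zmap z) x - L (\<lambda>x. c *s F x) x"
      have "continuous_on (closure D) ?f"
        using near_Vh[OF near'] near_Vh[OF near] L(1)[OF cF[of c]] unfolding upd
        by (intro continuous_on_diff) (auto simp: Vh_def)
      then have "norm (?f \<xi>) \<le> Vh_norm D ?f"
        by (rule Vh_norm_ge[OF bounded_D _ cl])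
      also have "\<dots> \<le> e / (2 * N) * W1inf_norm D (\<lambda>x. c *s F x)"
        using cF_norm[of c] c(3) by (intro \<eta>(2) cF) simp
      also have "\<dots> \<le> e / (2 * N) * (N * norm c)"
        using cF_norm e N by (intro mult_left_mono) auto
      also have "\<dots> < e * norm c"
        using e N c(1) by simp
      finally have "norm (?f \<xi>) < e * norm c" .
      moreover have "?f \<xi> = U (zmap (z(k := z k + c))) \<xi> - U (zmap (z(k := z k))) \<xi> - c * L F \<xi>"
        unfolding upd L(2)[OF F] by simp
      ultimately have "norm (U (zmap (z(k := z k + c))) \<xi> - U (zmap (z(k := z k))) \<xi> - c * L F \<xi>) / norm c < e"
        using c(1) by (simp add: divide_less_eq)
      then show "norm ((U (zmap (z(k := z k + c))) \<xi> - U (zmap (z(k := z k))) \<xi>) / c - L F \<xi>) < e"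
        using c(1) by (simp add: diff_divide_distrib flip: norm_divide)
    qed
  qed
  then have "((\<lambda>w. U (zmap (z(k := w))) \<xi>) has_field_derivative L F \<xi>) (at (z k))"
    by (simp add: DERIV_def)
  then show ?thesis
    by (auto simp: field_differentiable_def)
qed

lemma integrand_field_differentiable:
  assumes S: "open S" "z k \<in> S" "\<And>w. w \<in> S \<Longrightarrow> \<exists>y. near \<epsilon> (z(k := w)) y" and \<xi>: "\<xi> \<in> P"
  shows "(\<lambda>w. integrand (z(k := w)) \<xi>) field_differentiable (at (z k))"
proof -
  obtain y where near: "near \<epsilon> z y"
    using S(3)[OF S(2)] by auto
  let ?v = "cvec (basis_field k \<xi>)"
  have zm: "zmap (z(k := w)) \<xi> = (zmap z \<xi> - z k *s ?v) + w *s ?v" for w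
    using zmap_upd[OF near_summable[OF near]] by (simp add: vector_sub_rdistrib)
  have "(\<lambda>w. \<Phi> ((zmap z \<xi> - z k *s ?v) + w *s ?v)) field_differentiable (at (z k))"
    by (rule \<Phi>_line) (use near_\<Phi>[OF near \<xi>] in simp)
  then have "(\<lambda>w. \<Phi> (zmap (z(k := w)) \<xi>)) field_differentiable (at (z k))"
    by (simp only: zm)
  moreover have "(\<lambda>w. zratio (z(k := w)) (polar_angle \<xi>)) field_differentiable (at (z k))"
    unfolding zratio_upd[OF near_summable[OF near]] by (intro derivative_intros)
  moreover have "(\<lambda>w. U (zmap (z(k := w))) \<xi>) field_differentiable (at (z k))"
    using \<xi> P by (intro U_field_differentiable[OF S]) auto
  ultimately show ?thesis
    unfolding integrand_def by (intro field_differentiable_mult field_differentiable_power)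
qed

lemma integrand_integral_holomorphic:
  assumes S: "open S" "\<And>w. w \<in> S \<Longrightarrow> \<exists>y. near \<epsilon> (z(k := w)) y"
  shows "(\<lambda>w. LINT \<xi>:P|lebesgue. integrand (z(k := w)) \<xi>) holomorphic_on S"
  unfolding set_lebesgue_integral_def
proof (rule holomorphic_integral[OF S(1) _ _ indicator_integrable])
  show "(\<lambda>\<xi>. indicator P \<xi> *\<^sub>R integrand (z(k := w)) \<xi>) \<in> borel_measurable lebesgue" if "w \<in> S" for w
    using S(2)[OF that] integrand_measurable by (auto simp: measurable_completion)
  show "norm (indicator P \<xi> *\<^sub>R integrand (z(k := w)) \<xi>) \<le> indicator P \<xi> * integrand_bound" if "w \<in> S" for w \<xi>
    using S(2)[OF that] integrand_norm_le by blast
  show "(\<lambda>w. indicator P \<xi> *\<^sub>R integrand (z(k := w)) \<xi>) holomorphic_on S" for \<xi>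
  proof (cases "\<xi> \<in> P")
    case True
    have "(\<lambda>w. integrand (z(k := w)) \<xi>) field_differentiable (at w)" if "w \<in> S" for w
      using integrand_field_differentiable[of S "z(k := w)" k \<xi>] S that True by simp
    then show ?thesis
      using True by (auto simp: holomorphic_on_def intro: field_differentiable_at_within)
  qed simp
qed

end

section \<open>Assembly of the subdomains\<close>

lemma polar_body_norm_le:
  assumes "x \<in> polar_body \<rho>h" "\<And>t. 0 < \<rho>h t"
  shows "norm x \<le> \<rho>h (polar_angle x)"
proof -
  obtain s t where st: "x = s *\<^sub>R vector [cos t, sin t]" "0 \<le> s" "s \<le> \<rho>h t" "0 \<le> t" "t < 2 * pi"
    using assms(1) by (auto simp: polar_body_def)
  show ?thesis
  proof (cases "s = 0")
    case False
    then show ?thesis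
      using st polar_angle_polar[of s t] by (simp add: norm_direction)
  qed (use st assms(2) in \<open>simp add: less_imp_le\<close>)
qed

lemma negligible_AE: "negligible N \<Longrightarrow> AE x in lebesgue. x \<notin> N"
  by (simp add: AE_not_in negligible_iff_null_sets)

text \<open>Restricting to \<open>0 < Re (dist_sq x v)\<close> keeps the Green function holomorphic,
  and the real points of the body satisfy this because \<open>x\<close> lies outside. The bounds
  hold around the closure of \<open>E\<close>, the identity with \<open>\<kappa>\<close> only almost
  everywhere in \<open>E\<close> itself.\<close>

lemma green_contrast_extension:
  fixes x :: "real^2"
  assumes \<kappa>\<^sub>0: "0 < \<kappa>\<^sub>0" and body: "compact body" "x \<notin> body" and E: "bounded E"
    and W: "open W" "cvec ` closure E \<subseteq> W" and g: "holomorphic_Cn g W"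
    and AE: "AE \<eta>\<in>E in lebesgue. g (cvec \<eta>) = \<kappa> \<eta>"
  obtains e K W' \<Phi> where "0 < e" "0 \<le> K" "open W'" "continuous_on W' \<Phi>"
    "\<And>a w c. a + w *s c \<in> W' \<Longrightarrow> (\<lambda>w. \<Phi> (a + w *s c)) field_differentiable (at w)"
    "\<And>\<eta> v. \<eta> \<in> closure E \<inter> body \<Longrightarrow> norm (v - cvec \<eta>) \<le> e \<Longrightarrow> v \<in> W' \<and> norm (\<Phi> v) \<le> K"
    "AE \<eta> in lebesgue. \<eta> \<in> E \<inter> body \<longrightarrow> \<Phi> (cvec \<eta>) = green \<kappa>\<^sub>0 (x - \<eta>) * contrast \<kappa>\<^sub>0 \<kappa> \<eta>"
proof -
  define W' where "W' = W \<inter> {v. 0 < Re (dist_sq x v)}"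
  define \<Phi> where "\<Phi> v = green_sq \<kappa>\<^sub>0 (dist_sq x v) * ((g v)\<^sup>2 - of_real (\<kappa>\<^sub>0\<^sup>2))" for v
  have W': "open W'"
    unfolding W'_def by (intro open_Int W open_dist_sq)
  have c: "continuous_on W' \<Phi>"
    unfolding \<Phi>_def[abs_def]
    by (intro continuous_intros continuous_on_subset[OF continuous_green_dist_sq[OF \<kappa>\<^sub>0]]
        continuous_on_subset[OF holomorphic_Cn_continuous_on[OF g]]) (auto simp: W'_def)
  have line: "(\<lambda>w. \<Phi> (a + w *s c)) field_differentiable (at w)" if "a + w *s c \<in> W'" for a w c
    unfolding \<Phi>_def using that
    by (intro field_differentiable_mult field_differentiable_diff field_differentiable_power
        field_differentiable_const green_dist_sq_line[OF \<kappa>\<^sub>0] holomorphic_Cn_line[OF g]) (auto simp: W'_def)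
  have pos: "0 < Re (dist_sq x (cvec \<eta>))" if "\<eta> \<in> body" for \<eta>
  proof -
    have "x \<noteq> \<eta>"
      using body(2) that by auto
    then have "0 < (norm (x - \<eta>))\<^sup>2"
      by simp
    then show ?thesis
      by (simp only: dist_sq_cvec Re_complex_of_real)
  qed
  have "continuous_on A (cvec :: real^2 \<Rightarrow> complex^2)" for A
    using linear_continuous_on[OF bounded_linear_scalar_cvec[of 1]] by simp
  then have C: "compact (cvec ` (closure E \<inter> body))"
    using E body(1) by (intro compact_continuous_image compact_Int_closed closed_Int_compact closed_closure)
  have CW: "cvec ` (closure E \<inter> body) \<subseteq> W'"
    using W(2) pos by (auto simp: W'_def)
  obtain e K where eK: "0 < e" "0 \<le> K"
    "\<And>c v. c \<in> cvec ` (closure E \<inter> body) \<Longrightarrow> norm (v - c) \<le> e \<Longrightarrow> v \<in> W' \<and> norm (\<Phi> v) \<le> K"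
    using compact_neighborhood_bound[OF C CW W' c] by blast
  have "AE \<eta> in lebesgue. \<eta> \<in> E \<inter> body \<longrightarrow> \<Phi> (cvec \<eta>) = green \<kappa>\<^sub>0 (x - \<eta>) * contrast \<kappa>\<^sub>0 \<kappa> \<eta>"
    using AE
  proof eventually_elim
    case (elim \<eta>)
    show ?case
    proof
      assume \<eta>: "\<eta> \<in> E \<inter> body"
      then have "x - \<eta> \<noteq> 0"
        using body(2) by auto
      then show "\<Phi> (cvec \<eta>) = green \<kappa>\<^sub>0 (x - \<eta>) * contrast \<kappa>\<^sub>0 \<kappa> \<eta>"
        using elim \<eta> by (simp add: \<Phi>_def contrast_def dist_sq_cvec green_eq_green_sq[OF \<kappa>\<^sub>0])
    qed
  qed
  then show ?thesis
    using that[OF eK(1,2) W' c line] eK(3) by blast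
qed

theorem corollary5p3:
  fixes \<rho>h :: "real \<Rightarrow> real" and \<rho> :: "nat \<Rightarrow> real \<Rightarrow> real" and b :: "nat \<Rightarrow> real"
    and p \<kappa>\<^sub>0 \<delta> h h\<^sub>0 :: real
    and D \<Omega> :: "(real^2) set" and T :: "(real^2 \<Rightarrow> real^2) set"
    and M :: nat and Dp DH :: "nat \<Rightarrow> (real^2) set"
    and \<kappa> uinc :: "real^2 \<Rightarrow> complex"
    and \<F> :: "(real^2) set set set" and \<T> :: "(real^2) set set" and x :: "real^2"
  assumes radii: "admissible_radii \<rho>h \<rho>"
    and b: "b = (\<lambda>j. W1inf_per_norm (\<rho> j))"
    and D: "D = interior (polar_body \<rho>h)"
    and T: "T = affine_transformation \<rho>h \<rho> ` param_cube"
    and AT: "assumption_T D T"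
    and AP: "assumption_P D T M Dp"
    and AK: "assumption_K T M Dp DH \<kappa>"
    and wavenumber: "0 < \<kappa>\<^sub>0"
    and incident: "helmholtz_solution \<kappa>\<^sub>0 uinc" "entire_field uinc"
    and p: "0 < p" "p < 1" "summable_p p b"
    and Omega: "bounded \<Omega>" "lipschitz_domain \<Omega>"
    and exterior: "\<And>y. y \<in> param_cube \<Longrightarrow> frontier \<Omega> \<inter> polar_body (param_radius \<rho>h \<rho> y) = {}"
    and meshes: "regular_mesh_family D \<F>"
    and threshold: "mesh_threshold D T \<kappa>\<^sub>0 (contrast \<kappa>\<^sub>0 \<kappa>) uinc \<F> \<delta> h\<^sub>0"
    and mesh: "\<T> \<in> \<F>" "h = mesh_size \<T>" "0 < h" "h < h\<^sub>0"
    and x: "x \<in> frontier \<Omega>"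
  shows "\<exists>\<epsilon>>0. parametric_holomorphic b p \<epsilon>
    (\<lambda>y. let r = affine_transformation \<rho>h \<rho> y;
             u = push D r (discrete_solution D \<kappa>\<^sub>0 (contrast \<kappa>\<^sub>0 \<kappa>) uinc \<T> r)
         in volume_potential \<kappa>\<^sub>0 (contrast \<kappa>\<^sub>0 \<kappa>) (r ` D) u x)"
proof -
  obtain rmin rmax where rm: "0 < rmin" "\<And>t. summable (\<lambda>j. \<bar>\<rho> j t\<bar>)"
      "\<And>t. rmin \<le> \<rho>h t - (\<Sum>j. \<bar>\<rho> j t\<bar>)" "\<And>t. \<rho>h t + (\<Sum>j. \<bar>\<rho> j t\<bar>) \<le> rmax"
    and W: "\<rho>h \<in> W1inf_per" "\<And>j. \<rho> j \<in> W1inf_per"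
    using radii unfolding admissible_radii_def by blast
  have S0: "0 \<le> (\<Sum>j. \<bar>\<rho> j t\<bar>)" for t
    by (intro suminf_nonneg rm(2)) simp
  have rh: "rmin \<le> \<rho>h t" "\<rho>h t \<le> rmax" for t
    using rm(3,4)[of t] S0[of t] by linarith+
  have rh_pos: "0 < \<rho>h t" for t
    using rh(1)[of t] rm(1) by linarith
  have b_nonneg: "0 \<le> b j" for j
    using W1inf_per_bounds(1)[OF W(2)[of j], of 0] unfolding b by linarith
  have D_sub: "D \<subseteq> polar_body \<rho>h"
    unfolding D by (rule interior_subset)
  have D_le: "norm \<xi> \<le> \<rho>h (polar_angle \<xi>)" if "\<xi> \<in> D" for \<xi>
    by (rule polar_body_norm_le) (use D_sub that rh_pos in auto)
  have bounded_D: "bounded D"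
    unfolding bounded_iff using D_le rh(2) order_trans by blast
  have open_D: "open D"
    by (simp add: D)
  interpret R: radial_family \<rho>h \<rho> b rmin rmax "W1inf_per_norm \<rho>h" D
  proof
    show "summable b"
      by (rule summable_of_summable_p[OF p(3,1,2) b_nonneg])
  qed (use W1inf_per_bounds[OF W(1)] W1inf_per_bounds[OF W(2)] W rm(1) rh open_D bounded_D D_le
      in \<open>auto simp: b W1inf_per_def\<close>)
  have T_W1inf: "affine_transformation \<rho>h \<rho> y \<in> W1inf D" if "y \<in> param_cube" for y
    using AT T that by (auto simp: assumption_T_def compact_W1inf_def)
  have pr: "rmin \<le> param_radius \<rho>h \<rho> y t" "param_radius \<rho>h \<rho> y t \<le> rmax" if "y \<in> param_cube" for y t
  proof -
    have "norm (\<Sum>j. y j * \<rho> j t) \<le> (\<Sum>j. \<bar>\<rho> j t\<bar>)"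
      using R.param_cube_abs_le[OF that]
      by (intro norm_suminf_le rm(2)) (auto simp: abs_mult intro!: mult_left_le_one_le)
    then show "rmin \<le> param_radius \<rho>h \<rho> y t" "param_radius \<rho>h \<rho> y t \<le> rmax"
      using rm(3,4)[of t] by (auto simp: param_radius_def abs_le_iff)
  qed
  \<comment> \<open>The difference of the transformations at the \<open>k\<close>-th unit parameter
    and at zero, both members of \<open>T\<close>.\<close>
  have basis: "R.basis_field k \<in> W1inf D" for k
  proof -
    define e where "e j = (if j = k then 1 else 0 :: real)" for j
    have e: "e \<in> param_cube" "(\<lambda>j. 0) \<in> param_cube"
      by (auto simp: param_cube_def e_def)
    have "(\<lambda>j. e j * \<rho> j t) = (\<lambda>j. if j = k then \<rho> k t else 0)" for t
      by (auto simp: e_def)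
    then have "(\<Sum>j. e j * \<rho> j t) = \<rho> k t" for t
      using sums_unique[OF sums_single[of k "\<lambda>j. \<rho> k t"]] by simp
    then have eq: "affine_transformation \<rho>h \<rho> e \<xi> + - affine_transformation \<rho>h \<rho> (\<lambda>j. 0) \<xi> = R.basis_field k \<xi>" for \<xi>
      by (simp add: affine_transformation_def param_radius_def R.basis_field_def R.ratio_def
          add_divide_distrib scaleR_add_left)
    have "(\<lambda>\<xi>. - affine_transformation \<rho>h \<rho> (\<lambda>j. 0) \<xi>) \<in> W1inf D"
      by (rule W1inf_bounded_linear[OF T_W1inf[OF e(2)] open_D bounded_D bounded_linear_minus[OF bounded_linear_ident]])
    then have "(\<lambda>\<xi>. affine_transformation \<rho>h \<rho> e \<xi> + - affine_transformation \<rho>h \<rho> (\<lambda>j. 0) \<xi>) \<in> W1inf D"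
      by (rule W1inf_add[OF T_W1inf[OF e(1)] _ open_D bounded_D])
    then show ?thesis
      by (simp only: eq)
  qed
  have \<delta>: "0 < \<delta>"
    and ext: "bounded_holomorphic_extension D T \<delta> \<T> (discrete_solution D \<kappa>\<^sub>0 (contrast \<kappa>\<^sub>0 \<kappa>) uinc \<T>)"
    using threshold mesh by (auto simp: mesh_threshold_def)
  obtain U where U0: "(\<forall>r\<in>T. U (\<lambda>x. cvec (r x)) = discrete_solution D \<kappa>\<^sub>0 (contrast \<kappa>\<^sub>0 \<kappa>) uinc \<T> r) \<and>
     (\<forall>v\<in>complex_neighborhood D T \<delta>. U v \<in> Vh D \<T> \<and> frechet_differentiable_W1inf D \<T> U v) \<and>
     (\<exists>B. \<forall>v\<in>complex_neighborhood D T \<delta>. Vh_norm D (U v) \<le> B)"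
    using ext unfolding bounded_holomorphic_extension_def by (elim exE) (rule that)
  note U = U0[THEN conjunct1, rule_format] and U_nbhd = U0[THEN conjunct2, THEN conjunct1, rule_format]
  obtain B0 where B0: "\<forall>v\<in>complex_neighborhood D T \<delta>. Vh_norm D (U v) \<le> B0"
    using U0[THEN conjunct2, THEN conjunct2] by (elim exE) (rule that)
  have x_body: "x \<notin> R.outer_body"
    by (rule R.notin_outer_body) (use exterior x in blast)
  \<comment> \<open>Packs the conclusions of \<open>green_contrast_extension\<close> into one
    predicate, so that a single choice yields families indexed by \<open>i\<close>.\<close>
  define Q where "Q i e K W \<Phi> \<longleftrightarrow> 0 < e \<and> 0 \<le> K \<and> open W \<and> continuous_on W \<Phi> \<and>
    (\<forall>a w c. a + w *s c \<in> W \<longrightarrow> (\<lambda>w. \<Phi> (a + w *s c)) field_differentiable (at w)) \<and>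
    (\<forall>\<eta> v. \<eta> \<in> closure (DH i) \<inter> R.outer_body \<longrightarrow> norm (v - cvec \<eta>) \<le> e \<longrightarrow> v \<in> W \<and> norm (\<Phi> v) \<le> K) \<and>
    (AE \<eta> in lebesgue. \<eta> \<in> DH i \<inter> R.outer_body \<longrightarrow>
      \<Phi> (cvec \<eta>) = green \<kappa>\<^sub>0 (x - \<eta>) * contrast \<kappa>\<^sub>0 \<kappa> \<eta>)"
    for i :: nat and e K :: real and W :: "(complex^2) set" and \<Phi> :: "complex^2 \<Rightarrow> complex"
  have "\<forall>i\<in>{1..M}. \<exists>e K W \<Phi>. Q i e K W \<Phi>"
  proof
    fix i assume i: "i \<in> {1..M}"
    then obtain W0 g where W0: "open W0" "cvec ` closure (DH i) \<subseteq> W0" "holomorphic_Cn g W0"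
        "AE \<eta>\<in>DH i in lebesgue. g (cvec \<eta>) = \<kappa> \<eta>"
      using AK unfolding assumption_K_def by blast
    have "bounded (DH i)"
      using AK i by (auto simp: assumption_K_def)
    show "\<exists>e K W \<Phi>. Q i e K W \<Phi>"
    proof (rule green_contrast_extension[OF wavenumber R.compact_outer_body x_body \<open>bounded (DH i)\<close> W0])
      fix e K W \<Phi>
      assume "0 < e" "0 \<le> K" "open W" "continuous_on W \<Phi>"
        and "\<And>a w c. a + w *s c \<in> W \<Longrightarrow> (\<lambda>w. \<Phi> (a + w *s c)) field_differentiable (at w)"
        and "\<And>\<eta> v. \<eta> \<in> closure (DH i) \<inter> R.outer_body \<Longrightarrow> norm (v - cvec \<eta>) \<le> e \<Longrightarrow> v \<in> W \<and> norm (\<Phi> v) \<le> K"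
        and "AE \<eta> in lebesgue. \<eta> \<in> DH i \<inter> R.outer_body \<longrightarrow>
          \<Phi> (cvec \<eta>) = green \<kappa>\<^sub>0 (x - \<eta>) * contrast \<kappa>\<^sub>0 \<kappa> \<eta>"
      then have "Q i e K W \<Phi>"
        unfolding Q_def by (intro conjI allI impI; blast)
      then show ?thesis
        by (intro exI)
    qed
  qed
  then obtain e K W \<Phi> where "\<And>i. i \<in> {1..M} \<Longrightarrow> Q i (e i) (K i) (W i) (\<Phi> i)"
    by metis
  then have e: "\<And>i. i \<in> {1..M} \<Longrightarrow> 0 < e i" and K: "\<And>i. i \<in> {1..M} \<Longrightarrow> 0 \<le> K i"
    and W: "\<And>i. i \<in> {1..M} \<Longrightarrow> open (W i)" "\<And>i. i \<in> {1..M} \<Longrightarrow> continuous_on (W i) (\<Phi> i)"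
    and line: "\<And>i a w c. i \<in> {1..M} \<Longrightarrow> a + w *s c \<in> W i \<Longrightarrow>
      (\<lambda>w. \<Phi> i (a + w *s c)) field_differentiable (at w)"
    and \<Phi>_bound: "\<And>i \<eta> v. i \<in> {1..M} \<Longrightarrow> \<eta> \<in> closure (DH i) \<inter> R.outer_body \<Longrightarrow> norm (v - cvec \<eta>) \<le> e i \<Longrightarrow>
      v \<in> W i \<and> norm (\<Phi> i v) \<le> K i"
    and \<Phi>_real: "\<And>i. i \<in> {1..M} \<Longrightarrow> AE \<eta> in lebesgue. \<eta> \<in> DH i \<inter> R.outer_body \<longrightarrow>
      \<Phi> i (cvec \<eta>) = green \<kappa>\<^sub>0 (x - \<eta>) * contrast \<kappa>\<^sub>0 \<kappa> \<eta>"
    unfolding Q_def by blast+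
  \<comment> \<open>\<open>\<delta> / (2 * R.nbhd_const)\<close> keeps the complex maps in the
    neighborhood where the discrete solution extends, \<open>e i\<close> keeps their values in the
    domain of \<open>\<Phi> i\<close>. The inserted element makes the set nonempty whatever
    \<open>M\<close> is.\<close>
  define \<epsilon> where "\<epsilon> = Min (insert (\<delta> / (2 * R.nbhd_const)) (e ` {1..M}))"
  have \<epsilon>_pos: "0 < \<epsilon>"
    unfolding \<epsilon>_def using e \<delta> R.nbhd_const_pos by (subst Min_gr_iff) auto
  have \<epsilon>_le: "\<epsilon> \<le> e i" if "i \<in> {1..M}" for i
    unfolding \<epsilon>_def using that by (intro Min_le) auto
  have "\<epsilon> \<le> \<delta> / (2 * R.nbhd_const)"
    unfolding \<epsilon>_def by (intro Min_le) auto
  then have "R.nbhd_const * \<epsilon> \<le> \<delta> / 2"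
    using R.nbhd_const_pos by (simp add: field_simps)
  then have \<epsilon>_\<delta>: "R.nbhd_const * \<epsilon> < \<delta>"
    using \<delta> by linarith
  have nbhd: "R.zmap z \<in> complex_neighborhood D T \<delta>" if near: "R.near \<epsilon> z y" for z y
  proof -
    have y: "y \<in> param_cube"
      using near by (simp add: R.near_def)
    have "W1inf_norm D (\<lambda>\<xi>. R.zmap z \<xi> - cvec (affine_transformation \<rho>h \<rho> y \<xi>)) < \<delta>"
      using R.near_zmap(2)[OF basis T_W1inf near] \<epsilon>_\<delta> by simp
    then show ?thesis
      unfolding complex_neighborhood_def using R.near_zmap(1)[OF basis T_W1inf near] y T by blast
  qed
  have part: "domain_partition D M Dp" "\<And>r. r \<in> T \<Longrightarrow> domain_partition (r ` D) M (\<lambda>i. r ` Dp i)"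
    using AP by (auto simp: assumption_P_def)
  have Dp: "open (Dp i)" "Dp i \<subseteq> D" if i: "i \<in> {1..M}" for i
  proof -
    show op: "open (Dp i)"
      using part(1) i by (auto simp: domain_partition_def lipschitz_domain_def)
    \<comment> \<open>An open set inside the union of the closures lies in the interior of that
      union, which is \<open>D\<close>.\<close>
    have "Dp i \<subseteq> interior (\<Union>i\<in>{1..M}. closure (Dp i))"
      using i closure_subset[of "Dp i"] by (intro interior_maximal op) blast
    then show "Dp i \<subseteq> D"
      using part(1) by (simp add: domain_partition_def)
  qed
  have body: "affine_transformation \<rho>h \<rho> y \<xi> \<in> R.outer_body" if "y \<in> param_cube" "\<xi> \<in> D" for y \<xi>
    using R.affine_in_outer_body[OF that] pr(1)[OF that(1)] rm(1) by (meson less_imp_le order_trans)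
  have DH: "affine_transformation \<rho>h \<rho> y \<xi> \<in> closure (DH i)"
    if "y \<in> param_cube" "i \<in> {1..M}" "\<xi> \<in> Dp i" for y i \<xi>
  proof -
    have "(\<Union>r\<in>T. r ` Dp i) \<subseteq> closure (DH i)"
      using AK that(2) unfolding assumption_K_def by blast
    then show ?thesis
      using that(1,3) unfolding T by blast
  qed
  \<comment> \<open>\<open>newton_piece\<close> asks for a nonnegative bound and the sign of
    \<open>B0\<close> is unknown; hence \<open>max 0 B0\<close>.\<close>
  have piece: "newton_piece \<rho>h \<rho> b rmin rmax (W1inf_per_norm \<rho>h) D \<epsilon> (K i) (max 0 B0) (Dp i) (W i) (\<Phi> i) U \<T>"
    if i: "i \<in> {1..M}" for i
  proof (intro newton_piece.intro newton_piece_axioms.intro R.radial_family_axioms Dp[OF i] K[OF i]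
      basis W(1)[OF i] W(2)[OF i] line[OF i])
    show "R.zmap z \<xi> \<in> W i \<and> norm (\<Phi> i (R.zmap z \<xi>)) \<le> K i" if "R.near \<epsilon> z y" "\<xi> \<in> Dp i" for z y \<xi>
    proof -
      have y: "y \<in> param_cube"
        using that by (simp add: R.near_def)
      have \<xi>: "\<xi> \<in> D"
        using that Dp[OF i] by blast
      have "norm (R.zmap z \<xi> - cvec (affine_transformation \<rho>h \<rho> y \<xi>)) \<le> e i"
        using R.near_zmap(3)[OF basis T_W1inf that(1) \<xi>] \<epsilon>_le[OF i] by linarith
      then show ?thesis
        using body[OF y \<xi>] DH[OF y i that(2)] by (intro \<Phi>_bound[OF i]) auto
    qed
    fix z y assume near: "R.near \<epsilon> z y"
    show "U (R.zmap z) \<in> Vh D \<T>" "frechet_differentiable_W1inf D \<T> U (R.zmap z)"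
      using U_nbhd[OF nbhd[OF near]] by auto
    show "norm (U (R.zmap z) \<xi>) \<le> max 0 B0" if "\<xi> \<in> D" for \<xi>
    proof -
      have "norm (U (R.zmap z) \<xi>) \<le> Vh_norm D (U (R.zmap z))"
        using U_nbhd[OF nbhd[OF near]] that closure_subset[of D]
        by (intro Vh_norm_ge[OF bounded_D]) (auto simp: Vh_def)
      then show ?thesis
        using bspec[OF B0 nbhd[OF near]] by linarith
    qed
  qed simp
  define G where "G i z \<xi> = \<Phi> i (R.zmap z \<xi>) * (R.zratio z (polar_angle \<xi>))\<^sup>2 * U (R.zmap z) \<xi>" for i z \<xi>
  have G: "newton_piece.integrand \<rho>h \<rho> (\<Phi> i) U = G i" if "i \<in> {1..M}" for i
    using newton_piece.integrand_def[OF piece[OF that]] by (simp add: G_def fun_eq_iff)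
  define V where "V z = (\<Sum>i\<in>{1..M}. LINT \<xi>:Dp i|lebesgue. G i z \<xi>)" for z
  define F where "F = (\<lambda>y. let r = affine_transformation \<rho>h \<rho> y;
             u = push D r (discrete_solution D \<kappa>\<^sub>0 (contrast \<kappa>\<^sub>0 \<kappa>) uinc \<T> r)
         in volume_potential \<kappa>\<^sub>0 (contrast \<kappa>\<^sub>0 \<kappa>) (r ` D) u x)"
  have F_eq: "F y = V (\<lambda>j. of_real (y j))" if y: "y \<in> param_cube" for y
  proof -
    define r where "r = affine_transformation \<rho>h \<rho> y"
    define \<zeta> where "\<zeta> = (\<lambda>j. complex_of_real (y j))"
    have near: "R.near \<epsilon> \<zeta> y"
      unfolding \<zeta>_def using y \<epsilon>_pos by (intro R.near_self) auto
    have rT: "r \<in> T"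
      using y by (simp add: T r_def)
    have zr: "R.zmap \<zeta> = (\<lambda>\<xi>. cvec (r \<xi>))"
      using R.zmap_real[OF y] by (simp add: fun_eq_iff \<zeta>_def r_def)
    define u where "u = discrete_solution D \<kappa>\<^sub>0 (contrast \<kappa>\<^sub>0 \<kappa>) uinc \<T> r"
    have Uu: "U (R.zmap \<zeta>) = u"
      using U[OF rT] by (simp add: zr u_def)
    \<comment> \<open>The integrand on the reference domain without the Jacobian: the indicators of
      the disjoint pieces glue the local extensions together, with value zero on the
      interfaces.\<close>
    define k where "k \<xi> = (\<Sum>i\<in>{1..M}. indicator (Dp i) \<xi> *\<^sub>R (\<Phi> i (R.zmap \<zeta> \<xi>) * U (R.zmap \<zeta>) \<xi>))" for \<xi>
    have k_borel: "k \<in> borel_measurable borel"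
      unfolding k_def using newton_piece.piece_factor_measurable[OF piece near]
      by (intro borel_measurable_sum) auto
    have k_D: "\<xi> \<in> D" if "k \<xi> \<noteq> 0" for \<xi>
    proof (rule ccontr)
      assume "\<xi> \<notin> D"
      then have "k \<xi> = 0"
        unfolding k_def using Dp(2) by (intro sum.neutral ballI) (auto simp: indicator_def)
      with that show False
        by simp
    qed
    have inj: "inj_on r D"
      using AT rT by (auto simp: assumption_T_def)
    have k_piece: "k \<xi> = \<Phi> i (cvec (r \<xi>)) * u \<xi>" if i: "i \<in> {1..M}" and \<xi>: "\<xi> \<in> Dp i" for i \<xi>
    proof -
      have "\<xi> \<in> Dp j \<longleftrightarrow> j = i" if "j \<in> {1..M}" for j
      proof
        have disj: "disjoint_family_on Dp {1..M}"
          using part(1) by (simp add: domain_partition_def)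
        show "j = i" if "\<xi> \<in> Dp j"
          using disjoint_family_onD[OF disj \<open>j \<in> {1..M}\<close> i] that \<xi> by blast
      qed (use \<xi> in simp)
      then have "k \<xi> = (\<Sum>j\<in>{1..M}. if j = i then \<Phi> i (R.zmap \<zeta> \<xi>) * U (R.zmap \<zeta>) \<xi> else 0)"
        unfolding k_def by (intro sum.cong) (auto simp: indicator_def)
      then show ?thesis
        using i by (simp add: zr[THEN fun_cong] Uu)
    qed
    \<comment> \<open>Three null sets are discarded for each piece: the boundary of its image, the
      boundary of \<open>DH i\<close>, and the points of \<open>DH i\<close> in the body where the
      extension is wrong.\<close>
    have A: "AE \<eta> in lebesgue. \<forall>i\<in>{1..M}. \<eta> \<notin> frontier (r ` Dp i) \<and> \<eta> \<notin> frontier (DH i) \<and>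
      (\<eta> \<in> DH i \<inter> R.outer_body \<longrightarrow> \<Phi> i (cvec \<eta>) = green \<kappa>\<^sub>0 (x - \<eta>) * contrast \<kappa>\<^sub>0 \<kappa> \<eta>)"
    proof (intro AE_finite_allI AE_conjI \<Phi>_real)
      fix i assume i: "i \<in> {1..M}"
      show "AE \<eta> in lebesgue. \<eta> \<notin> frontier (r ` Dp i)"
        using part(2)[OF rT] i
        by (intro negligible_AE negligible_frontier_lipschitz_domain) (auto simp: domain_partition_def)
      show "AE \<eta> in lebesgue. \<eta> \<notin> frontier (DH i)"
        using AK i by (intro negligible_AE negligible_frontier_lipschitz_domain) (auto simp: assumption_K_def)
    qed auto
    have AE: "AE \<eta> in lebesgue. \<forall>\<xi>\<in>D. \<eta> = affine_transformation \<rho>h \<rho> y \<xi> \<longrightarrow>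
        green \<kappa>\<^sub>0 (x - \<eta>) * contrast \<kappa>\<^sub>0 \<kappa> \<eta> * push D r u \<eta> = k \<xi>"
      using A
    proof eventually_elim
      case (elim \<eta>)
      show ?case
      proof (intro ballI impI)
        fix \<xi> assume \<xi>: "\<xi> \<in> D" and "\<eta> = affine_transformation \<rho>h \<rho> y \<xi>"
        then have \<eta>: "\<eta> = r \<xi>"
          by (simp add: r_def)
        have "r ` D \<subseteq> (\<Union>i\<in>{1..M}. closure (r ` Dp i))"
          using part(2)[OF rT] interior_subset by (simp add: domain_partition_def)
        then obtain i where i: "i \<in> {1..M}" "\<eta> \<in> closure (r ` Dp i)"
          using \<xi> \<eta> by blast
        \<comment> \<open>Off the boundaries \<open>\<eta>\<close> lies in the image of an open
          piece; injectivity of \<open>r\<close> on \<open>D\<close> then identifies the preimage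
          \<open>\<xi>'\<close> with \<open>\<xi>\<close>.\<close>
        then have "\<eta> \<in> interior (r ` Dp i)"
          using elim by (auto simp: frontier_def)
        then obtain \<xi>' where "\<xi>' \<in> Dp i" "\<eta> = r \<xi>'"
          using interior_subset by blast
        then have \<xi>i: "\<xi> \<in> Dp i"
          using inj_onD[OF inj, of \<xi> \<xi>'] \<xi> \<eta> Dp(2)[OF i(1)] by auto
        have "\<eta> \<in> closure (DH i)" "\<eta> \<in> R.outer_body"
          using DH[OF y i(1) \<xi>i] body[OF y \<xi>] by (simp_all add: \<eta> r_def)
        \<comment> \<open>Assumption (K) gives only the closure of \<open>DH i\<close>; the
          discarded boundary closes the gap.\<close>
        then have "\<eta> \<in> interior (DH i)"
          using elim i(1) by (auto simp: frontier_def)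
        then have "\<Phi> i (cvec \<eta>) = green \<kappa>\<^sub>0 (x - \<eta>) * contrast \<kappa>\<^sub>0 \<kappa> \<eta>"
          using elim i(1) \<open>\<eta> \<in> R.outer_body\<close> interior_subset by blast
        moreover have "push D r u \<eta> = u \<xi>"
          using inj \<xi> by (simp add: push_def \<eta> inv_into_f_f)
        ultimately show "green \<kappa>\<^sub>0 (x - \<eta>) * contrast \<kappa>\<^sub>0 \<kappa> \<eta> * push D r u \<eta> = k \<xi>"
          using k_piece[OF i(1) \<xi>i] \<eta> by simp
      qed
    qed
    have meas: "(\<lambda>\<xi>. indicator (Dp i) \<xi> *\<^sub>R G i \<zeta> \<xi>) \<in> borel_measurable borel" if "i \<in> {1..M}" for i
      using newton_piece.integrand_measurable[OF piece[OF that] near] by (simp add: G[OF that])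
    have int: "integrable lborel (\<lambda>\<xi>. indicator (Dp i) \<xi> *\<^sub>R G i \<zeta> \<xi>)" if i: "i \<in> {1..M}" for i
      using newton_piece.integrand_integrable[OF piece[OF i] near] meas[OF i]
      by (simp add: G[OF i] integrable_completion)
    have "F y = volume_potential \<kappa>\<^sub>0 (contrast \<kappa>\<^sub>0 \<kappa>) (r ` D) (push D r u) x"
      by (simp add: F_def Let_def r_def u_def)
    also have "\<dots> = (LINT \<xi>|lborel. (R.zratio \<zeta> (polar_angle \<xi>))\<^sup>2 * k \<xi>)"
      unfolding volume_potential_def r_def \<zeta>_def
      by (rule R.integral_affine_image[OF y rm(1) pr(1)[OF y] pr(2)[OF y] k_borel k_D])
        (use AE in \<open>simp_all add: r_def\<close>)
    also have "\<dots> = (LINT \<xi>|lborel. (\<Sum>i\<in>{1..M}. indicator (Dp i) \<xi> *\<^sub>R G i \<zeta> \<xi>))"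
      unfolding k_def G_def sum_distrib_left
      by (intro Bochner_Integration.integral_cong refl sum.cong) (simp add: mult_ac)
    also have "\<dots> = (\<Sum>i\<in>{1..M}. LINT \<xi>|lborel. indicator (Dp i) \<xi> *\<^sub>R G i \<zeta> \<xi>)"
      by (intro Bochner_Integration.integral_sum int)
    also have "\<dots> = V \<zeta>"
      unfolding V_def set_lebesgue_integral_def
      by (intro sum.cong refl integral_completion[symmetric]) (simp add: meas)
    finally show ?thesis
      by (simp add: \<zeta>_def)
  qed
  \<comment> \<open>The absolute value and the summand 1 ensure \<open>0 < C\<close>.\<close>
  define C where "C = \<bar>\<Sum>i\<in>{1..M}. LINT \<xi>|lebesgue. indicator (Dp i) \<xi> *
    newton_piece.integrand_bound b rmin rmax \<epsilon> (K i) (max 0 B0)\<bar> + 1"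
  have V_le: "norm (V z) \<le> C" if near: "R.near \<epsilon> z y" for z y
  proof -
    have "norm (V z) \<le> (\<Sum>i\<in>{1..M}. LINT \<xi>|lebesgue. indicator (Dp i) \<xi> *
        newton_piece.integrand_bound b rmin rmax \<epsilon> (K i) (max 0 B0))"
      unfolding V_def
    proof (rule sum_norm_le)
      fix i assume i: "i \<in> {1..M}"
      show "norm (LINT \<xi>:Dp i|lebesgue. G i z \<xi>) \<le> (LINT \<xi>|lebesgue. indicator (Dp i) \<xi> *
          newton_piece.integrand_bound b rmin rmax \<epsilon> (K i) (max 0 B0))"
        using newton_piece.integrand_integral_le[OF piece[OF i] near] by (simp add: G[OF i])
    qed
    then show ?thesis
      by (simp add: C_def)
  qed
  \<comment> \<open>\<open>y j\<close> is a point of the interval close to \<open>z j\<close>;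
    admissibility bounds the weighted sum of the distances that \<open>R.near\<close> asks
    for.\<close>
  have stadium_near: "\<exists>y. R.near \<epsilon> z y"
    if adm: "admissible_sequence b \<epsilon> \<sigma>" and z: "\<And>j. z j \<in> stadium (\<sigma> j)" for \<sigma> z
  proof -
    have "\<forall>j. \<exists>y. -1 \<le> y \<and> y \<le> 1 \<and> cmod (z j - of_real y) < \<sigma> j - 1"
      using stadium_near_interval[OF z] by metis
    then obtain y where y: "\<And>j. -1 \<le> y j" "\<And>j. y j \<le> 1" "\<And>j. cmod (z j - of_real (y j)) < \<sigma> j - 1"
      by metis
    have le: "cmod (z j - of_real (y j)) * b j \<le> (\<sigma> j - 1) * b j" for j
      using y(3)[of j] b_nonneg[of j] by (intro mult_right_mono) auto
    have s: "summable (\<lambda>j. (\<sigma> j - 1) * b j)" "(\<Sum>j. (\<sigma> j - 1) * b j) \<le> \<epsilon>"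
      using adm by (auto simp: admissible_sequence_def)
    have s': "summable (\<lambda>j. cmod (z j - of_real (y j)) * b j)"
      by (rule summable_comparison_test'[OF s(1), of 0]) (use le b_nonneg in \<open>simp add: abs_mult\<close>)
    have "(\<Sum>j. cmod (z j - of_real (y j)) * b j) \<le> \<epsilon>"
      using suminf_le[OF le s' s(1)] s(2) by linarith
    then have "R.near \<epsilon> z y"
      using s' y by (simp add: R.near_def param_cube_def)
    then show ?thesis
      by (rule exI[of _ y])
  qed
  have "parametric_holomorphic b p \<epsilon> F"
    unfolding parametric_holomorphic_def
  proof (intro conjI allI b_nonneg p(3))
    show "\<exists>B. \<forall>y\<in>param_cube. norm (F y) \<le> B"
    proof (intro exI[of _ C] ballI)
      show "norm (F y) \<le> C" if "y \<in> param_cube" for y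
        unfolding F_eq[OF that] by (rule V_le[OF R.near_self[OF that less_imp_le[OF \<epsilon>_pos]]])
    qed
    have "0 < C"
      by (simp add: C_def add_nonneg_pos)
    then show "\<exists>C>0. \<forall>\<sigma>. admissible_sequence b \<epsilon> \<sigma> \<longrightarrow>
        (\<exists>v :: (nat \<Rightarrow> complex) \<Rightarrow> complex.
           (\<forall>y\<in>param_cube. v (\<lambda>j. complex_of_real (y j)) = F y) \<and>
           (\<forall>z. (\<forall>j. z j \<in> stadium (\<sigma> j)) \<longrightarrow>
              (\<forall>j. (\<lambda>w. v (z(j := w))) holomorphic_on stadium (\<sigma> j))) \<and>
           (\<forall>z. (\<forall>j. z j \<in> bernstein_ellipse (\<sigma> j)) \<longrightarrow> norm (v z) \<le> C))"
    \<comment> \<open>One extension \<open>V\<close> and one constant \<open>C\<close> serve all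
      admissible sequences; only the domain of holomorphy depends on
      \<open>\<sigma>\<close>.\<close>
    proof (intro exI[of _ C] exI[of _ V] conjI allI impI ballI)
      show "V (\<lambda>j. complex_of_real (y j)) = F y" if "y \<in> param_cube" for y
        using F_eq[OF that] by simp
    next
      fix \<sigma> z j
      assume adm: "admissible_sequence b \<epsilon> \<sigma>" and z: "\<forall>j. z j \<in> stadium (\<sigma> j)"
      show "(\<lambda>w. V (z(j := w))) holomorphic_on stadium (\<sigma> j)"
        unfolding V_def
      proof (rule holomorphic_on_sum)
        fix i assume i: "i \<in> {1..M}"
        have "\<exists>y. R.near \<epsilon> (z(j := w)) y" if "w \<in> stadium (\<sigma> j)" for w
          using z that by (intro stadium_near[OF adm]) auto
        from newton_piece.integrand_integral_holomorphic[OF piece[OF i] open_stadium this]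
        show "(\<lambda>w. LINT \<xi>:Dp i|lebesgue. G i (z(j := w)) \<xi>) holomorphic_on stadium (\<sigma> j)"
          by (simp add: G[OF i])
      qed
    next
      fix \<sigma> z
      assume adm: "admissible_sequence b \<epsilon> \<sigma>" and z: "\<forall>j. z j \<in> bernstein_ellipse (\<sigma> j)"
      have "z j \<in> stadium (\<sigma> j)" for j
        using z adm bernstein_ellipse_subset_stadium[of "\<sigma> j"] by (auto simp: admissible_sequence_def)
      then show "norm (V z) \<le> C"
        using stadium_near[OF adm] V_le by blast
    qed
  qed
  then show ?thesis
    unfolding F_def using \<epsilon>_pos by blast
qed

end
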